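(* $\mathrm{regRD}\equiv\mathrm{regWRD}\le\mathrm{regRTI}\le\mathrm{regRTL}\le\mathrm{regWRTL}\le\mathrm{RD}$ and $\mathrm{regRTI}\le\mathrm{regWRTI}\le\mathrm{regWRTL}$.
   Context: Clauses are finite sets of literals; $\Box$ is the empty clause. Resolution: from $C_0\ni x$ and $C_1\ni\overline x$ infer $(C_0\setminus\{x\})\cup(C_1\setminus\{\overline x\})$. W-resolution: from arbitrary $C_0,C_1$ and a variable $x$ infer $(C_0\setminus\{x\})\cup(C_1\setminus\{\overline x\})$. RD: a finite dag of clause-labeled nodes with a unique out-degree-$0$ node (the conclusion); in-degree-$0$ nodes labeled by initial clauses; every other node has in-degree $2$ and is labeled by a variable $x$ and the resolvent on $x$ of its predecessors' clauses. WRD: same with w-resolution. regRD / regWRD: those in which for every variable $x$ every path contains at most one node labeled $x$. RTL: an ordered binary tree $T$ with post-order $<_T$ (nodes of the left subtree of $u$ precede those of the right subtree, which precede $u$) where each leaf $v$ is labeled by an initial clause or by a clause labeling some node $u<_T v$ (a lemma), each internal node is labeled by a variable $x$ and the resolvent on $x$ of its children's clauses, the root being the conclusion. WRTL: same with w-resolution. An input resolution tree is a tree using only (genuine) resolution in which every internal node has at least one leaf child; a node $v$ of $T$ is input-derived if the subtree rooted at $v$ is an input resolution tree. RTI (resp. WRTI): an RTL (resp. WRTL) in which every leaf $v$ not labeled by an initial clause is labeled by a clause labeling some input-derived node $u<_T v$. The prefix "reg" means regular: no path in the tree from a leaf to the root contains two nodes whose (w-)resolution inferences are on the same variable. Refutation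 = proof of $\Box$; size = number of nodes. For refutation systems $Q,R$: $R$ p-simulates $Q$ if there are a polynomial $p$ and a polynomial-time procedure converting every $Q$-refutation of size $n$ of any set $F$ of clauses into an $R$-refutation of $F$ of size at most $p(n)$. $Q\le R$ means $R$ p-simulates $Q$; $Q\equiv R$ means $Q\le R$ and $R\le Q$. *)

theory Defs
  imports "HOL-Library.FSet" "HOL-Computational_Algebra.Polynomial"
begin

section \<open>Clauses and inference rules\<close>

type_synonym var = nat

datatype literal = Pos var | Neg var

text \<open>Clauses are finite by type; tautological clauses are not excluded.\<close>

type_synonym clause = "literal fset"

text \<open>\<open>R x C\<^sub>0 C\<^sub>1 D\<close>: the rule \<open>R\<close> infers \<open>D\<close> from \<open>C\<^sub>0\<close> and \<open>C\<^sub>1\<close> on the variable \<open>x\<close>.\<close>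

type_synonym inference_rule = "var \<Rightarrow> clause \<Rightarrow> clause \<Rightarrow> clause \<Rightarrow> bool"

definition w_resolution :: inference_rule where
  "w_resolution x C0 C1 D \<longleftrightarrow> D = (C0 |-| {|Pos x|}) |\<union>| (C1 |-| {|Neg x|})"

definition resolution :: inference_rule where
  "resolution x C0 C1 D \<longleftrightarrow> Pos x |\<in>| C0 \<and> Neg x |\<in>| C1 \<and> w_resolution x C0 C1 D"

text \<open>The order of the predecessors of a node does not determine which of the two plays the role
  of \<open>C\<^sub>0\<close>. This matters for the ordered trees below, where that order fixes which lemmas are
  available.\<close>

definition infers :: "inference_rule \<Rightarrow> var \<Rightarrow> clause \<Rightarrow> clause \<Rightarrow> clause \<Rightarrow> bool" where
  "infers R x C C' D \<longleftrightarrow> R x C C' D \<or> R x C' C D"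


section \<open>Dag-like derivations\<close>

text \<open>Edges run from premises to consequences. Nodes are named by arbitrary natural numbers.\<close>

record dag =
  nodes :: "nat set"
  edges :: "(nat \<times> nat) set"
  clause_of :: "nat \<Rightarrow> clause"
  var_of :: "nat \<Rightarrow> var option"

definition preds :: "dag \<Rightarrow> nat \<Rightarrow> nat set" where
  "preds G u = {p. (p, u) \<in> edges G}"

definition succs :: "dag \<Rightarrow> nat \<Rightarrow> nat set" where
  "succs G u = {s. (u, s) \<in> edges G}"

definition dag_derivation :: "inference_rule \<Rightarrow> clause set \<Rightarrow> dag \<Rightarrow> clause \<Rightarrow> bool" where
  "dag_derivation R F G C \<longleftrightarrow>
     finite (nodes G) \<and> edges G \<subseteq> nodes G \<times> nodes G \<and> acyclic (edges G) \<and>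
     (\<exists>r. {u \<in> nodes G. succs G u = {}} = {r} \<and> clause_of G r = C) \<and>
     (\<forall>u \<in> nodes G.
        (preds G u = {} \<and> var_of G u = None \<and> clause_of G u \<in> F) \<or>
        (\<exists>p q x. p \<noteq> q \<and> preds G u = {p, q} \<and> var_of G u = Some x \<and>
           infers R x (clause_of G p) (clause_of G q) (clause_of G u)))"

definition dag_path :: "dag \<Rightarrow> nat list \<Rightarrow> bool" where
  "dag_path G us \<longleftrightarrow> us \<noteq> [] \<and> set us \<subseteq> nodes G \<and> successively (\<lambda>u w. (u, w) \<in> edges G) us"

definition regular_dag :: "dag \<Rightarrow> bool" where
  "regular_dag G \<longleftrightarrow>
     (\<forall>x us. dag_path G us \<longrightarrow> length (filter (\<lambda>u. var_of G u = Some x) us) \<le> 1)"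


section \<open>Resolution trees with lemmas\<close>

text \<open>In \<open>Infer x C l r\<close>, \<open>C\<close> is the clause and \<open>x\<close> the variable labeling the node, and \<open>l\<close>, \<open>r\<close>
  are its left and right subtrees.\<close>

datatype rtree = Leaf clause | Infer var clause rtree rtree

primrec conclusion :: "rtree \<Rightarrow> clause" where
  "conclusion (Leaf C) = C"
| "conclusion (Infer x C l r) = C"

text \<open>The nodes in post-order, each represented by the subtree rooted at it; distinct
  positions of the list are distinct nodes, even if the subtrees are equal.\<close>

primrec postorder :: "rtree \<Rightarrow> rtree list" where
  "postorder (Leaf C) = [Leaf C]"
| "postorder (Infer x C l r) = postorder l @ postorder r @ [Infer x C l r]"

primrec correct_inferences :: "inference_rule \<Rightarrow> rtree \<Rightarrow> bool" where
  "correct_inferences R (Leaf C) \<longleftrightarrow> True"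
| "correct_inferences R (Infer x C l r) \<longleftrightarrow>
     infers R x (conclusion l) (conclusion r) C \<and> correct_inferences R l \<and> correct_inferences R r"

fun is_leaf :: "rtree \<Rightarrow> bool" where
  "is_leaf (Leaf C) \<longleftrightarrow> True"
| "is_leaf (Infer x C l r) \<longleftrightarrow> False"

primrec has_input_shape :: "rtree \<Rightarrow> bool" where
  "has_input_shape (Leaf C) \<longleftrightarrow> True"
| "has_input_shape (Infer x C l r) \<longleftrightarrow>
     (is_leaf l \<or> is_leaf r) \<and> has_input_shape l \<and> has_input_shape r"

definition input_resolution_tree :: "rtree \<Rightarrow> bool" where
  "input_resolution_tree T \<longleftrightarrow> correct_inferences resolution T \<and> has_input_shape T"

text \<open>\<open>L\<close> tells which nodes may be used as lemmas.\<close>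

definition tree_derivation ::
    "inference_rule \<Rightarrow> (rtree \<Rightarrow> bool) \<Rightarrow> clause set \<Rightarrow> rtree \<Rightarrow> clause \<Rightarrow> bool" where
  "tree_derivation R L F T C \<longleftrightarrow>
     conclusion T = C \<and> correct_inferences R T \<and>
     (\<forall>i < length (postorder T). \<forall>D. postorder T ! i = Leaf D \<longrightarrow>
        D \<in> F \<or> (\<exists>j < i. L (postorder T ! j) \<and> conclusion (postorder T ! j) = D))"

text \<open>The variables of the inferences on each path between the root and a leaf.\<close>

primrec branches :: "rtree \<Rightarrow> var list set" where
  "branches (Leaf C) = {[]}"
| "branches (Infer x C l r) = (#) x ` (branches l \<union> branches r)"

definition regular_tree :: "rtree \<Rightarrow> bool" where
  "regular_tree T \<longleftrightarrow> (\<forall>xs \<in> branches T. distinct xs)"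


section \<open>Polynomial-time procedures\<close>

text \<open>
  The machine model is a deterministic first-order functional programming language, with general
  recursion, over S-expressions with a single atom. Its cost measure counts the evaluation steps,
  as for Lisp programs whose data are shared pointer structures. After \<open>t\<close> steps on an input with
  \<open>n\<close> cells at most \<open>n + t\<close> cells are allocated, so such a computation can be carried out by a
  Turing machine in time polynomial in \<open>n + t\<close> and, conversely, Turing machines are simulated
  with linear overhead. Because of sharing, a value may be exponentially larger than the number
  of steps that built it, so the size of the output is bounded separately
  in \<open>polytime_on\<close>.
\<close>

datatype val = Atom | Pair val val

primrec cells :: "val \<Rightarrow> nat" where
  "cells Atom = 1"
| "cells (Pair v w) = 1 + cells v + cells w"

datatype expr =
    Arg nat
  | AtomE
  | PairE expr expr
  | Fst expr
  | Snd expr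
  | IfE expr expr expr
  | LetE expr expr
  | Call nat "expr list"

text \<open>A program lists the bodies of its functions. Its functions are called by their index,
  and \<open>Arg i\<close> refers to the \<open>i\<close>-th entry of the environment. Function \<open>0\<close> is the main function.\<close>

type_synonym prog = "expr list"

text \<open>\<open>evaluates P env e v t\<close>: under \<open>env\<close>, \<open>e\<close> evaluates to \<open>v\<close> in \<open>t\<close> steps.\<close>

inductive
  evaluates :: "prog \<Rightarrow> val list \<Rightarrow> expr \<Rightarrow> val \<Rightarrow> nat \<Rightarrow> bool" and
  evaluates_list :: "prog \<Rightarrow> val list \<Rightarrow> expr list \<Rightarrow> val list \<Rightarrow> nat \<Rightarrow> bool"
  for P :: prog
where
  evaluates_Arg: "i < length env \<Longrightarrow> evaluates P env (Arg i) (env ! i) 1"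
| evaluates_Atom: "evaluates P env AtomE Atom 1"
| evaluates_Pair: "evaluates P env e1 v1 t1 \<Longrightarrow> evaluates P env e2 v2 t2 \<Longrightarrow>
    evaluates P env (PairE e1 e2) (Pair v1 v2) (1 + t1 + t2)"
| evaluates_Fst: "evaluates P env e (Pair v w) t \<Longrightarrow> evaluates P env (Fst e) v (1 + t)"
| evaluates_Fst_Atom: "evaluates P env e Atom t \<Longrightarrow> evaluates P env (Fst e) Atom (1 + t)"
| evaluates_Snd: "evaluates P env e (Pair v w) t \<Longrightarrow> evaluates P env (Snd e) w (1 + t)"
| evaluates_Snd_Atom: "evaluates P env e Atom t \<Longrightarrow> evaluates P env (Snd e) Atom (1 + t)"
| evaluates_If_Pair: "evaluates P env b (Pair u u') t \<Longrightarrow> evaluates P env e1 v t1 \<Longrightarrow>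
    evaluates P env (IfE b e1 e2) v (1 + t + t1)"
| evaluates_If_Atom: "evaluates P env b Atom t \<Longrightarrow> evaluates P env e2 v t2 \<Longrightarrow>
    evaluates P env (IfE b e1 e2) v (1 + t + t2)"
| evaluates_Let: "evaluates P env e1 v1 t1 \<Longrightarrow> evaluates P (v1 # env) e2 v t2 \<Longrightarrow>
    evaluates P env (LetE e1 e2) v (1 + t1 + t2)"
| evaluates_Call: "f < length P \<Longrightarrow> evaluates_list P env es vs t1 \<Longrightarrow> evaluates P vs (P ! f) v t2 \<Longrightarrow>
    evaluates P env (Call f es) v (1 + t1 + t2)"
| evaluates_list_Nil: "evaluates_list P env [] [] 0"
| evaluates_list_Cons: "evaluates P env e v t1 \<Longrightarrow> evaluates_list P env es vs t2 \<Longrightarrow>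
    evaluates_list P env (e # es) (v # vs) (t1 + t2)"

definition runs :: "prog \<Rightarrow> val \<Rightarrow> val \<Rightarrow> nat \<Rightarrow> bool" where
  "runs P v w t \<longleftrightarrow> evaluates P [v] (Call 0 [Arg 0]) w t"

definition polytime_on :: "val set \<Rightarrow> prog \<Rightarrow> bool" where
  "polytime_on D P \<longleftrightarrow>
     (\<exists>q :: nat poly. \<forall>v \<in> D. \<exists>w t. runs P v w t \<and>
        t \<le> poly q (cells v) \<and> cells w \<le> poly q (cells v))"

inductive_cases evaluates_cases:
  "evaluates P env (Arg i) v t" "evaluates P env AtomE v t" "evaluates P env (PairE e1 e2) v t"
  "evaluates P env (Fst e) v t" "evaluates P env (Snd e) v t" "evaluates P env (IfE b e1 e2) v t"
  "evaluates P env (LetE e1 e2) v t" "evaluates P env (Call f es) v t"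

inductive_cases evaluates_list_cases:
  "evaluates_list P env [] vs t" "evaluates_list P env (e # es) vs t"

lemma evaluates_deterministic_aux:
  "evaluates P env e v t \<Longrightarrow> (\<And>v' t'. evaluates P env e v' t' \<Longrightarrow> v' = v \<and> t' = t)"
  "evaluates_list P env es vs t \<Longrightarrow>
     (\<And>vs' t'. evaluates_list P env es vs' t' \<Longrightarrow> vs' = vs \<and> t' = t)"
proof (induction rule: evaluates_evaluates_list.inducts)
  case evaluates_Arg
  then show ?case by (auto elim: evaluates_cases(1))
next
  case evaluates_Atom
  then show ?case by (auto elim: evaluates_cases(2))
next
  case evaluates_Pair
  show ?case
    by (rule evaluates_cases(3)[OF evaluates_Pair.prems])
      (metis evaluates_Pair.IH val.distinct(1) val.inject plus_1_eq_Suc add_Suc)+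
next
  case evaluates_Fst
  show ?case
    by (rule evaluates_cases(4)[OF evaluates_Fst.prems])
      (metis evaluates_Fst.IH val.distinct(1) val.inject plus_1_eq_Suc add_Suc)+
next
  case evaluates_Fst_Atom
  show ?case
    by (rule evaluates_cases(4)[OF evaluates_Fst_Atom.prems])
      (metis evaluates_Fst_Atom.IH val.distinct(1) val.inject plus_1_eq_Suc add_Suc)+
next
  case evaluates_Snd
  show ?case
    by (rule evaluates_cases(5)[OF evaluates_Snd.prems])
      (metis evaluates_Snd.IH val.distinct(1) val.inject plus_1_eq_Suc add_Suc)+
next
  case evaluates_Snd_Atom
  show ?case
    by (rule evaluates_cases(5)[OF evaluates_Snd_Atom.prems])
      (metis evaluates_Snd_Atom.IH val.distinct(1) val.inject plus_1_eq_Suc add_Suc)+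
next
  case evaluates_If_Pair
  show ?case
    by (rule evaluates_cases(6)[OF evaluates_If_Pair.prems])
      (metis evaluates_If_Pair.IH val.distinct(1) val.inject plus_1_eq_Suc add_Suc)+
next
  case evaluates_If_Atom
  show ?case
    by (rule evaluates_cases(6)[OF evaluates_If_Atom.prems])
      (metis evaluates_If_Atom.IH val.distinct(1) val.inject plus_1_eq_Suc add_Suc)+
next
  case evaluates_Let
  show ?case
    by (rule evaluates_cases(7)[OF evaluates_Let.prems])
      (metis evaluates_Let.IH val.distinct(1) val.inject plus_1_eq_Suc add_Suc)+
next
  case evaluates_Call
  show ?case
    by (rule evaluates_cases(8)[OF evaluates_Call.prems])
      (metis evaluates_Call.IH val.distinct(1) val.inject plus_1_eq_Suc add_Suc)+
next
  case evaluates_list_Nil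
  then show ?case by (auto elim: evaluates_list_cases(1))
next
  case evaluates_list_Cons
  show ?case
    by (rule evaluates_list_cases(2)[OF evaluates_list_Cons.prems])
      (metis evaluates_list_Cons.IH val.distinct(1) val.inject plus_1_eq_Suc add_Suc)+
qed

lemma runs_deterministic:
  "runs P v w t \<Longrightarrow> runs P v w' t' \<Longrightarrow> w' = w \<and> t' = t"
  unfolding runs_def by (rule evaluates_deterministic_aux(1))


section \<open>Encodings\<close>

fun encode_list :: "val list \<Rightarrow> val" where
  "encode_list [] = Atom"
| "encode_list (v # vs) = Pair v (encode_list vs)"

definition encode_bool :: "bool \<Rightarrow> val" where
  "encode_bool b = (if b then Pair Atom Atom else Atom)"

text \<open>Binary notation, least significant bit first.\<close>

fun encode_nat :: "nat \<Rightarrow> val" where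
  "encode_nat n = (if n = 0 then Atom else Pair (encode_bool (odd n)) (encode_nat (n div 2)))"

declare encode_nat.simps [simp del]

fun encode_nat_option :: "nat option \<Rightarrow> val" where
  "encode_nat_option None = Atom"
| "encode_nat_option (Some n) = Pair (encode_nat n) Atom"

fun encode_literal :: "literal \<Rightarrow> val" where
  "encode_literal (Pos x) = Pair (encode_bool True) (encode_nat x)"
| "encode_literal (Neg x) = Pair (encode_bool False) (encode_nat x)"

text \<open>A finite set is encoded by any list of its elements without repetitions. Hence encodings
  of clauses and derivations are relations, and a procedure has to cope with every encoding
  of its input.\<close>

definition encodes_clause :: "val \<Rightarrow> clause \<Rightarrow> bool" where
  "encodes_clause v C \<longleftrightarrow>
     (\<exists>ls. distinct ls \<and> fset_of_list ls = C \<and> v = encode_list (map encode_literal ls))"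

definition encodes_node :: "dag \<Rightarrow> val \<Rightarrow> nat \<Rightarrow> bool" where
  "encodes_node G v u \<longleftrightarrow>
     (\<exists>c ps. encodes_clause c (clause_of G u) \<and> distinct ps \<and> set ps = preds G u \<and>
        v = encode_list
              [encode_nat u, c, encode_nat_option (var_of G u), encode_list (map encode_nat ps)])"

definition encodes_dag :: "val \<Rightarrow> dag \<Rightarrow> bool" where
  "encodes_dag v G \<longleftrightarrow>
     (\<exists>us vs. distinct us \<and> set us = nodes G \<and> list_all2 (encodes_node G) vs us \<and>
        v = encode_list vs)"

fun encodes_tree :: "val \<Rightarrow> rtree \<Rightarrow> bool" where
  "encodes_tree v (Leaf C) \<longleftrightarrow> (\<exists>c. encodes_clause c C \<and> v = encode_list [c])"
| "encodes_tree v (Infer x C l r) \<longleftrightarrow>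
     (\<exists>c vl vr. encodes_clause c C \<and> encodes_tree vl l \<and> encodes_tree vr r \<and>
        v = encode_list [encode_nat x, c, vl, vr])"


section \<open>Refutation systems and p-simulation\<close>

record 'p refutation_system =
  refutes :: "'p \<Rightarrow> clause set \<Rightarrow> bool"
  proof_size :: "'p \<Rightarrow> nat"
  encodes :: "val \<Rightarrow> 'p \<Rightarrow> bool"

text \<open>\<open>Q \<le>\<^sub>p R\<close> says that \<open>R\<close> p-simulates \<open>Q\<close>. The input of the procedure is the \<open>Q\<close>-refutation
  alone, so that \<open>F\<close> may be infinite. \<open>p\<close>
  bounds numbers of nodes, whereas the running time is measured in the length of the encoding.\<close>

definition p_simulated_by ::
    "'q refutation_system \<Rightarrow> 'r refutation_system \<Rightarrow> bool"  (infix "\<le>\<^sub>p" 50) where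
  "Q \<le>\<^sub>p R \<longleftrightarrow>
     (\<exists>(p :: nat poly) P.
        polytime_on {v. \<exists>F \<pi>. refutes Q \<pi> F \<and> encodes Q v \<pi>} P \<and>
        (\<forall>F \<pi> v. refutes Q \<pi> F \<and> encodes Q v \<pi> \<longrightarrow>
           (\<exists>w t \<rho>. runs P v w t \<and> encodes R w \<rho> \<and> refutes R \<rho> F \<and>
              proof_size R \<rho> \<le> poly p (proof_size Q \<pi>))))"

definition p_equivalent ::
    "'q refutation_system \<Rightarrow> 'r refutation_system \<Rightarrow> bool"  (infix "\<equiv>\<^sub>p" 50) where
  "Q \<equiv>\<^sub>p R \<longleftrightarrow> Q \<le>\<^sub>p R \<and> R \<le>\<^sub>p Q"

definition dag_system :: "(dag \<Rightarrow> clause set \<Rightarrow> bool) \<Rightarrow> dag refutation_system" where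
  "dag_system ref = \<lparr>refutes = ref, proof_size = (\<lambda>G. card (nodes G)), encodes = encodes_dag\<rparr>"

definition tree_system :: "(rtree \<Rightarrow> clause set \<Rightarrow> bool) \<Rightarrow> rtree refutation_system" where
  "tree_system ref =
     \<lparr>refutes = ref, proof_size = (\<lambda>T. length (postorder T)), encodes = encodes_tree\<rparr>"

definition RD :: "dag refutation_system" where
  "RD = dag_system (\<lambda>G F. dag_derivation resolution F G {||})"

definition regRD :: "dag refutation_system" where
  "regRD = dag_system (\<lambda>G F. dag_derivation resolution F G {||} \<and> regular_dag G)"

definition regWRD :: "dag refutation_system" where
  "regWRD = dag_system (\<lambda>G F. dag_derivation w_resolution F G {||} \<and> regular_dag G)"

definition regRTL :: "rtree refutation_system" where
  "regRTL = tree_system (\<lambda>T F.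
     tree_derivation resolution (\<lambda>_. True) F T {||} \<and> regular_tree T)"

definition regWRTL :: "rtree refutation_system" where
  "regWRTL = tree_system (\<lambda>T F.
     tree_derivation w_resolution (\<lambda>_. True) F T {||} \<and> regular_tree T)"

definition regRTI :: "rtree refutation_system" where
  "regRTI = tree_system (\<lambda>T F.
     tree_derivation resolution input_resolution_tree F T {||} \<and> regular_tree T)"

definition regWRTI :: "rtree refutation_system" where
  "regWRTI = tree_system (\<lambda>T F.
     tree_derivation w_resolution input_resolution_tree F T {||} \<and> regular_tree T)"

end

theory Submission
  imports Defs
begin

text \<open>
  A w-resolution inference whose conclusion is not a genuine resolvent of the premises is subsumed by
  one of the premises; replacing every node by a node with a subclause of its clause
  turns a WRD into an RD, every edge of which is a path of the original, so that regularity
  is preserved. A WRTL becomes a dag by identifying the nodes with equal clauses, since the first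
  occurrence of a clause in post-order is either an initial clause or is derived from clauses that occur
  earlier.

  A regular RD is unfolded into a tree by a depth-first search that stops at the nodes whose clauses are
  initial or learned, where a clause is learned when it is inferred from two leaves. Each visit of
  a node that is not yet learned ends up learning some clause, hence a dag with \<open>n\<close> nodes and height \<open>h\<close>
  is unfolded into at most \<open>h * n\<close> inferences.

  To see that these procedures run in polynomial time, programs are never written down explicitly,
  apart from an equality test, the size of a value and a loop over a list; they are obtained from
  closure properties of the class of polynomial-time computable functions.
\<close>

section \<open>Polynomially bounded functions\<close>

text \<open>Three features of the definitions shape the procedures. Encodings list nodes, literals
  and predecessors in arbitrary order; hence dags are first sorted into lists in which every node
  stands before its predecessors, and clauses are compared as sets. The set \<open>F\<close> is not
  part of the input, so a procedure cannot test whether a clause is initial: in a dag it looks at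
  the predecessors, in a tree it relies on the first occurrence of a clause in post-order. Finally,
  a dag node needs two different predecessors and the dag a single sink; the former holds because an
  inference from a clause and itself returns that clause, the latter is restored by pruning.

  W-resolution is eliminated before a dag is unfolded, because only genuine resolution can make a
  tree node input-derived.

  Iteration keeps polynomial time only if all intermediate states are polynomially bounded. This is
  why resolvents are cut out of given clauses, why new names gain just one bit at a time, and why
  each loop comes with an estimate of the growth of its state.\<close>

definition poly_fun :: "(nat \<Rightarrow> nat) \<Rightarrow> bool" where
  "poly_fun b \<longleftrightarrow> (\<exists>q :: nat poly. b = poly q)"

lemma poly_fun_const: "poly_fun (\<lambda>n. c)"
  unfolding poly_fun_def by (rule exI[of _ "[:c:]"]) auto

lemma poly_fun_id: "poly_fun (\<lambda>n. n)"
  unfolding poly_fun_def by (rule exI[of _ "[:0, 1:]"]) auto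

lemma poly_fun_add: "poly_fun f \<Longrightarrow> poly_fun g \<Longrightarrow> poly_fun (\<lambda>n. f n + g n)"
  unfolding poly_fun_def
proof (elim exE)
  fix p q :: "nat poly"
  assume "f = poly p" "g = poly q"
  then show "\<exists>r. (\<lambda>n. f n + g n) = poly r"
    by (intro exI[of _ "p + q"]) (simp add: fun_eq_iff)
qed

lemma poly_fun_mult: "poly_fun f \<Longrightarrow> poly_fun g \<Longrightarrow> poly_fun (\<lambda>n. f n * g n)"
  unfolding poly_fun_def
proof (elim exE)
  fix p q :: "nat poly"
  assume "f = poly p" "g = poly q"
  then show "\<exists>r. (\<lambda>n. f n * g n) = poly r"
    by (intro exI[of _ "p * q"]) (simp add: fun_eq_iff)
qed

lemma poly_fun_compose: "poly_fun f \<Longrightarrow> poly_fun g \<Longrightarrow> poly_fun (\<lambda>n. f (g n))"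
  unfolding poly_fun_def
proof (elim exE)
  fix p q :: "nat poly"
  assume "f = poly p" "g = poly q"
  then show "\<exists>r. (\<lambda>n. f (g n)) = poly r"
    by (intro exI[of _ "pcompose p q"]) (simp add: fun_eq_iff poly_pcompose)
qed

lemma poly_fun_Suc: "poly_fun f \<Longrightarrow> poly_fun (\<lambda>n. Suc (f n))"
  using poly_fun_add[of f "\<lambda>n. 1"] poly_fun_const by simp

lemmas poly_fun_intros =
  poly_fun_const poly_fun_id poly_fun_add poly_fun_mult poly_fun_Suc

text \<open>Coefficients are natural numbers, so monotonicity follows along Horner's scheme. It is
  what allows a size bound to be substituted into a time bound.\<close>

lemma poly_fun_mono:
  assumes "poly_fun f" "m \<le> n"
  shows "f m \<le> f n"
proof -
  obtain q :: "nat poly" where "f = poly q"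
    using assms(1) unfolding poly_fun_def by blast
  moreover have "poly q m \<le> poly q n"
    by (induction q) (use assms(2) in \<open>auto intro: add_mono mult_mono\<close>)
  ultimately show ?thesis by simp
qed


section \<open>Programs that run in polynomial time\<close>

lemma evaluates_Arg_0: "evaluates P (v # env) (Arg 0) v 1"
  using evaluates_Arg[of 0 "v # env" P] by simp

lemma ex_evaluatesI: "evaluates P env e w t \<Longrightarrow> t \<le> b \<Longrightarrow> \<exists>t \<le> b. evaluates P env e w t"
  by blast

lemma evaluates_Call_unary:
  assumes "evaluates P env e v t1" "f < length P" "evaluates P [v] (P ! f) w t2"
  shows "evaluates P env (Call f [e]) w (1 + t1 + t2)"
  using evaluates_Call[OF assms(2) evaluates_list_Cons[OF assms(1) evaluates_list_Nil] assms(3)]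
  by simp

text \<open>A fragment of code is given as a function of the position at which its library is placed,
  so that fragments can be juxtaposed without renumbering their calls.\<close>

definition code_computes ::
    "(nat \<Rightarrow> expr) \<Rightarrow> (nat \<Rightarrow> prog) \<Rightarrow> (nat \<Rightarrow> nat) \<Rightarrow> val \<Rightarrow> val \<Rightarrow> bool" where
  "code_computes e lib b v w \<longleftrightarrow>
     (\<forall>pre post env. \<exists>t \<le> b (cells v).
        evaluates (pre @ lib (length pre) @ post) (v # env) (e (length pre)) w t) \<and>
     cells w \<le> b (cells v)"

text \<open>Input and output are both functions of an index \<open>x\<close>: an intermediate value
  can then serve as the input of a later stage, and a claim can be limited to the indices at which a
  branch is taken. One code and one bound serve all of \<open>D\<close>; the bound covers the size
  of the output too, since shared values may outgrow the running time.\<close>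

definition poly_computable :: "'x set \<Rightarrow> ('x \<Rightarrow> val) \<Rightarrow> ('x \<Rightarrow> val) \<Rightarrow> bool" where
  "poly_computable D v w \<longleftrightarrow>
     (\<exists>e lib b. poly_fun b \<and> (\<forall>x \<in> D. code_computes e lib b (v x) (w x)))"

lemma poly_computableI:
  assumes "poly_fun b" "\<And>x. x \<in> D \<Longrightarrow> code_computes e lib b (v x) (w x)"
  shows "poly_computable D v w"
  using assms unfolding poly_computable_def by blast

lemma code_computesI:
  assumes "\<And>pre post env P. P = pre @ lib (length pre) @ post \<Longrightarrow>
      \<exists>t \<le> b (cells v). evaluates P (v # env) (e (length pre)) w t"
    and "cells w \<le> b (cells v)"
  shows "code_computes e lib b v w"
  using assms unfolding code_computes_def by blast

lemma code_computesD:
  assumes "code_computes e lib b v w" "P = pre @ lib (length pre) @ post" "n = length pre"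
  shows "\<exists>t \<le> b (cells v). evaluates P (v # env) (e n) w t"
  using assms unfolding code_computes_def by blast

lemma code_computes_size: "code_computes e lib b v w \<Longrightarrow> cells w \<le> b (cells v)"
  unfolding code_computes_def by blast

lemma poly_computable_cong:
  assumes "poly_computable D v w" "\<And>x. x \<in> E \<Longrightarrow> h x \<in> D"
    and "\<And>x. x \<in> E \<Longrightarrow> v' x = v (h x)" "\<And>x. x \<in> E \<Longrightarrow> w' x = w (h x)"
  shows "poly_computable E v' w'"
proof -
  obtain e lib b where "poly_fun b" "\<forall>x \<in> D. code_computes e lib b (v x) (w x)"
    using assms(1) unfolding poly_computable_def by blast
  then show ?thesis
    using assms(2-4) by (intro poly_computableI[of b E e lib]) auto
qed

section \<open>Identity, pairing, composition, projections and branching of programs\<close>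

lemma poly_computable_id: "poly_computable D v v"
proof (rule poly_computableI)
  show "poly_fun (\<lambda>n. n + 1)" by (intro poly_fun_intros)
  show "code_computes (\<lambda>_. Arg 0) (\<lambda>_. []) (\<lambda>n. n + 1) (v x) (v x)" for x
    by (rule code_computesI, rule ex_evaluatesI[OF evaluates_Arg_0]) simp_all
qed

lemma poly_computable_Atom: "poly_computable D v (\<lambda>_. Atom)"
proof (rule poly_computableI)
  show "poly_fun (\<lambda>n. n + 1)" by (intro poly_fun_intros)
  show "code_computes (\<lambda>_. AtomE) (\<lambda>_. []) (\<lambda>n. n + 1) (v x) Atom" for x
    by (rule code_computesI, rule ex_evaluatesI[OF evaluates_Atom]) simp_all
qed

lemma poly_computable_Pair:
  assumes "poly_computable D v f" "poly_computable D v g"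
  shows "poly_computable D v (\<lambda>x. Pair (f x) (g x))"
proof -
  obtain e1 lib1 b1 where 1: "poly_fun b1" "\<And>x. x \<in> D \<Longrightarrow> code_computes e1 lib1 b1 (v x) (f x)"
    using assms(1) unfolding poly_computable_def by blast
  obtain e2 lib2 b2 where 2: "poly_fun b2" "\<And>x. x \<in> D \<Longrightarrow> code_computes e2 lib2 b2 (v x) (g x)"
    using assms(2) unfolding poly_computable_def by blast
  \<comment> \<open>The second library begins where the first one, placed at \<open>n\<close>,
    ends.\<close>
  define n2 where "n2 n = n + length (lib1 n)" for n
  show ?thesis
  proof (rule poly_computableI)
    show "poly_fun (\<lambda>n. 1 + b1 n + b2 n)" by (intro poly_fun_intros 1 2)
    fix x assume x: "x \<in> D"
    show "code_computes (\<lambda>n. PairE (e1 n) (e2 (n2 n))) (\<lambda>n. lib1 n @ lib2 (n2 n))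
        (\<lambda>n. 1 + b1 n + b2 n) (v x) (Pair (f x) (g x))"
    proof (rule code_computesI)
      fix pre post env P
      assume P: "P = pre @ (lib1 (length pre) @ lib2 (n2 (length pre))) @ post"
      obtain t1 where t1: "t1 \<le> b1 (cells (v x))" "evaluates P (v x # env) (e1 (length pre)) (f x) t1"
        using code_computesD[OF 1(2)[OF x], of P pre "lib2 (n2 (length pre)) @ post" "length pre" env] P
        by auto
      obtain t2 where t2: "t2 \<le> b2 (cells (v x))"
        "evaluates P (v x # env) (e2 (n2 (length pre))) (g x) t2"
        using code_computesD[OF 2(2)[OF x], of P "pre @ lib1 (length pre)" post
            "n2 (length pre)" env] P
        by (auto simp: n2_def)
      show "\<exists>t \<le> 1 + b1 (cells (v x)) + b2 (cells (v x)).
          evaluates P (v x # env) (PairE (e1 (length pre)) (e2 (n2 (length pre)))) (Pair (f x) (g x)) t"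
        by (rule ex_evaluatesI[OF evaluates_Pair[OF t1(2) t2(2)]]) (use t1(1) t2(1) in linarith)
    qed (use code_computes_size[OF 1(2)[OF x]] code_computes_size[OF 2(2)[OF x]] in simp)
  qed
qed

text \<open>\<open>LetE\<close> pushes the intermediate value onto the environment, and the second
  code looks only at the head of its environment, as \<open>code_computes\<close> holds for every
  \<open>env\<close>. By monotonicity its cost is at most \<open>b2 (b1 n)\<close>.\<close>

lemma poly_computable_comp:
  assumes "poly_computable D v f" "poly_computable D f g"
  shows "poly_computable D v g"
proof -
  obtain e1 lib1 b1 where 1: "poly_fun b1" "\<And>x. x \<in> D \<Longrightarrow> code_computes e1 lib1 b1 (v x) (f x)"
    using assms(1) unfolding poly_computable_def by blast
  obtain e2 lib2 b2 where 2: "poly_fun b2" "\<And>x. x \<in> D \<Longrightarrow> code_computes e2 lib2 b2 (f x) (g x)"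
    using assms(2) unfolding poly_computable_def by blast
  define n2 where "n2 n = n + length (lib1 n)" for n
  show ?thesis
  proof (rule poly_computableI)
    show "poly_fun (\<lambda>n. 1 + b1 n + b2 (b1 n))"
      by (intro poly_fun_add poly_fun_const 1(1) poly_fun_compose[OF 2(1) 1(1)])
    fix x assume x: "x \<in> D"
    have size: "b2 (cells (f x)) \<le> b2 (b1 (cells (v x)))"
      by (rule poly_fun_mono[OF 2(1) code_computes_size[OF 1(2)[OF x]]])
    show "code_computes (\<lambda>n. LetE (e1 n) (e2 (n2 n))) (\<lambda>n. lib1 n @ lib2 (n2 n))
        (\<lambda>n. 1 + b1 n + b2 (b1 n)) (v x) (g x)"
    proof (rule code_computesI)
      fix pre post env P
      assume P: "P = pre @ (lib1 (length pre) @ lib2 (n2 (length pre))) @ post"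
      obtain t1 where t1: "t1 \<le> b1 (cells (v x))" "evaluates P (v x # env) (e1 (length pre)) (f x) t1"
        using code_computesD[OF 1(2)[OF x], of P pre "lib2 (n2 (length pre)) @ post" "length pre" env] P
        by auto
      obtain t2 where t2: "t2 \<le> b2 (cells (f x))"
        "evaluates P (f x # v x # env) (e2 (n2 (length pre))) (g x) t2"
        using code_computesD[OF 2(2)[OF x], of P "pre @ lib1 (length pre)" post
            "n2 (length pre)" "v x # env"] P
        by (auto simp: n2_def)
      show "\<exists>t \<le> 1 + b1 (cells (v x)) + b2 (b1 (cells (v x))).
          evaluates P (v x # env) (LetE (e1 (length pre)) (e2 (n2 (length pre)))) (g x) t"
        by (rule ex_evaluatesI[OF evaluates_Let[OF t1(2) t2(2)]]) (use t1(1) t2(1) size in linarith)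
    qed (use code_computes_size[OF 2(2)[OF x]] size in simp)
  qed
qed

lemma poly_computable_proj:
  assumes "poly_computable D v (\<lambda>x. Pair (f x) (g x))"
  shows "poly_computable D v f" "poly_computable D v g"
proof -
  have "poly_computable D (\<lambda>x. Pair (f x) (g x)) f"
  proof (rule poly_computableI)
    show "poly_fun (\<lambda>n. n + 2)" by (intro poly_fun_intros)
    show "code_computes (\<lambda>_. Fst (Arg 0)) (\<lambda>_. []) (\<lambda>n. n + 2) (Pair (f x) (g x)) (f x)" for x
      by (rule code_computesI, rule ex_evaluatesI[OF evaluates_Fst[OF evaluates_Arg_0]]) simp_all
  qed
  then show "poly_computable D v f" by (rule poly_computable_comp[OF assms])
  have "poly_computable D (\<lambda>x. Pair (f x) (g x)) g"
  proof (rule poly_computableI)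
    show "poly_fun (\<lambda>n. n + 2)" by (intro poly_fun_intros)
    show "code_computes (\<lambda>_. Snd (Arg 0)) (\<lambda>_. []) (\<lambda>n. n + 2) (Pair (f x) (g x)) (g x)" for x
      by (rule code_computesI, rule ex_evaluatesI[OF evaluates_Snd[OF evaluates_Arg_0]]) simp_all
  qed
  then show "poly_computable D v g" by (rule poly_computable_comp[OF assms])
qed

text \<open>Each branch is required to work only where it is taken. A branch may thus take apart a
  value that is known there to be a \<open>Pair\<close>.\<close>

lemma poly_computable_If:
  assumes "poly_computable D v c"
    and "poly_computable {x \<in> D. c x \<noteq> Atom} v f" "poly_computable {x \<in> D. c x = Atom} v g"
  shows "poly_computable D v (\<lambda>x. if c x = Atom then g x else f x)"
proof -
  obtain e1 lib1 b1 where 1: "poly_fun b1" "\<And>x. x \<in> D \<Longrightarrow> code_computes e1 lib1 b1 (v x) (c x)"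
    using assms(1) unfolding poly_computable_def by blast
  obtain e2 lib2 b2 where 2: "poly_fun b2"
    "\<And>x. x \<in> D \<Longrightarrow> c x \<noteq> Atom \<Longrightarrow> code_computes e2 lib2 b2 (v x) (f x)"
    using assms(2) unfolding poly_computable_def by blast
  obtain e3 lib3 b3 where 3: "poly_fun b3"
    "\<And>x. x \<in> D \<Longrightarrow> c x = Atom \<Longrightarrow> code_computes e3 lib3 b3 (v x) (g x)"
    using assms(3) unfolding poly_computable_def by blast
  define n2 where "n2 n = n + length (lib1 n)" for n
  define n3 where "n3 n = n2 n + length (lib2 (n2 n))" for n
  define lib where "lib n = lib1 n @ lib2 (n2 n) @ lib3 (n3 n)" for n
  show ?thesis
  proof (rule poly_computableI)
    show "poly_fun (\<lambda>n. 1 + b1 n + (b2 n + b3 n))" by (intro poly_fun_intros 1 2 3)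
    fix x assume x: "x \<in> D"
    show "code_computes (\<lambda>n. IfE (e1 n) (e2 (n2 n)) (e3 (n3 n))) lib
        (\<lambda>n. 1 + b1 n + (b2 n + b3 n)) (v x) (if c x = Atom then g x else f x)"
    proof (rule code_computesI)
      fix pre post env P
      assume P: "P = pre @ lib (length pre) @ post"
      let ?n = "length pre"
      obtain t1 where t1: "t1 \<le> b1 (cells (v x))" "evaluates P (v x # env) (e1 ?n) (c x) t1"
        using code_computesD[OF 1(2)[OF x], of P pre "lib2 (n2 ?n) @ lib3 (n3 ?n) @ post" ?n env] P
        by (auto simp: lib_def)
      show "\<exists>t \<le> 1 + b1 (cells (v x)) + (b2 (cells (v x)) + b3 (cells (v x))).
          evaluates P (v x # env) (IfE (e1 ?n) (e2 (n2 ?n)) (e3 (n3 ?n)))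
            (if c x = Atom then g x else f x) t"
      proof (cases "c x")
        case Atom
        then obtain t3 where t3: "t3 \<le> b3 (cells (v x))" "evaluates P (v x # env) (e3 (n3 ?n)) (g x) t3"
          using code_computesD[OF 3(2)[OF x], of P "pre @ lib1 ?n @ lib2 (n2 ?n)" post "n3 ?n" env] P
          by (auto simp: n2_def n3_def lib_def add.assoc)
        show ?thesis
          by (rule ex_evaluatesI, simp add: Atom, rule evaluates_If_Atom[OF t1(2)[unfolded Atom] t3(2)])
            (use t1(1) t3(1) in linarith)
      next
        case (Pair u u')
        then obtain t2 where t2: "t2 \<le> b2 (cells (v x))" "evaluates P (v x # env) (e2 (n2 ?n)) (f x) t2"
          using code_computesD[OF 2(2)[OF x], of P "pre @ lib1 ?n" "lib3 (n3 ?n) @ post" "n2 ?n" env] P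
          by (auto simp: n2_def n3_def lib_def)
        show ?thesis
          by (rule ex_evaluatesI, simp add: Pair, rule evaluates_If_Pair[OF t1(2)[unfolded Pair] t2(2)])
            (use t1(1) t2(1) in linarith)
      qed
    qed (use code_computes_size[OF 2(2)[OF x]] code_computes_size[OF 3(2)[OF x]] in auto)
  qed
qed

section \<open>The explicit programs: loop over a list, equality test, size\<close>

lemma cells_pos: "cells v \<ge> 1"
  by (cases v) auto

lemma cells_encode_list: "cells (encode_list vs) = 1 + length vs + sum_list (map cells vs)"
  by (induction vs) auto

text \<open>The loop has as its argument the static data, the remaining list and the current state.\<close>

definition loop_body :: "nat \<Rightarrow> expr \<Rightarrow> expr" where
  "loop_body n e =
     IfE (Fst (Snd (Arg 0)))
       (Call n [PairE (Fst (Arg 0)) (PairE (Snd (Fst (Snd (Arg 0))))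
          (LetE (PairE (Fst (Arg 0)) (PairE (Fst (Fst (Snd (Arg 0)))) (Snd (Snd (Arg 0))))) e))])
       (Snd (Snd (Arg 0)))"

text \<open>Induction from the end of the list backwards. \<open>7\<close> is the cost of the last
  call, which finds the list empty; \<open>30\<close> is a generous bound for the overhead of a
  round besides the body \<open>e\<close>.\<close>

lemma evaluates_loop_body:
  assumes "length pre = n" "P = pre @ loop_body n e # post"
    and "\<And>j env. j < length vs \<Longrightarrow>
      \<exists>t \<le> b. evaluates P (Pair v (Pair (vs ! j) (s j)) # env) e (s (Suc j)) t"
    and "i \<le> length vs"
  shows "\<exists>t \<le> 7 + (length vs - i) * (30 + b).
    evaluates P (Pair v (Pair (encode_list (drop i vs)) (s i)) # env) (loop_body n e) (s (length vs)) t"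
  using assms(4)
proof (induction i arbitrary: env rule: inc_induct)
  case base
  have "evaluates P (Pair v (Pair Atom (s (length vs))) # env) (loop_body n e)
      (s (length vs)) (1 + (1 + (1 + 1)) + (1 + (1 + 1)))"
    unfolding loop_body_def
    by (rule evaluates_If_Atom[OF evaluates_Fst[OF evaluates_Snd[OF evaluates_Arg_0]]
          evaluates_Snd[OF evaluates_Snd[OF evaluates_Arg_0]]])
  then show ?case by (intro exI[of _ "1 + (1 + (1 + 1)) + (1 + (1 + 1))"]) auto
next
  case (step i)
  let ?vs' = "encode_list (drop (Suc i) vs)"
  have drop: "encode_list (drop i vs) = Pair (vs ! i) ?vs'"
    using step.hyps by (metis Cons_nth_drop_Suc encode_list.simps(2))
  let ?env = "Pair v (Pair (Pair (vs ! i) ?vs') (s i)) # env"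
  have Pn: "n < length P" "P ! n = loop_body n e"
    using assms(1,2) by auto
  obtain t1 where t1: "t1 \<le> b"
    "evaluates P (Pair v (Pair (vs ! i) (s i)) # ?env) e (s (Suc i)) t1"
    using assms(3) step.hyps by blast
  obtain t2 where t2: "t2 \<le> 7 + (length vs - Suc i) * (30 + b)"
    "evaluates P [Pair v (Pair ?vs' (s (Suc i)))] (P ! n) (s (length vs)) t2"
    using step.IH unfolding Pn by blast
  note list = evaluates_Fst[OF evaluates_Snd[OF evaluates_Arg_0]]
  note "let" = evaluates_Let[OF evaluates_Pair[OF evaluates_Fst[OF evaluates_Arg_0]
        evaluates_Pair[OF evaluates_Fst[OF list] evaluates_Snd[OF evaluates_Snd[OF evaluates_Arg_0]]]] t1(2)]
  note eval = evaluates_If_Pair[OF list evaluates_Call_unary[OF evaluates_Pair[OF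
        evaluates_Fst[OF evaluates_Arg_0] evaluates_Pair[OF evaluates_Snd[OF list] "let"]] Pn(1) t2(2)]]
  have len: "length vs - i = Suc (length vs - Suc i)"
    using step.hyps by simp
  show ?case
    unfolding drop loop_body_def by (rule ex_evaluatesI, rule eval) (use t1(1) t2(1) in \<open>simp add: len\<close>)
qed

text \<open>Composing the bound of the body with itself once per round would not stay polynomial.
  The states are therefore bounded in advance by \<open>q\<close>, in terms of the initial input, so
  that every round has the same polynomial cost.\<close>

lemma poly_computable_loop:
  fixes vs :: "'x \<Rightarrow> val list" and s :: "'x \<Rightarrow> nat \<Rightarrow> val"
  assumes "poly_computable {(x, i). x \<in> D \<and> i < length (vs x)}
      (\<lambda>(x, i). Pair (v x) (Pair (vs x ! i) (s x i))) (\<lambda>(x, i). s x (Suc i))"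
    and "poly_fun q"
    and "\<And>x i. x \<in> D \<Longrightarrow> i \<le> length (vs x) \<Longrightarrow>
      cells (s x i) \<le> q (cells (Pair (v x) (Pair (encode_list (vs x)) (s x 0))))"
  shows "poly_computable D (\<lambda>x. Pair (v x) (Pair (encode_list (vs x)) (s x 0)))
    (\<lambda>x. s x (length (vs x)))"
proof -
  let ?a = "\<lambda>x. Pair (v x) (Pair (encode_list (vs x)) (s x 0))"
  obtain e lib b where 1: "poly_fun b" "\<And>x i. x \<in> D \<Longrightarrow> i < length (vs x) \<Longrightarrow>
      code_computes e lib b (Pair (v x) (Pair (vs x ! i) (s x i))) (s x (Suc i))"
  proof -
    from assms(1) obtain e lib b where "poly_fun b" "\<forall>y \<in> {(x, i). x \<in> D \<and> i < length (vs x)}.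
        code_computes e lib b (case y of (x, i) \<Rightarrow> Pair (v x) (Pair (vs x ! i) (s x i)))
          (case y of (x, i) \<Rightarrow> s x (Suc i))"
      unfolding poly_computable_def by blast
    then show ?thesis
      by (intro that[of b e lib]) auto
  qed
  show ?thesis
  proof (rule poly_computableI)
    \<comment> \<open>\<open>9\<close> is the \<open>7\<close> of the last round plus two steps for
      the outer call and its argument; \<open>n + q n\<close> bounds the input of the body, and the
      summand \<open>q n\<close> accounts for the size of the result.\<close>
    show "poly_fun (\<lambda>n. 9 + n * (30 + b (n + q n)) + q n)"
      by (intro poly_fun_intros assms(2) poly_fun_compose[OF 1(1)])
    fix x assume x: "x \<in> D"
    let ?c = "cells (?a x)"
    have elem: "cells (Pair (v x) (Pair (vs x ! j) (s x j))) \<le> ?c + q ?c" if "j < length (vs x)" for j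
    proof -
      have "cells (vs x ! j) \<le> sum_list (map cells (vs x))"
        using that by (intro member_le_sum_list) auto
      then show ?thesis
        using assms(3)[OF x, of j] that by (auto simp: cells_encode_list)
    qed
    have len: "length (vs x) * m \<le> ?c * m" for m
      by (rule mult_le_mono1) (auto simp: cells_encode_list)
    show "code_computes (\<lambda>n. Call n [Arg 0]) (\<lambda>n. loop_body n (e (Suc n)) # lib (Suc n))
        (\<lambda>n. 9 + n * (30 + b (n + q n)) + q n) (?a x) (s x (length (vs x)))"
    proof (rule code_computesI)
      fix pre post :: prog and env P
      let ?n = "length pre"
      assume P: "P = pre @ (loop_body ?n (e (Suc ?n)) # lib (Suc ?n)) @ post"
      then have P1: "P = pre @ loop_body ?n (e (Suc ?n)) # (lib (Suc ?n) @ post)"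
        and P2: "P = (pre @ [loop_body ?n (e (Suc ?n))]) @
          lib (length (pre @ [loop_body ?n (e (Suc ?n))])) @ post"
        and Pn: "?n < length P" "P ! ?n = loop_body ?n (e (Suc ?n))"
        by simp_all
      have step: "\<exists>t \<le> b (?c + q ?c).
        evaluates P (Pair (v x) (Pair (vs x ! j) (s x j)) # env) (e (Suc ?n)) (s x (Suc j)) t"
        if j: "j < length (vs x)" for j env
        using code_computesD[OF 1(2)[OF x j] P2, of "Suc ?n" env]
          poly_fun_mono[OF 1(1) elem[OF j]] le_trans by fastforce
      obtain t where t: "t \<le> 7 + length (vs x) * (30 + b (?c + q ?c))"
        "evaluates P [?a x] (P ! ?n) (s x (length (vs x))) t"
        using evaluates_loop_body[OF refl P1 step le0, of "[]"] unfolding Pn by auto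
      show "\<exists>t \<le> 9 + ?c * (30 + b (?c + q ?c)) + q ?c.
          evaluates P (?a x # env) (Call ?n [Arg 0]) (s x (length (vs x))) t"
        by (rule ex_evaluatesI[OF evaluates_Call_unary[OF evaluates_Arg_0 Pn(1) t(2)]])
          (use t(1) len[of "30 + b (?c + q ?c)"] in linarith)
    next
      show "cells (s x (length (vs x))) \<le> 9 + ?c * (30 + b (?c + q ?c)) + q ?c"
        using assms(3)[OF x, of "length (vs x)"] by linarith
    qed
  qed
qed

definition eq_body :: "nat \<Rightarrow> expr" where
  "eq_body n =
     IfE (Fst (Arg 0))
       (IfE (Snd (Arg 0))
         (IfE (Call n [PairE (Fst (Fst (Arg 0))) (Fst (Snd (Arg 0)))])
           (Call n [PairE (Snd (Fst (Arg 0))) (Snd (Snd (Arg 0)))])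
           AtomE)
         AtomE)
       (IfE (Snd (Arg 0)) AtomE (PairE AtomE AtomE))"

text \<open>Every recursive call descends to a different cell of \<open>v\<close>, so the cost is
  linear in \<open>v\<close> alone, whatever the size of \<open>w\<close>.\<close>

lemma evaluates_eq_body:
  assumes "n < length P" "P ! n = eq_body n"
  shows "\<exists>t \<le> 40 * cells v. evaluates P (Pair v w # env) (eq_body n) (encode_bool (v = w)) t"
proof (induction v arbitrary: w env)
  case Atom
  note fst = evaluates_Fst[OF evaluates_Arg_0] and snd = evaluates_Snd[OF evaluates_Arg_0]
  show ?case
  proof (cases w)
    case Atom
    note eval = evaluates_If_Atom[OF fst evaluates_If_Atom[OF snd
          evaluates_Pair[OF evaluates_Atom evaluates_Atom]]]
    show ?thesis unfolding Atom eq_body_def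
      by (rule ex_evaluatesI, simp add: encode_bool_def, rule eval) simp
  next
    case (Pair w1 w2)
    note eval = evaluates_If_Atom[OF fst evaluates_If_Pair[OF snd evaluates_Atom]]
    show ?thesis unfolding Pair eq_body_def
      by (rule ex_evaluatesI, simp add: encode_bool_def, rule eval) simp
  qed
next
  case (Pair v1 v2)
  note fst = evaluates_Fst[OF evaluates_Arg_0] and snd = evaluates_Snd[OF evaluates_Arg_0]
  show ?case
  proof (cases w)
    case Atom
    note eval = evaluates_If_Pair[OF fst evaluates_If_Atom[OF snd evaluates_Atom]]
    show ?thesis unfolding Atom eq_body_def
      by (rule ex_evaluatesI, simp add: encode_bool_def, rule eval) simp
  next
    case w: (Pair w1 w2)
    let ?env = "Pair (Pair v1 v2) (Pair w1 w2) # env"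
    obtain t1 where t1: "t1 \<le> 40 * cells v1"
      "evaluates P [Pair v1 w1] (P ! n) (encode_bool (v1 = w1)) t1"
      using Pair.IH(1) unfolding assms(2) by blast
    obtain t2 where t2: "t2 \<le> 40 * cells v2"
      "evaluates P [Pair v2 w2] (P ! n) (encode_bool (v2 = w2)) t2"
      using Pair.IH(2) unfolding assms(2) by blast
    let ?e1 = "Call n [PairE (Fst (Fst (Arg 0))) (Fst (Snd (Arg 0)))]"
    let ?e2 = "Call n [PairE (Snd (Fst (Arg 0))) (Snd (Snd (Arg 0)))]"
    note c1 = evaluates_Call_unary[OF evaluates_Pair[OF evaluates_Fst[OF fst] evaluates_Fst[OF snd]]
        assms(1) t1(2)]
    note c2 = evaluates_Call_unary[OF evaluates_Pair[OF evaluates_Snd[OF fst] evaluates_Snd[OF snd]]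
        assms(1) t2(2)]
    have "\<exists>t \<le> 20 + t1 + t2.
      evaluates P ?env (IfE ?e1 ?e2 AtomE) (encode_bool (Pair v1 v2 = Pair w1 w2)) t"
    proof (cases "v1 = w1")
      case True
      then have eq: "encode_bool (v1 = w1) = Pair Atom Atom"
        "encode_bool (Pair v1 v2 = Pair w1 w2) = encode_bool (v2 = w2)"
        by (simp_all add: encode_bool_def)
      show ?thesis unfolding eq(2)
        by (rule ex_evaluatesI, rule evaluates_If_Pair[OF c1[unfolded eq(1)] c2]) simp
    next
      case False
      then have eq: "encode_bool (v1 = w1) = Atom" "encode_bool (Pair v1 v2 = Pair w1 w2) = Atom"
        by (simp_all add: encode_bool_def)
      show ?thesis unfolding eq(2)
        by (rule ex_evaluatesI, rule evaluates_If_Atom[OF c1[unfolded eq(1)] evaluates_Atom]) simp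
    qed
    then obtain t where t: "t \<le> 20 + t1 + t2"
      "evaluates P ?env (IfE ?e1 ?e2 AtomE) (encode_bool (Pair v1 v2 = Pair w1 w2)) t"
      by blast
    note eval = evaluates_If_Pair[OF fst evaluates_If_Pair[OF snd t(2)]]
    show ?thesis unfolding w eq_body_def
      by (rule ex_evaluatesI, rule eval) (use t(1) t1(1) t2(1) in simp)
  qed
qed

lemma poly_computable_eq:
  "poly_computable D (\<lambda>x. Pair (v x) (w x)) (\<lambda>x. encode_bool (v x = w x))"
proof (rule poly_computableI)
  show "poly_fun (\<lambda>n. 40 * n + 10)" by (intro poly_fun_intros)
  fix x
  show "code_computes (\<lambda>n. Call n [Arg 0]) (\<lambda>n. [eq_body n]) (\<lambda>n. 40 * n + 10)
      (Pair (v x) (w x)) (encode_bool (v x = w x))"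
  proof (rule code_computesI)
    fix pre post env P
    assume P: "P = pre @ [eq_body (length pre)] @ post"
    then have Pn: "length pre < length P" "P ! length pre = eq_body (length pre)" by auto
    obtain t where t: "t \<le> 40 * cells (v x)"
      "evaluates P [Pair (v x) (w x)] (P ! length pre) (encode_bool (v x = w x)) t"
      using evaluates_eq_body[OF Pn] unfolding Pn(2) by blast
    show "\<exists>t \<le> 40 * cells (Pair (v x) (w x)) + 10.
        evaluates P (Pair (v x) (w x) # env) (Call (length pre) [Arg 0]) (encode_bool (v x = w x)) t"
      by (rule ex_evaluatesI[OF evaluates_Call_unary[OF evaluates_Arg_0 Pn(1) t(2)]]) (use t(1) in simp)
  qed (auto simp: encode_bool_def)
qed

text \<open>Counts in unary with an accumulator in the second component: first the right part of the
  value, then the left. The resulting list is the \<open>fuel\<close> that drives loops whose number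
  of rounds is not the length of a given list.\<close>

definition size_body :: "nat \<Rightarrow> expr" where
  "size_body n =
     IfE (Fst (Arg 0))
       (Call n [PairE (Fst (Fst (Arg 0)))
          (Call n [PairE (Snd (Fst (Arg 0))) (PairE AtomE (Snd (Arg 0)))])])
       (PairE AtomE (Snd (Arg 0)))"

lemma evaluates_size_body:
  assumes "n < length P" "P ! n = size_body n"
  shows "\<exists>t \<le> 30 * cells v. evaluates P (Pair v (encode_list (replicate k Atom)) # env) (size_body n)
    (encode_list (replicate (cells v + k) Atom)) t"
proof (induction v arbitrary: k env)
  case Atom
  note eval = evaluates_If_Atom[OF evaluates_Fst[OF evaluates_Arg_0]
      evaluates_Pair[OF evaluates_Atom evaluates_Snd[OF evaluates_Arg_0]]]
  show ?case unfolding size_body_def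
    by (rule ex_evaluatesI, simp, rule eval) simp
next
  case (Pair v1 v2)
  let ?w = "\<lambda>k. encode_list (replicate k Atom)"
  note fst = evaluates_Fst[OF evaluates_Arg_0] and snd = evaluates_Snd[OF evaluates_Arg_0]
  obtain t2 where t2: "t2 \<le> 30 * cells v2"
    "evaluates P [Pair v2 (Pair Atom (?w k))] (P ! n) (?w (cells v2 + Suc k)) t2"
    using Pair.IH(2)[of "Suc k" "[]", unfolded replicate_Suc[of k] encode_list.simps]
    unfolding assms(2) by blast
  obtain t1 where t1: "t1 \<le> 30 * cells v1"
    "evaluates P [Pair v1 (?w (cells v2 + Suc k))] (P ! n) (?w (cells v1 + (cells v2 + Suc k))) t1"
    using Pair.IH(1) unfolding assms(2) by blast
  note c2 = evaluates_Call_unary[OF evaluates_Pair[OF evaluates_Snd[OF fst]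
        evaluates_Pair[OF evaluates_Atom snd]] assms(1) t2(2)]
  note eval = evaluates_If_Pair[OF fst evaluates_Call_unary[OF evaluates_Pair[OF evaluates_Fst[OF fst] c2]
        assms(1) t1(2)]]
  have size: "cells (Pair v1 v2) + k = cells v1 + (cells v2 + Suc k)" by simp
  show ?case unfolding size_body_def size
    by (rule ex_evaluatesI, rule eval) (use t1(1) t2(1) in simp)
qed

lemma poly_computable_size:
  "poly_computable D v (\<lambda>x. encode_list (replicate (cells (v x)) Atom))"
proof (rule poly_computableI)
  show "poly_fun (\<lambda>n. 30 * n + 10)" by (intro poly_fun_intros)
  fix x
  show "code_computes (\<lambda>n. Call n [PairE (Arg 0) AtomE]) (\<lambda>n. [size_body n]) (\<lambda>n. 30 * n + 10)
      (v x) (encode_list (replicate (cells (v x)) Atom))"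
  proof (rule code_computesI)
    fix pre post env P
    assume P: "P = pre @ [size_body (length pre)] @ post"
    then have Pn: "length pre < length P" "P ! length pre = size_body (length pre)" by auto
    obtain t where t: "t \<le> 30 * cells (v x)"
      "evaluates P [Pair (v x) Atom] (P ! length pre) (encode_list (replicate (cells (v x)) Atom)) t"
      using evaluates_size_body[OF Pn, of "v x" 0 "[]"]
      unfolding Pn(2) replicate_0 encode_list.simps add_0_right by blast
    show "\<exists>t \<le> 30 * cells (v x) + 10. evaluates P (v x # env)
        (Call (length pre) [PairE (Arg 0) AtomE]) (encode_list (replicate (cells (v x)) Atom)) t"
      by (rule ex_evaluatesI[OF evaluates_Call_unary[OF evaluates_Pair[OF evaluates_Arg_0 evaluates_Atom]
              Pn(1) t(2)]]) (use t(1) in simp)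
  qed (auto simp: cells_encode_list sum_list_replicate)
qed

section \<open>Polynomial-time functions on encoded data\<close>

text \<open>Concrete data with a functional encoding, in contrast to the relational encodings of
  clauses and derivations. Injectivity turns the equality test on values into one on data.\<close>

class enc =
  fixes enc :: "'a \<Rightarrow> val"
  assumes enc_inject: "enc x = enc y \<Longrightarrow> x = y"

lemma enc_eq_iff [simp]: "enc x = enc y \<longleftrightarrow> x = y"
  using enc_inject by blast

instantiation unit :: enc
begin
definition enc_unit :: "unit \<Rightarrow> val" where "enc_unit x = Atom"
instance by standard simp
end

instantiation bool :: enc
begin
definition enc_bool :: "bool \<Rightarrow> val" where "enc_bool = encode_bool"
instance by standard (auto simp: enc_bool_def encode_bool_def split: if_splits)
end

lemma encode_nat_inject: "encode_nat m = encode_nat n \<Longrightarrow> m = n"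
proof (induction m arbitrary: n rule: less_induct)
  case (less m)
  show ?case
  proof (cases "m = 0 \<or> n = 0")
    case True
    then show ?thesis
      using less.prems by (auto simp: encode_nat.simps[of m] encode_nat.simps[of n] split: if_splits)
  next
    case False
    then have "encode_bool (odd m) = encode_bool (odd n)" "encode_nat (m div 2) = encode_nat (n div 2)"
      using less.prems by (simp_all add: encode_nat.simps[of m] encode_nat.simps[of n])
    then have "odd m = odd n" "m div 2 = n div 2"
      using less.IH[of "m div 2" "n div 2"] False by (auto simp: encode_bool_def split: if_splits)
    then show ?thesis by presburger
  qed
qed

instantiation nat :: enc
begin
definition enc_nat :: "nat \<Rightarrow> val" where "enc_nat = encode_nat"
instance by standard (simp add: enc_nat_def encode_nat_inject)
end

instantiation literal :: enc
begin
definition enc_literal :: "literal \<Rightarrow> val" where "enc_literal = encode_literal"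
instance
proof
  fix l l' :: literal
  show "enc l = enc l' \<Longrightarrow> l = l'"
    by (cases l; cases l') (auto simp: enc_literal_def encode_bool_def dest: encode_nat_inject)
qed
end

instantiation prod :: (enc, enc) enc
begin
definition enc_prod :: "'a \<times> 'b \<Rightarrow> val" where "enc_prod p = Pair (enc (fst p)) (enc (snd p))"
instance by standard (auto simp: enc_prod_def prod_eq_iff)
end

instantiation option :: (enc) enc
begin
definition enc_option :: "'a option \<Rightarrow> val" where
  "enc_option x = (case x of None \<Rightarrow> Atom | Some y \<Rightarrow> Pair (enc y) Atom)"
instance by standard (auto simp: enc_option_def split: option.splits)
end

instantiation list :: (enc) enc
begin
definition enc_list :: "'a list \<Rightarrow> val" where "enc_list xs = encode_list (map enc xs)"
instance
proof
  fix xs ys :: "'a list"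
  show "enc xs = enc ys \<Longrightarrow> xs = ys"
  proof (induction xs arbitrary: ys)
    case Nil
    then show ?case by (cases ys) (auto simp: enc_list_def)
  next
    case (Cons x xs)
    then show ?case by (cases ys) (auto simp: enc_list_def)
  qed
qed
end

text \<open>Resolution trees whose clauses are lists of literals, as in the encodings.\<close>

datatype ltree = LLeaf "literal list" | LInfer var "literal list" ltree ltree

primrec encode_ltree :: "ltree \<Rightarrow> val" where
  "encode_ltree (LLeaf c) = Pair (enc c) Atom"
| "encode_ltree (LInfer x c l r) =
     Pair (enc x) (Pair (enc c) (Pair (encode_ltree l) (Pair (encode_ltree r) Atom)))"

instantiation ltree :: enc
begin
definition enc_ltree :: "ltree \<Rightarrow> val" where "enc_ltree = encode_ltree"
instance
proof
  fix s t :: ltree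
  show "enc s = enc t \<Longrightarrow> s = t"
  proof (induction s arbitrary: t)
    case (LLeaf c)
    then show ?case by (cases t) (auto simp: enc_ltree_def)
  next
    case (LInfer x c l r)
    then show ?case by (cases t) (auto simp: enc_ltree_def)
  qed
qed
end

lemma enc_simps [simp]:
  "enc (x, y) = Pair (enc x) (enc y)"
  "enc None = Atom" "enc (Some x) = Pair (enc x) Atom"
  "enc [] = Atom" "enc (x # xs) = Pair (enc x) (enc xs)"
  "enc () = Atom" "enc True = Pair Atom Atom" "enc False = Atom"
  "enc (Pos n) = Pair (Pair Atom Atom) (enc n)" "enc (Neg n) = Pair Atom (enc n)"
  "enc (LLeaf c) = Pair (enc c) Atom"
  "enc (LInfer n c l r) = Pair (enc n) (Pair (enc c) (Pair (enc l) (Pair (enc r) Atom)))"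
  by (simp_all add: enc_prod_def enc_option_def enc_list_def enc_unit_def enc_bool_def
      encode_bool_def enc_literal_def enc_nat_def enc_ltree_def)

text \<open>With the least significant bit first, this operation just puts a bit in front. It is the
  only arithmetic that the procedures perform, and serves to create fresh names without programming
  addition.\<close>

lemma enc_double_Suc [simp]: "enc (Suc (2 * n)) = Pair (Pair Atom Atom) (enc n)"
  by (simp add: enc_nat_def encode_nat.simps[of "Suc (2 * n)"] encode_bool_def)

lemma enc_0 [simp]: "enc (0 :: nat) = Atom"
  by (simp add: enc_nat_def encode_nat.simps)

lemma cells_enc_pos [simp]: "cells (enc x) > 0"
  using cells_pos[of "enc x"] by simp

lemma cells_enc_mem: "x \<in> set xs \<Longrightarrow> cells (enc x) < cells (enc xs)"
  by (induction xs) (auto simp: less_Suc_eq_le trans_le_add1 trans_le_add2 intro: less_imp_le)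

lemma length_le_cells: "length xs < cells (enc xs)"
proof (induction xs)
  case (Cons x xs)
  then show ?case using cells_enc_pos[of x] by simp
qed simp

definition polytime_fun :: "('a :: enc \<Rightarrow> 'b :: enc) \<Rightarrow> bool" where
  "polytime_fun f \<longleftrightarrow> poly_computable UNIV enc (\<lambda>x. enc (f x))"

definition poly_bounded :: "('a :: enc \<Rightarrow> nat) \<Rightarrow> bool" where
  "poly_bounded c \<longleftrightarrow> (\<exists>b. poly_fun b \<and> (\<forall>x. c x \<le> b (cells (enc x))))"

lemma poly_bounded_mono: "poly_bounded d \<Longrightarrow> (\<And>x. c x \<le> d x) \<Longrightarrow> poly_bounded c"
  unfolding poly_bounded_def by (meson le_trans)

lemma poly_bounded_const: "poly_bounded (\<lambda>_. n)"
  unfolding poly_bounded_def using poly_fun_const[of n] by blast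

lemma poly_bounded_cells: "poly_bounded (\<lambda>x. cells (enc x))"
  unfolding poly_bounded_def using poly_fun_id by blast

lemma poly_bounded_add:
  assumes "poly_bounded c" "poly_bounded d"
  shows "poly_bounded (\<lambda>x. c x + d x)"
proof -
  obtain b b' where "poly_fun b" "\<And>x. c x \<le> b (cells (enc x))" "poly_fun b'" "\<And>x. d x \<le> b' (cells (enc x))"
    using assms unfolding poly_bounded_def by blast
  then show ?thesis
    unfolding poly_bounded_def
    by (intro exI[of _ "\<lambda>n. b n + b' n"]) (auto intro: poly_fun_add add_mono)
qed

lemma poly_bounded_Suc: "poly_bounded c \<Longrightarrow> poly_bounded (\<lambda>x. Suc (c x))"
  using poly_bounded_add[OF poly_bounded_const[of 1], of c] by simp

lemma poly_bounded_mult: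
  assumes "poly_bounded c" "poly_bounded d"
  shows "poly_bounded (\<lambda>x. c x * d x)"
proof -
  obtain b b' where "poly_fun b" "\<And>x. c x \<le> b (cells (enc x))" "poly_fun b'" "\<And>x. d x \<le> b' (cells (enc x))"
    using assms unfolding poly_bounded_def by blast
  then show ?thesis
    unfolding poly_bounded_def
    by (intro exI[of _ "\<lambda>n. b n * b' n"]) (auto intro: poly_fun_mult mult_mono)
qed

lemma poly_bounded_cells_fun: "polytime_fun f \<Longrightarrow> poly_bounded (\<lambda>x. cells (enc (f x)))"
  unfolding polytime_fun_def poly_computable_def poly_bounded_def using code_computes_size by blast

lemma poly_bounded_length: "polytime_fun f \<Longrightarrow> poly_bounded (\<lambda>x. length (f x))"
  by (rule poly_bounded_mono[OF poly_bounded_cells_fun]) (auto intro: less_imp_le length_le_cells)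

lemmas poly_bounded_intros = poly_bounded_const poly_bounded_cells poly_bounded_Suc poly_bounded_add
  poly_bounded_mult  poly_bounded_cells_fun poly_bounded_length

text \<open>These rules follow the syntax of functional definitions; a procedure is shown to be
  polynomial-time by traversing its body with them.\<close>

named_theorems polytime_intros

lemma polytime_fun_compose:
  assumes "polytime_fun f" "polytime_fun g"
  shows "polytime_fun (\<lambda>x. f (g x))"
proof -
  have "poly_computable UNIV (\<lambda>x. enc (g x)) (\<lambda>x. enc (f (g x)))"
    using assms(1) unfolding polytime_fun_def by (rule poly_computable_cong[where h = g]) auto
  then show ?thesis
    using assms(2) poly_computable_comp unfolding polytime_fun_def by blast
qed

lemma polytime_fun_id [polytime_intros]: "polytime_fun (\<lambda>x. x)"
  unfolding polytime_fun_def by (rule poly_computable_id)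

lemma poly_computable_const: "poly_computable D v (\<lambda>_. w)"
  by (induction w) (auto intro: poly_computable_Atom poly_computable_Pair)

lemma polytime_fun_const [polytime_intros]: "polytime_fun (\<lambda>x. c)"
  unfolding polytime_fun_def by (rule poly_computable_const)

lemma polytime_fun_Pair [polytime_intros]:
  "polytime_fun f \<Longrightarrow> polytime_fun g \<Longrightarrow> polytime_fun (\<lambda>x. (f x, g x))"
  unfolding polytime_fun_def by (simp add: poly_computable_Pair)

lemma polytime_fun_fst [polytime_intros]: "polytime_fun f \<Longrightarrow> polytime_fun (\<lambda>x. fst (f x))"
  and polytime_fun_snd [polytime_intros]: "polytime_fun f \<Longrightarrow> polytime_fun (\<lambda>x. snd (f x))"
  unfolding polytime_fun_def using poly_computable_proj by (auto simp: enc_prod_def)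

lemma polytime_fun_Cons [polytime_intros]:
  "polytime_fun f \<Longrightarrow> polytime_fun g \<Longrightarrow> polytime_fun (\<lambda>x. f x # g x)"
  unfolding polytime_fun_def by (simp add: poly_computable_Pair)

lemma polytime_fun_Some [polytime_intros]: "polytime_fun f \<Longrightarrow> polytime_fun (\<lambda>x. Some (f x))"
  unfolding polytime_fun_def by (simp add: poly_computable_Pair poly_computable_Atom)

lemma polytime_fun_Pos [polytime_intros]: "polytime_fun f \<Longrightarrow> polytime_fun (\<lambda>x. Pos (f x))"
  and polytime_fun_Neg [polytime_intros]: "polytime_fun f \<Longrightarrow> polytime_fun (\<lambda>x. Neg (f x))"
  unfolding polytime_fun_def by (auto intro: poly_computable_Pair poly_computable_const)

lemma polytime_fun_double_Suc [polytime_intros]: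
  "polytime_fun f \<Longrightarrow> polytime_fun (\<lambda>x. Suc (2 * f x))"
  unfolding polytime_fun_def by (simp add: poly_computable_Pair poly_computable_const)

lemma polytime_fun_LLeaf [polytime_intros]: "polytime_fun f \<Longrightarrow> polytime_fun (\<lambda>x. LLeaf (f x))"
  unfolding polytime_fun_def by (simp add: poly_computable_Pair poly_computable_Atom)

lemma polytime_fun_LInfer [polytime_intros]:
  "polytime_fun f \<Longrightarrow> polytime_fun g \<Longrightarrow> polytime_fun h \<Longrightarrow> polytime_fun k \<Longrightarrow>
    polytime_fun (\<lambda>x. LInfer (f x) (g x) (h x) (k x))"
  unfolding polytime_fun_def by (simp add: poly_computable_Pair poly_computable_Atom)

lemma polytime_fun_app2:
  assumes "polytime_fun (\<lambda>p. f (fst p) (snd p))" "polytime_fun g" "polytime_fun h"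
  shows "polytime_fun (\<lambda>x. f (g x) (h x))"
  using polytime_fun_compose[OF assms(1) polytime_fun_Pair[OF assms(2,3)]] by simp

lemma polytime_fun_branch:
  assumes "poly_computable UNIV enc c"
    and "poly_computable {x. c x \<noteq> Atom} enc (\<lambda>x. enc (h x))"
    and "poly_computable {x. c x = Atom} enc (\<lambda>x. enc (h x))"
  shows "polytime_fun h"
  using poly_computable_If[of UNIV enc c "\<lambda>x. enc (h x)" "\<lambda>x. enc (h x)"] assms
  unfolding polytime_fun_def by simp

lemma poly_computable_app:
  assumes "polytime_fun g" "poly_computable D enc (\<lambda>x. enc (k x))"
    and "\<And>x. x \<in> D \<Longrightarrow> h x = g (k x)"
  shows "poly_computable D enc (\<lambda>x. enc (h x))"
proof -
  have "poly_computable D (\<lambda>x. enc (k x)) (\<lambda>x. enc (h x))"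
    using assms(1) unfolding polytime_fun_def by (rule poly_computable_cong[where h = k]) (auto simp: assms(3))
  then show ?thesis
    by (rule poly_computable_comp[OF assms(2)])
qed

lemma polytime_fun_If [polytime_intros]:
  assumes "polytime_fun b" "polytime_fun f" "polytime_fun g"
  shows "polytime_fun (\<lambda>x. if b x then f x else g x)"
proof (rule polytime_fun_branch[where c = "\<lambda>x. enc (b x)"])
  show "poly_computable {x. enc (b x) \<noteq> Atom} enc (\<lambda>x. enc (if b x then f x else g x))"
    by (rule poly_computable_app[OF assms(2) poly_computable_id]) (metis enc_simps(8) mem_Collect_eq)
  show "poly_computable {x. enc (b x) = Atom} enc (\<lambda>x. enc (if b x then f x else g x))"
    by (rule poly_computable_app[OF assms(3) poly_computable_id]) (auto split: if_splits)
qed (use assms in \<open>simp add: polytime_fun_def\<close>)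

lemma polytime_fun_case_list [polytime_intros]:
  assumes "polytime_fun xs" "polytime_fun f"
    and "polytime_fun (\<lambda>p. g (fst p) (fst (snd p)) (snd (snd p)))"
  shows "polytime_fun (\<lambda>x. case xs x of [] \<Rightarrow> f x | y # ys \<Rightarrow> g x y ys)"
proof (rule polytime_fun_branch[where c = "\<lambda>x. enc (xs x)"])
  let ?D = "{x. enc (xs x) \<noteq> Atom}"
  \<comment> \<open>On \<open>?D\<close> the list is nonempty, hence its encoding is a
    \<open>Pair\<close> whose components encode head and tail.\<close>
  have "poly_computable ?D enc (\<lambda>x. Pair (enc (hd (xs x))) (enc (tl (xs x))))"
    using assms(1) unfolding polytime_fun_def
    by (rule poly_computable_cong[where h = id]) (simp_all, metis enc_simps(4,5) list.collapse)
  note parts = poly_computable_proj[OF this]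
  show "poly_computable ?D enc (\<lambda>x. enc (case xs x of [] \<Rightarrow> f x | y # ys \<Rightarrow> g x y ys))"
    by (rule poly_computable_app[OF assms(3), where k = "\<lambda>x. (x, hd (xs x), tl (xs x))"])
      (auto intro!: poly_computable_Pair poly_computable_id parts split: list.splits)
  show "poly_computable {x. enc (xs x) = Atom} enc (\<lambda>x. enc (case xs x of [] \<Rightarrow> f x | y # ys \<Rightarrow> g x y ys))"
    by (rule poly_computable_app[OF assms(2) poly_computable_id]) (auto split: list.splits)
qed (use assms in \<open>simp add: polytime_fun_def\<close>)

lemma polytime_fun_case_option [polytime_intros]:
  assumes "polytime_fun u" "polytime_fun f" "polytime_fun (\<lambda>p. g (fst p) (snd p))"
  shows "polytime_fun (\<lambda>x. case u x of None \<Rightarrow> f x | Some y \<Rightarrow> g x y)"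
proof (rule polytime_fun_branch[where c = "\<lambda>x. enc (u x)"])
  let ?D = "{x. enc (u x) \<noteq> Atom}"
  have "poly_computable ?D enc (\<lambda>x. Pair (enc (the (u x))) Atom)"
    using assms(1) unfolding polytime_fun_def
    by (rule poly_computable_cong[where h = id]) (auto simp: enc_option_def split: option.splits)
  note parts = poly_computable_proj[OF this]
  show "poly_computable ?D enc (\<lambda>x. enc (case u x of None \<Rightarrow> f x | Some y \<Rightarrow> g x y))"
    by (rule poly_computable_app[OF assms(3), where k = "\<lambda>x. (x, the (u x))"])
      (auto intro!: poly_computable_Pair poly_computable_id parts split: option.splits)
  show "poly_computable {x. enc (u x) = Atom} enc (\<lambda>x. enc (case u x of None \<Rightarrow> f x | Some y \<Rightarrow> g x y))"
    by (rule poly_computable_app[OF assms(2) poly_computable_id]) (auto split: option.splits)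
qed (use assms in \<open>simp add: polytime_fun_def\<close>)

primrec ltree_clause :: "ltree \<Rightarrow> literal list" where
  "ltree_clause (LLeaf c) = c"
| "ltree_clause (LInfer x c l r) = c"

text \<open>Both constructors are encoded by a \<open>Pair\<close>. They are told apart by its
  second component \<open>body\<close>, which is \<open>Atom\<close> exactly for a leaf.\<close>

lemma polytime_fun_case_ltree [polytime_intros]:
  assumes "polytime_fun t" "polytime_fun (\<lambda>p. f (fst p) (snd p))"
    and "polytime_fun (\<lambda>p. g (fst p) (fst (snd p)) (fst (snd (snd p))) (fst (snd (snd (snd p))))
      (snd (snd (snd (snd p)))))"
  shows "polytime_fun (\<lambda>x. case t x of LLeaf c \<Rightarrow> f x c | LInfer y c l r \<Rightarrow> g x y c l r)"
    (is "polytime_fun ?h")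
proof (rule polytime_fun_branch)
  define body where "body x = (case t x of LLeaf c \<Rightarrow> Atom
    | LInfer y c l r \<Rightarrow> Pair (enc c) (Pair (enc l) (Pair (enc r) Atom)))" for x
  define head where "head x = (case t x of LLeaf c \<Rightarrow> enc c | LInfer y c l r \<Rightarrow> enc y)" for x
  have "poly_computable UNIV enc (\<lambda>x. Pair (head x) (body x))"
    using assms(1) unfolding polytime_fun_def
    by (rule poly_computable_cong[where h = id]) (auto simp: head_def body_def split: ltree.splits)
  note parts = poly_computable_proj[OF this]
  show "poly_computable UNIV enc body" by (rule parts)
  let ?D = "{x. body x \<noteq> Atom}" and ?E = "{x. body x = Atom}"
  define var left right where
    "var x = (case t x of LInfer y c l r \<Rightarrow> y)" and "left x = (case t x of LInfer y c l r \<Rightarrow> l)" and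
    "right x = (case t x of LInfer y c l r \<Rightarrow> r)" for x
  have D: "poly_computable ?D enc (\<lambda>x. enc (var x))"
    by (rule poly_computable_cong[OF parts(1), where h = id])
      (auto simp: head_def body_def var_def split: ltree.splits)
  have "poly_computable ?D enc (\<lambda>x. Pair (enc (ltree_clause (t x)))
      (Pair (enc (left x)) (Pair (enc (right x)) Atom)))"
    by (rule poly_computable_cong[OF parts(2), where h = id])
      (auto simp: body_def left_def right_def split: ltree.splits)
  note D2 = poly_computable_proj[OF this]
  note D3 = poly_computable_proj[OF D2(2)]
  note D4 = poly_computable_proj[OF D3(2)]
  show "poly_computable ?D enc (\<lambda>x. enc (?h x))"
  proof (rule poly_computable_app[OF assms(3)])
    show "poly_computable ?D enc (\<lambda>x. enc (x, var x, ltree_clause (t x), left x, right x))"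
      unfolding enc_simps by (intro poly_computable_Pair poly_computable_id D D2 D3 D4)
  qed (auto simp: body_def left_def right_def var_def split: ltree.splits)
  have E: "poly_computable ?E enc (\<lambda>x. enc (ltree_clause (t x)))"
    by (rule poly_computable_cong[OF parts(1), where h = id])
      (auto simp: head_def body_def split: ltree.splits)
  show "poly_computable ?E enc (\<lambda>x. enc (?h x))"
  proof (rule poly_computable_app[OF assms(2)])
    show "poly_computable ?E enc (\<lambda>x. enc (x, ltree_clause (t x)))"
      unfolding enc_simps by (intro poly_computable_Pair poly_computable_id E)
  qed (auto simp: body_def split: ltree.splits)
qed

lemma polytime_fun_eq [polytime_intros]:
  assumes "polytime_fun f" "polytime_fun g"
  shows "polytime_fun (\<lambda>x. f x = g x)"
  using poly_computable_comp[OF poly_computable_Pair[OF assms[unfolded polytime_fun_def]] poly_computable_eq]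
  unfolding polytime_fun_def by (simp add: enc_bool_def)

lemma polytime_fun_conj [polytime_intros]:
  assumes "polytime_fun f" "polytime_fun g"
  shows "polytime_fun (\<lambda>x. f x \<and> g x)"
proof -
  have "(\<lambda>x. f x \<and> g x) = (\<lambda>x. if f x then g x else False)" by auto
  then show ?thesis by (simp only:) (intro polytime_intros assms)
qed

lemma polytime_fun_not [polytime_intros]:
  assumes "polytime_fun f"
  shows "polytime_fun (\<lambda>x. \<not> f x)"
proof -
  have "(\<lambda>x. \<not> f x) = (\<lambda>x. if f x then False else True)" by auto
  then show ?thesis by (simp only:) (intro polytime_intros assms)
qed

lemma polytime_fun_disj [polytime_intros]:
  assumes "polytime_fun f" "polytime_fun g"
  shows "polytime_fun (\<lambda>x. f x \<or> g x)"
proof -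
  have "(\<lambda>x. f x \<or> g x) = (\<lambda>x. if f x then True else g x)" by auto
  then show ?thesis by (simp only:) (intro polytime_intros assms)
qed

section \<open>Bounded iteration\<close>

definition fuel :: "'a :: enc \<Rightarrow> unit list" where
  "fuel x = replicate (cells (enc x)) ()"

lemma polytime_fun_fuel [polytime_intros]:
  assumes "polytime_fun f"
  shows "polytime_fun (\<lambda>x. fuel (f x))"
  using poly_computable_comp[OF assms[unfolded polytime_fun_def] poly_computable_size]
  unfolding polytime_fun_def by (simp add: fuel_def enc_list_def enc_unit_def)

lemma polytime_fun_fold:
  assumes f: "polytime_fun (\<lambda>p. f (fst p) (fst (snd p)) (snd (snd p)))"
    and xs: "polytime_fun xs" and s: "polytime_fun s"
    and c: "poly_bounded c"
    and size: "\<And>x i. i \<le> length (xs x) \<Longrightarrow> cells (enc (fold (f x) (take i (xs x)) (s x))) \<le> c x"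
  shows "polytime_fun (\<lambda>x. fold (f x) (xs x) (s x))"
proof -
  let ?s = "\<lambda>x i. enc (fold (f x) (take i (xs x)) (s x))"
  obtain q where q: "poly_fun q" "\<And>x. c x \<le> q (cells (enc x))"
    using c unfolding poly_bounded_def by blast
  have "poly_computable UNIV (\<lambda>x. Pair (enc x) (Pair (encode_list (map enc (xs x))) (?s x 0)))
    (\<lambda>x. ?s x (length (map enc (xs x))))"
  proof (rule poly_computable_loop[OF _ q(1)])
    show "poly_computable {(x, i). x \<in> UNIV \<and> i < length (map enc (xs x))}
        (\<lambda>(x, i). Pair (enc x) (Pair (map enc (xs x) ! i) (?s x i))) (\<lambda>(x, i). ?s x (Suc i))"
      using f unfolding polytime_fun_def
      by (rule poly_computable_cong[where h = "\<lambda>(x, i). (x, xs x ! i, fold (f x) (take i (xs x)) (s x))"])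
        (auto simp: take_Suc_conv_app_nth)
  next
    fix x i assume "i \<le> length (map enc (xs x))"
    then have "cells (?s x i) \<le> q (cells (enc x))"
      using size q(2) by (metis le_trans length_map)
    also have "\<dots> \<le> q (cells (Pair (enc x) (Pair (encode_list (map enc (xs x))) (?s x 0))))"
      by (intro poly_fun_mono[OF q(1)]) simp
    finally show "cells (?s x i) \<le> \<dots>" .
  qed
  moreover have "poly_computable UNIV enc (\<lambda>x. Pair (enc x) (Pair (encode_list (map enc (xs x))) (?s x 0)))"
    using xs s unfolding polytime_fun_def
    by (intro poly_computable_Pair poly_computable_id) (simp_all add: enc_list_def)
  ultimately show ?thesis
    unfolding polytime_fun_def using poly_computable_comp by fastforce
qed

text \<open>The invariant may depend on the number \<open>i\<close> of rounds done, so growth that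
  is linear in the rounds can be recorded and then estimated at
  \<open>length (xs x)\<close>.\<close>

lemma polytime_fun_fold_invariant:
  assumes f: "polytime_fun (\<lambda>p. f (fst p) (fst (snd p)) (snd (snd p)))"
    and xs: "polytime_fun xs" and s: "polytime_fun s"
    and init: "\<And>x. I x 0 (s x)"
    and step: "\<And>x i y t. I x i t \<Longrightarrow> y \<in> set (xs x) \<Longrightarrow> i < length (xs x) \<Longrightarrow> I x (Suc i) (f x y t)"
    and c: "poly_bounded c"
    and size: "\<And>x i t. I x i t \<Longrightarrow> i \<le> length (xs x) \<Longrightarrow> cells (enc t) \<le> c x"
  shows "polytime_fun (\<lambda>x. fold (f x) (xs x) (s x))"
proof (rule polytime_fun_fold[OF f xs s c])
  have inv: "i \<le> length (xs x) \<Longrightarrow> I x i (fold (f x) (take i (xs x)) (s x))" for x i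
    by (induction i) (auto simp: take_Suc_conv_app_nth init step)
  show "cells (enc (fold (f x) (take i (xs x)) (s x))) \<le> c x" if "i \<le> length (xs x)" for x i
    using size[OF inv] that by blast
qed

text \<open>A step that adds at most \<open>c x\<close> cells, a number fixed by the input and not
  by the state, adds at most \<open>length (xs x) * c x\<close> altogether.\<close>

lemma polytime_fun_fold_increment:
  fixes f :: "'a :: enc \<Rightarrow> 'b :: enc \<Rightarrow> 's :: enc \<Rightarrow> 's"
  assumes f: "polytime_fun (\<lambda>p. f (fst p) (fst (snd p)) (snd (snd p)))"
    and xs: "polytime_fun xs" and s: "polytime_fun s" and c: "poly_bounded c"
    and step: "\<And>x y t. y \<in> set (xs x) \<Longrightarrow> cells (enc (f x y t)) \<le> cells (enc t) + c x"
  shows "polytime_fun (\<lambda>x. fold (f x) (xs x) (s x))"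
proof (rule polytime_fun_fold_invariant[OF f xs s,
      where I = "\<lambda>x i t. cells (enc t) \<le> cells (enc (s x)) + i * c x"])
  show "poly_bounded (\<lambda>x. cells (enc (s x)) + length (xs x) * c x)"
    by (intro poly_bounded_intros xs s c)
next
  fix x y i and t :: 's
  assume "cells (enc t) \<le> cells (enc (s x)) + i * c x" "y \<in> set (xs x)"
  then show "cells (enc (f x y t)) \<le> cells (enc (s x)) + Suc i * c x"
    using step[of y x t] by simp
next
  fix x i and t :: 's
  assume "cells (enc t) \<le> cells (enc (s x)) + i * c x" "i \<le> length (xs x)"
  moreover have "i * c x \<le> length (xs x) * c x"
    using \<open>i \<le> length (xs x)\<close> by simp
  ultimately show "cells (enc t) \<le> cells (enc (s x)) + length (xs x) * c x"
    by linarith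
qed simp

section \<open>Reversal, filtering, searching and bounded quantification over lists\<close>

lemma polytime_fun_rev [polytime_intros]:
  assumes "polytime_fun xs"
  shows "polytime_fun (\<lambda>x. rev (xs x))"
proof -
  have "polytime_fun (\<lambda>x. fold (\<lambda>y s. y # s) (xs x) [])"
    by (rule polytime_fun_fold_increment[where c = "\<lambda>x. 1 + cells (enc (xs x))"])
      (auto intro!: polytime_intros poly_bounded_intros assms dest: cells_enc_mem)
  then show ?thesis by (simp add: fold_Cons_rev)
qed

lemma polytime_fun_filter [polytime_intros]:
  assumes "polytime_fun (\<lambda>p. P (fst p) (snd p))" "polytime_fun xs"
  shows "polytime_fun (\<lambda>x. filter (P x) (xs x))"
proof -
  have "fold (\<lambda>y s. if P x y then y # s else s) ys s = rev (filter (P x) ys) @ s" for x ys s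
    by (induction ys arbitrary: s) auto
  \<comment> \<open>The accumulator comes out reversed, so the fold runs over the reversed
    list.\<close>
  moreover have "polytime_fun (\<lambda>x. fold (\<lambda>y s. if P x y then y # s else s) (rev (xs x)) [])"
    by (rule polytime_fun_fold_increment[where c = "\<lambda>x. 1 + cells (enc (xs x))"])
      (auto intro!: polytime_intros poly_bounded_intros assms polytime_fun_app2[OF assms(1)]
        dest: cells_enc_mem)
  ultimately show ?thesis by (simp add: rev_filter)
qed

lemma polytime_fun_find [polytime_intros]:
  assumes "polytime_fun (\<lambda>p. P (fst p) (snd p))" "polytime_fun xs"
  shows "polytime_fun (\<lambda>x. List.find (P x) (xs x))"
proof -
  let ?f = "\<lambda>x y s. case s of None \<Rightarrow> if P x y then Some y else None | Some z \<Rightarrow> Some z"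
  have "fold (?f x) ys (Some z) = Some z" for x ys z
    by (induction ys) auto
  then have "fold (?f x) ys None = List.find (P x) ys" for x ys
    by (induction ys) auto
  moreover have "polytime_fun (\<lambda>x. fold (?f x) (xs x) None)"
    by (rule polytime_fun_fold_increment[where c = "\<lambda>x. 1 + cells (enc (xs x))"])
      (auto intro!: polytime_intros poly_bounded_intros assms polytime_fun_app2[OF assms(1)]
        dest: cells_enc_mem split: option.splits)
  ultimately show ?thesis by simp
qed

lemma polytime_fun_list_ex [polytime_intros]:
  assumes "polytime_fun (\<lambda>p. P (fst p) (snd p))" "polytime_fun xs"
  shows "polytime_fun (\<lambda>x. list_ex (P x) (xs x))"
proof -
  have "list_ex (P x) ys \<longleftrightarrow> List.find (P x) ys \<noteq> None" for x ys
    by (auto simp: find_None_iff list_ex_iff)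
  then show ?thesis
    by (simp only:) (intro polytime_intros assms)
qed

lemma polytime_fun_list_all [polytime_intros]:
  assumes "polytime_fun (\<lambda>p. P (fst p) (snd p))" "polytime_fun xs"
  shows "polytime_fun (\<lambda>x. list_all (P x) (xs x))"
proof -
  have "list_all (P x) ys \<longleftrightarrow> \<not> list_ex (\<lambda>y. \<not> P x y) ys" for x ys
    by (auto simp: list_all_iff list_ex_iff)
  then show ?thesis
    by (simp only:) (intro polytime_intros assms)
qed

lemma polytime_fun_mem [polytime_intros]:
  assumes "polytime_fun f" "polytime_fun xs"
  shows "polytime_fun (\<lambda>x. f x \<in> set (xs x))"
proof -
  have "y \<in> set ys \<longleftrightarrow> list_ex (\<lambda>z. z = y) ys" for y and ys :: "'b list"
    by (auto simp: list_ex_iff)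
  then show ?thesis
    by (simp only:) (intro polytime_intros polytime_fun_compose[OF assms(1)] assms(2))
qed

section \<open>The procedures\<close>

datatype node =
  Node (node_id: nat) (node_clause: "literal list") (node_var: "var option") (node_preds: "nat list")

instantiation node :: enc
begin
text \<open>The trailing unit is encoded by \<open>Atom\<close> and thus terminates the list of four
  entries that \<open>encodes_node\<close> prescribes.\<close>

definition enc_node :: "node \<Rightarrow> val" where
  "enc_node n = enc (node_id n, node_clause n, node_var n, node_preds n, ())"
instance by standard (auto simp: enc_node_def intro: node.expand)
end

lemma enc_Node [simp]:
  "enc (Node u c v ps) = Pair (enc u) (Pair (enc c) (Pair (enc v) (Pair (enc ps) Atom)))"
  by (simp add: enc_node_def)

lemma polytime_fun_Node [polytime_intros]:
  "polytime_fun f \<Longrightarrow> polytime_fun g \<Longrightarrow> polytime_fun h \<Longrightarrow> polytime_fun k \<Longrightarrow>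
    polytime_fun (\<lambda>x. Node (f x) (g x) (h x) (k x))"
  unfolding polytime_fun_def by (simp add: poly_computable_Pair poly_computable_Atom)

lemma polytime_fun_node_sel [polytime_intros]:
  assumes "polytime_fun f"
  shows "polytime_fun (\<lambda>x. node_id (f x))" "polytime_fun (\<lambda>x. node_clause (f x))"
    "polytime_fun (\<lambda>x. node_var (f x))" "polytime_fun (\<lambda>x. node_preds (f x))"
proof -
  have "polytime_fun (\<lambda>x. (node_id (f x), node_clause (f x), node_var (f x), node_preds (f x), ()))"
    (is "polytime_fun ?t")
    using assms unfolding polytime_fun_def by (simp add: enc_node_def)
  note t = this
  show "polytime_fun (\<lambda>x. node_id (f x))" "polytime_fun (\<lambda>x. node_clause (f x))"
    "polytime_fun (\<lambda>x. node_var (f x))" "polytime_fun (\<lambda>x. node_preds (f x))"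
    using polytime_fun_fst[OF t] polytime_fun_fst[OF polytime_fun_snd[OF t]]
      polytime_fun_fst[OF polytime_fun_snd[OF polytime_fun_snd[OF t]]]
      polytime_fun_fst[OF polytime_fun_snd[OF polytime_fun_snd[OF polytime_fun_snd[OF t]]]]
    by simp_all
qed

lemma cells_node:
  "cells (enc n) = 5 + cells (enc (node_id n)) + cells (enc (node_clause n))
     + cells (enc (node_var n)) + cells (enc (node_preds n))"
  by (cases n) simp

definition find_node :: "nat \<Rightarrow> node list \<Rightarrow> node option" where
  "find_node u N = List.find (\<lambda>n. node_id n = u) N"

lemma polytime_fun_find_node [polytime_intros]:
  "polytime_fun f \<Longrightarrow> polytime_fun g \<Longrightarrow> polytime_fun (\<lambda>x. find_node (f x) (g x))"
  by (rule polytime_fun_app2) (unfold find_node_def, intro polytime_intros)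

lemma find_Some_mem: "List.find P xs = Some x \<Longrightarrow> x \<in> set xs \<and> P x"
  by (auto simp: find_Some_iff)

lemma cells_filter: "cells (enc (filter P xs)) \<le> cells (enc xs)"
  by (induction xs) auto

lemma cells_fold:
  assumes "\<And>y t. y \<in> set xs \<Longrightarrow> cells (enc (f y t)) \<le> cells (enc t) + c"
  shows "cells (enc (fold f xs s)) \<le> cells (enc s) + length xs * c"
  using assms
proof (induction xs arbitrary: s)
  case (Cons x xs)
  have "cells (enc (fold f xs (f x s))) \<le> cells (enc (f x s)) + length xs * c"
    using Cons.prems by (intro Cons.IH) auto
  also have "cells (enc (f x s)) \<le> cells (enc s) + c"
    using Cons.prems by auto
  finally show ?case by simp
qed simp

subsection \<open>Topological sorting\<close>

definition topo_step :: "node \<Rightarrow> node list \<Rightarrow> node list" where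
  "topo_step n A =
     (if find_node (node_id n) A = None \<and> list_all (\<lambda>p. find_node p A \<noteq> None) (node_preds n)
      then n # A else A)"

text \<open>Each pass over \<open>N\<close> inserts at least one missing node, so
  \<open>length N\<close> passes suffice; the outer fold uses \<open>N\<close> only as a
  counter.\<close>

definition topo_sort :: "node list \<Rightarrow> node list" where
  "topo_sort N = fold (\<lambda>_ A. fold topo_step N A) N []"

lemma polytime_fun_topo_step [polytime_intros]:
  "polytime_fun f \<Longrightarrow> polytime_fun g \<Longrightarrow> polytime_fun (\<lambda>x. topo_step (f x) (g x))"
  by (rule polytime_fun_app2) (unfold topo_step_def, intro polytime_intros)

lemma cells_topo_step: "n \<in> set N \<Longrightarrow> cells (enc (topo_step n A)) \<le> cells (enc A) + (1 + cells (enc N))"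
  using cells_enc_mem[of n N] by (simp add: topo_step_def)

lemma polytime_fun_topo_sort: "polytime_fun topo_sort"
  unfolding topo_sort_def[abs_def]
proof (rule polytime_fun_fold_increment)
  show "polytime_fun (\<lambda>p :: node list \<times> node \<times> node list. fold topo_step (fst p) (snd (snd p)))"
    by (rule polytime_fun_fold_increment[where c = "\<lambda>p. 1 + cells (enc (fst p))"])
      (intro polytime_intros poly_bounded_intros cells_topo_step | assumption)+
  show "poly_bounded (\<lambda>N :: node list. length N * (1 + cells (enc N)))"
    by (intro poly_bounded_intros polytime_intros)
  show "cells (enc (fold topo_step N A)) \<le> cells (enc A) + length N * (1 + cells (enc N))" for N A
    by (rule cells_fold) (rule cells_topo_step)
qed (intro polytime_intros)+

subsection \<open>Eliminating w-resolution\<close>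

definition sub_clause :: "literal list \<Rightarrow> literal list \<Rightarrow> bool" where
  "sub_clause c d = list_all (\<lambda>l. l \<in> set d) c"

lemma polytime_fun_sub_clause [polytime_intros]:
  "polytime_fun f \<Longrightarrow> polytime_fun g \<Longrightarrow> polytime_fun (\<lambda>x. sub_clause (f x) (g x))"
  by (rule polytime_fun_app2) (unfold sub_clause_def, intro polytime_intros)

lemma sub_clause_iff [simp]: "sub_clause c d \<longleftrightarrow> set c \<subseteq> set d"
  by (auto simp: sub_clause_def list_all_iff)

text \<open>The resolvent of \<open>c\<close> and \<open>d\<close> is computed as a sublist of the clause \<open>e\<close> that is known
  to contain it; this keeps the clauses from growing.\<close>

definition w_resolvent :: "var \<Rightarrow> literal list \<Rightarrow> literal list \<Rightarrow> literal list \<Rightarrow> literal list" where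
  "w_resolvent x c d e =
     (let f = (\<lambda>c d. filter (\<lambda>l. (l \<in> set c \<and> l \<noteq> Pos x) \<or> (l \<in> set d \<and> l \<noteq> Neg x)) e)
      in if list_all (\<lambda>l. l = Pos x \<or> l \<in> set e) c \<and> list_all (\<lambda>l. l = Neg x \<or> l \<in> set e) d
         then f c d else f d c)"

text \<open>The first component of the state assigns to each processed node the name and clause of
  its representative, the second lists the new derivation. If neither representative of the premises
  is contained in the clause of \<open>n\<close>, each must contain a literal that the inference
  removes, so a genuine resolvent can be formed.\<close>

definition rep_step ::
    "node \<Rightarrow> (nat \<times> nat \<times> literal list) list \<times> node list \<Rightarrow> (nat \<times> nat \<times> literal list) list \<times> node list"
  where
  "rep_step n s =
     (case node_var n of
        None \<Rightarrow> ((node_id n, node_id n, node_clause n) # fst s,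
                 Node (node_id n) (node_clause n) None [] # snd s)
      | Some x \<Rightarrow> (case node_preds n of [] \<Rightarrow> s | p # ps \<Rightarrow> (case ps of [] \<Rightarrow> s | q # _ \<Rightarrow>
          (case List.find (\<lambda>e. fst e = p) (fst s) of None \<Rightarrow> s | Some a \<Rightarrow>
          (case List.find (\<lambda>e. fst e = q) (fst s) of None \<Rightarrow> s | Some b \<Rightarrow>
             if sub_clause (snd (snd a)) (node_clause n) then ((node_id n, snd a) # fst s, snd s)
             else if sub_clause (snd (snd b)) (node_clause n) then ((node_id n, snd b) # fst s, snd s)
             else
               ((node_id n, node_id n, w_resolvent x (snd (snd a)) (snd (snd b)) (node_clause n)) # fst s,
                Node (node_id n) (w_resolvent x (snd (snd a)) (snd (snd b)) (node_clause n)) (Some x)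
                   [fst (snd a), fst (snd b)] # snd s))))))"

definition strict_resolution :: "node list \<Rightarrow> node list" where
  "strict_resolution N = snd (fold rep_step (rev N) ([], []))"

lemma polytime_fun_w_resolvent [polytime_intros]:
  assumes "polytime_fun f" "polytime_fun g" "polytime_fun h" "polytime_fun k"
  shows "polytime_fun (\<lambda>x. w_resolvent (f x) (g x) (h x) (k x))"
proof -
  have "polytime_fun (\<lambda>p. w_resolvent (fst p) (fst (snd p)) (fst (snd (snd p))) (snd (snd (snd p))))"
    unfolding w_resolvent_def Let_def by (intro polytime_intros)
  then show ?thesis
    using polytime_fun_compose[of _ "\<lambda>x. (f x, g x, h x, k x)"] assms
    by (fastforce intro: polytime_intros)
qed

lemma polytime_fun_rep_step [polytime_intros]:
  "polytime_fun f \<Longrightarrow> polytime_fun g \<Longrightarrow> polytime_fun (\<lambda>x. rep_step (f x) (g x))"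
  by (rule polytime_fun_app2) (unfold rep_step_def, intro polytime_intros)

lemma cells_w_resolvent: "cells (enc (w_resolvent x c d e)) \<le> cells (enc e)"
  by (simp add: w_resolvent_def Let_def cells_filter)

text \<open>An entry may be copied from an earlier one. The uniform bound \<open>k\<close> on all
  entries is therefore carried along; it keeps the growth per step independent of the number of
  steps before.\<close>

lemma rep_step_size:
  assumes "\<forall>e \<in> set (fst s). cells (enc (snd e)) \<le> k" "cells (enc n) \<le> k"
  shows "(\<forall>e \<in> set (fst (rep_step n s)). cells (enc (snd e)) \<le> k) \<and>
    cells (enc (rep_step n s)) \<le> cells (enc s) + (7 * k + 40)"
proof -
  note [simp] = enc_prod_def[of s]
  have size: "cells (enc (node_id n)) + cells (enc (node_clause n)) + 5 \<le> k"
    using assms(2) cells_node[of n] by simp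
  show ?thesis
  proof (cases "node_var n")
    case None
    then show ?thesis using assms size by (simp add: rep_step_def)
  next
    case (Some x)
    have var: "cells (enc x) \<le> k"
      using assms(2) cells_node[of n] Some by simp
    show ?thesis
    proof (cases "rep_step n s = s")
      case False
      then obtain p q ps a b where preds: "node_preds n = p # q # ps"
        and a: "List.find (\<lambda>e. fst e = p) (fst s) = Some a"
        and b: "List.find (\<lambda>e. fst e = q) (fst s) = Some b"
        using Some by (auto simp: rep_step_def split: list.splits option.splits)
      have ak: "cells (enc (snd a)) \<le> k" and bk: "cells (enc (snd b)) \<le> k"
        using assms(1) find_Some_mem[OF a] find_Some_mem[OF b] by auto
      then have "cells (enc (fst (snd a))) \<le> k" "cells (enc (fst (snd b))) \<le> k"
        by (simp_all add: enc_prod_def)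
      moreover have "cells (enc (w_resolvent x (snd (snd a)) (snd (snd b)) (node_clause n)))
          \<le> cells (enc (node_clause n))"
        by (rule cells_w_resolvent)
      ultimately show ?thesis
        using assms(1) ak bk size var by (auto simp: rep_step_def Some preds a b)
    qed (use assms in auto)
  qed
qed

lemma polytime_fun_strict_resolution: "polytime_fun strict_resolution"
proof -
  let ?b = "\<lambda>N :: node list. 7 * cells (enc N) + 40"
  have "polytime_fun (\<lambda>N. fold rep_step (rev N) ([], []))"
  \<comment> \<open>The initial state \<open>([], [])\<close> occupies \<open>3\<close>
    cells.\<close>
  proof (rule polytime_fun_fold_invariant[where
        I = "\<lambda>N i s. (\<forall>e \<in> set (fst s). cells (enc (snd e)) \<le> cells (enc N)) \<and>
          cells (enc s) \<le> 3 + i * ?b N"])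
    show "poly_bounded (\<lambda>N :: node list. 3 + length (rev N) * ?b N)"
      by (intro poly_bounded_intros polytime_intros)
  next
    fix N :: "node list" and i n and s :: "(nat \<times> nat \<times> literal list) list \<times> node list"
    assume "(\<forall>e \<in> set (fst s). cells (enc (snd e)) \<le> cells (enc N)) \<and> cells (enc s) \<le> 3 + i * ?b N"
      and "n \<in> set (rev N)"
    then show "(\<forall>e \<in> set (fst (rep_step n s)). cells (enc (snd e)) \<le> cells (enc N)) \<and>
        cells (enc (rep_step n s)) \<le> 3 + Suc i * ?b N"
      using rep_step_size[of s "cells (enc N)" n] cells_enc_mem[of n N] by auto
  next
    fix N :: "node list" and i and s :: "(nat \<times> nat \<times> literal list) list \<times> node list"
    assume "(\<forall>e \<in> set (fst s). cells (enc (snd e)) \<le> cells (enc N)) \<and> cells (enc s) \<le> 3 + i * ?b N"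
      and "i \<le> length (rev N)"
    moreover have "i * ?b N \<le> length (rev N) * ?b N"
      using \<open>i \<le> length (rev N)\<close> by (rule mult_le_mono1)
    ultimately show "cells (enc s) \<le> 3 + length (rev N) * ?b N" by linarith
  qed (intro polytime_intros | simp)+
  then show ?thesis
    unfolding strict_resolution_def[abs_def] by (rule polytime_fun_snd)
qed

subsection \<open>Removing useless nodes\<close>

text \<open>As nodes stand before their predecessors, a single pass marks everything from which the
  root is derived. The root is the first node with the empty clause; the test \<open>S = []\<close>
  prevents a second one.\<close>

definition needed_step :: "node \<Rightarrow> nat list \<Rightarrow> nat list" where
  "needed_step n S =
     (if (S = [] \<and> node_clause n = []) \<or> node_id n \<in> set S
      then node_id n # (case node_preds n of [] \<Rightarrow> S | p # ps \<Rightarrow> (case ps of [] \<Rightarrow> S | q # _ \<Rightarrow> p # q # S))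
      else S)"

definition needed :: "node list \<Rightarrow> nat list" where
  "needed N = fold needed_step N []"

definition prune :: "node list \<Rightarrow> node list" where
  "prune N = filter (\<lambda>n. node_id n \<in> set (needed N)) N"

lemma polytime_fun_needed_step [polytime_intros]:
  "polytime_fun f \<Longrightarrow> polytime_fun g \<Longrightarrow> polytime_fun (\<lambda>x. needed_step (f x) (g x))"
  by (rule polytime_fun_app2) (unfold needed_step_def, intro polytime_intros)

lemma polytime_fun_needed: "polytime_fun needed"
  unfolding needed_def[abs_def]
proof (rule polytime_fun_fold_increment[where c = "\<lambda>N. cells (enc N)"])
  fix N :: "node list" and n S
  assume "n \<in> set N"
  then have "cells (enc n) \<le> cells (enc N)" using cells_enc_mem less_imp_le by blast
  then show "cells (enc (needed_step n S)) \<le> cells (enc S) + cells (enc N)"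
    by (auto simp: needed_step_def cells_node split: list.splits)
qed (intro polytime_intros poly_bounded_intros)+

lemma polytime_fun_prune: "polytime_fun prune"
  unfolding prune_def[abs_def] by (intro polytime_intros polytime_fun_compose[OF polytime_fun_needed])

subsection \<open>Turning trees into dags\<close>

text \<open>Nodes are visited in the order root, right subtree, left subtree and collected at the
  front of a list, which therefore ends up in post-order.\<close>

definition visit_step :: "ltree list \<times> ltree list \<Rightarrow> ltree list \<times> ltree list" where
  "visit_step s =
     (case fst s of [] \<Rightarrow> s | t # ts \<Rightarrow>
        (case t of LLeaf c \<Rightarrow> (ts, t # snd s) | LInfer x c l r \<Rightarrow> (r # l # ts, t # snd s)))"

definition subtrees :: "ltree \<Rightarrow> ltree list" where
  "subtrees t = snd (fold (\<lambda>_. visit_step) (fuel t) ([t], []))"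

text \<open>The newest node is at the head and has the largest name, so this name exceeds all
  others. Its value may double each time, but its binary notation grows by one bit only.\<close>

definition fresh_id :: "node list \<Rightarrow> nat" where
  "fresh_id N = (case N of [] \<Rightarrow> 0 | n # _ \<Rightarrow> Suc (2 * node_id n))"

text \<open>Mutual inclusion instead of equality, because one clause may be listed in different
  orders.\<close>

definition find_clause :: "literal list \<Rightarrow> node list \<Rightarrow> node option" where
  "find_clause c N = List.find (\<lambda>n. sub_clause c (node_clause n) \<and> sub_clause (node_clause n) c) N"

text \<open>A leaf whose clause has not occurred yet becomes an initial node without any test of
  membership in \<open>F\<close>: a lemma repeats an earlier clause and is caught by the first
  test.\<close>

definition add_step :: "ltree \<Rightarrow> node list \<Rightarrow> node list" where
  "add_step t N =
     (if find_clause (ltree_clause t) N \<noteq> None then N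
      else (case t of
        LLeaf c \<Rightarrow> Node (fresh_id N) c None [] # N
      | LInfer x c l r \<Rightarrow>
          (case find_clause (ltree_clause l) N of None \<Rightarrow> N | Some a \<Rightarrow>
          (case find_clause (ltree_clause r) N of None \<Rightarrow> N | Some b \<Rightarrow>
             Node (fresh_id N) c (Some x) [node_id a, node_id b] # N))))"

definition linearize :: "ltree \<Rightarrow> node list" where
  "linearize t = fold add_step (subtrees t) []"

lemma polytime_fun_visit_step [polytime_intros]:
  assumes "polytime_fun f"
  shows "polytime_fun (\<lambda>x. visit_step (f x))"
  by (rule polytime_fun_compose[OF _ assms]) (unfold visit_step_def, intro polytime_intros)

lemma polytime_fun_ltree_clause [polytime_intros]:
  assumes "polytime_fun f"
  shows "polytime_fun (\<lambda>x. ltree_clause (f x))"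
proof -
  have eq: "ltree_clause = (\<lambda>t. case t of LLeaf c \<Rightarrow> c | LInfer x c l r \<Rightarrow> c)"
    by (auto simp: fun_eq_iff split: ltree.splits)
  have "polytime_fun ltree_clause" unfolding eq by (intro polytime_intros)
  then show ?thesis using assms by (rule polytime_fun_compose)
qed

lemma polytime_fun_fresh_id [polytime_intros]:
  assumes "polytime_fun f"
  shows "polytime_fun (\<lambda>x. fresh_id (f x))"
  by (rule polytime_fun_compose[OF _ assms]) (unfold fresh_id_def, intro polytime_intros)

lemma polytime_fun_find_clause [polytime_intros]:
  "polytime_fun f \<Longrightarrow> polytime_fun g \<Longrightarrow> polytime_fun (\<lambda>x. find_clause (f x) (g x))"
  by (rule polytime_fun_app2) (unfold find_clause_def, intro polytime_intros)

lemma polytime_fun_add_step [polytime_intros]: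
  "polytime_fun f \<Longrightarrow> polytime_fun g \<Longrightarrow> polytime_fun (\<lambda>x. add_step (f x) (g x))"
  by (rule polytime_fun_app2) (unfold add_step_def, intro polytime_intros)

lemma polytime_fun_subtrees [polytime_intros]:
  assumes "polytime_fun f"
  shows "polytime_fun (\<lambda>x. subtrees (f x))"
proof -
  let ?b = "\<lambda>t :: ltree. 3 + cells (enc t)"
  have "polytime_fun (\<lambda>t. fold (\<lambda>_. visit_step) (fuel t) ([t], []))"
  proof (rule polytime_fun_fold_invariant[where
        I = "\<lambda>t i s. (\<forall>t' \<in> set (fst s). cells (enc t') \<le> cells (enc t)) \<and>
          cells (enc s) \<le> 4 + cells (enc t) + i * ?b t"])
    show "poly_bounded (\<lambda>t :: ltree. 4 + cells (enc t) + length (fuel t) * ?b t)"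
      by (intro poly_bounded_intros polytime_intros)
  next
    fix t :: ltree and i :: nat and y :: unit and s :: "ltree list \<times> ltree list"
    assume "(\<forall>t' \<in> set (fst s). cells (enc t') \<le> cells (enc t)) \<and>
      cells (enc s) \<le> 4 + cells (enc t) + i * ?b t"
    moreover have "(\<forall>t' \<in> set (fst (visit_step s)). cells (enc t') \<le> cells (enc t)) \<and>
        cells (enc (visit_step s)) \<le> cells (enc s) + ?b t"
      if "\<forall>t' \<in> set (fst s). cells (enc t') \<le> cells (enc t)"
      using that by (cases s) (auto simp: visit_step_def split: list.splits ltree.splits)
    ultimately show "(\<forall>t' \<in> set (fst (visit_step s)). cells (enc t') \<le> cells (enc t)) \<and>
        cells (enc (visit_step s)) \<le> 4 + cells (enc t) + Suc i * ?b t"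
      by auto
  next
    fix t :: ltree and i and s :: "ltree list \<times> ltree list"
    assume "(\<forall>t' \<in> set (fst s). cells (enc t') \<le> cells (enc t)) \<and>
      cells (enc s) \<le> 4 + cells (enc t) + i * ?b t" and "i \<le> length (fuel t)"
    moreover have "i * ?b t \<le> length (fuel t) * ?b t"
      using \<open>i \<le> length (fuel t)\<close> by (rule mult_le_mono1)
    ultimately show "cells (enc s) \<le> 4 + cells (enc t) + length (fuel t) * ?b t" by linarith
  qed (intro polytime_intros | simp)+
  then have "polytime_fun subtrees"
    unfolding subtrees_def[abs_def] by (rule polytime_fun_snd)
  then show ?thesis using assms by (rule polytime_fun_compose)
qed

text \<open>The name \<open>0\<close> has one cell, and every new name has four cells more than the
  one at the head, namely a \<open>Pair\<close> and a bit of three cells; this gives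
  \<open>1 + 4 * i\<close>. A new inference node contains three names, whence
  \<open>12 * i\<close>.\<close>

lemma add_step_size:
  assumes "\<forall>n \<in> set N. cells (enc (node_id n)) \<le> 1 + 4 * i" "cells (enc t) \<le> k"
  shows "(\<forall>n \<in> set (add_step t N). cells (enc (node_id n)) \<le> 1 + 4 * Suc i) \<and>
    cells (enc (add_step t N)) \<le> cells (enc N) + (30 + 12 * i + k)"
proof -
  have fresh: "cells (enc (fresh_id N)) \<le> 1 + 4 * Suc i"
    using assms(1) by (auto simp: fresh_id_def split: list.splits)
  have old: "\<forall>n \<in> set N. cells (enc (node_id n)) \<le> 1 + 4 * Suc i"
    using assms(1) by (auto dest: bspec)
  have find: "cells (enc (node_id n)) \<le> 1 + 4 * i" if "find_clause c N = Some n" for c n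
    using assms(1) find_Some_mem[OF that[unfolded find_clause_def]] by blast
  show ?thesis
  proof (cases t)
    case (LLeaf c)
    then show ?thesis using assms(2) fresh old by (auto simp: add_step_def)
  next
    case (LInfer x c l r)
    show ?thesis
    proof (cases "find_clause c N = None \<and> find_clause (ltree_clause l) N \<noteq> None \<and>
        find_clause (ltree_clause r) N \<noteq> None")
      case True
      then obtain a b where ab: "find_clause (ltree_clause l) N = Some a"
        "find_clause (ltree_clause r) N = Some b" "find_clause c N = None"
        by blast
      then show ?thesis
        using assms(2) fresh old find[OF ab(1)] find[OF ab(2)] by (simp add: add_step_def LInfer)
    next
      case False
      then have "add_step t N = N" by (cases "find_clause (ltree_clause l) N"; cases "find_clause (ltree_clause r) N")
          (auto simp: add_step_def LInfer)
      then show ?thesis using old by simp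
    qed
  qed
qed

lemma polytime_fun_linearize: "polytime_fun linearize"
  unfolding linearize_def[abs_def]
proof -
  let ?k = "\<lambda>t. cells (enc (subtrees t))"
  let ?b = "\<lambda>t. 30 + 12 * length (subtrees t) + ?k t"
  show "polytime_fun (\<lambda>t. fold add_step (subtrees t) [])"
  proof (rule polytime_fun_fold_invariant[where
        I = "\<lambda>t i N. (\<forall>n \<in> set N. cells (enc (node_id n)) \<le> 1 + 4 * i) \<and>
          cells (enc N) \<le> 1 + i * ?b t"])
    show "poly_bounded (\<lambda>t. 1 + length (subtrees t) * ?b t)"
      by (intro poly_bounded_intros polytime_intros)
  next
    fix t i N t'
    assume "(\<forall>n \<in> set N. cells (enc (node_id n)) \<le> 1 + 4 * i) \<and> cells (enc N) \<le> 1 + i * ?b t"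
      and "t' \<in> set (subtrees t)" and "i < length (subtrees t)"
    moreover from this have "cells (enc t') \<le> ?k t"
      using cells_enc_mem less_imp_le by blast
    ultimately show "(\<forall>n \<in> set (add_step t' N). cells (enc (node_id n)) \<le> 1 + 4 * Suc i) \<and>
        cells (enc (add_step t' N)) \<le> 1 + Suc i * ?b t"
      using add_step_size[of N i t' "?k t"] by auto
  next
    fix t i N
    assume "(\<forall>n \<in> set N. cells (enc (node_id n)) \<le> 1 + 4 * i) \<and> cells (enc N) \<le> 1 + i * ?b t"
      and "i \<le> length (subtrees t)"
    moreover have "i * ?b t \<le> length (subtrees t) * ?b t"
      using \<open>i \<le> length (subtrees t)\<close> by (rule mult_le_mono1)
    ultimately show "cells (enc N) \<le> 1 + length (subtrees t) * ?b t" by linarith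
  qed (intro polytime_intros | simp)+
qed

subsection \<open>Unfolding dags into trees\<close>

text \<open>The state of the depth-first search consists of a stack of tasks, the nodes whose clauses
  are available as lemmas, and a stack of completed subtrees. A task is a node together with a flag
  which tells whether the subtrees of its predecessors are already on the stack.\<close>

definition known :: "nat list \<Rightarrow> node \<Rightarrow> bool" where
  "known K n \<longleftrightarrow> node_preds n = [] \<or> node_id n \<in> set K"

text \<open>If both predecessors are known, the inference from two leaves is an input resolution
  tree and \<open>n\<close> becomes a lemma. A node completed after expansion is not added to the
  lemmas, as its tree need not have input shape; it may have to be visited again.\<close>

definition search_step :: "node list \<Rightarrow> (nat \<times> bool) list \<times> nat list \<times> ltree list \<Rightarrow>
    (nat \<times> bool) list \<times> nat list \<times> ltree list" where
  "search_step N s =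
     (case fst s of [] \<Rightarrow> s | w # W \<Rightarrow> (case find_node (fst w) N of None \<Rightarrow> s | Some n \<Rightarrow>
        if \<not> snd w \<and> known (fst (snd s)) n
        then (W, fst (snd s), LLeaf (node_clause n) # snd (snd s))
        else (case node_var n of None \<Rightarrow> s | Some x \<Rightarrow>
          if snd w
          then (case snd (snd s) of [] \<Rightarrow> s | r # ts \<Rightarrow> (case ts of [] \<Rightarrow> s | l # ts' \<Rightarrow>
                  (W, fst (snd s), LInfer x (node_clause n) l r # ts')))
          else (case node_preds n of [] \<Rightarrow> s | p # ps \<Rightarrow> (case ps of [] \<Rightarrow> s | q # _ \<Rightarrow>
            (case find_node p N of None \<Rightarrow> s | Some a \<Rightarrow> (case find_node q N of None \<Rightarrow> s | Some b \<Rightarrow>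
               if known (fst (snd s)) a \<and> known (fst (snd s)) b
               then (W, node_id n # fst (snd s),
                 LInfer x (node_clause n) (LLeaf (node_clause a)) (LLeaf (node_clause b)) # snd (snd s))
               else ((node_id a, False) # (node_id b, False) # (node_id n, True) # W, snd s))))))))"

text \<open>The nested folds provide quadratically many steps, because the tree may have as many
  inferences as the square of the number of nodes.\<close>

definition search :: "node list \<Rightarrow> (nat \<times> bool) list \<times> nat list \<times> ltree list \<Rightarrow>
    (nat \<times> bool) list \<times> nat list \<times> ltree list" where
  "search N s = fold (\<lambda>_ s. fold (\<lambda>_. search_step N) (fuel N) s) (fuel N) s"

definition unfold_dag :: "node list \<Rightarrow> ltree" where
  "unfold_dag N =
     (case List.find (\<lambda>n. node_clause n = []) N of None \<Rightarrow> LLeaf [] | Some n \<Rightarrow>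
        (case snd (snd (search N ([(node_id n, False)], [], []))) of [] \<Rightarrow> LLeaf [] | t # _ \<Rightarrow> t))"

lemma polytime_fun_known [polytime_intros]:
  "polytime_fun f \<Longrightarrow> polytime_fun g \<Longrightarrow> polytime_fun (\<lambda>x. known (f x) (g x))"
  by (rule polytime_fun_app2) (unfold known_def, intro polytime_intros)

lemma polytime_fun_search_step [polytime_intros]:
  "polytime_fun f \<Longrightarrow> polytime_fun g \<Longrightarrow> polytime_fun (\<lambda>x. search_step (f x) (g x))"
  by (rule polytime_fun_app2) (unfold search_step_def, intro polytime_intros)

lemma cells_search_step: "cells (enc (search_step N s)) \<le> cells (enc s) + (5 * cells (enc N) + 50)"
proof (cases "search_step N s = s")
  case False
  obtain W K ts where s: "s = (W, K, ts)" by (cases s)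
  have size: "cells (enc n) \<le> cells (enc N)" if "find_node u N = Some n" for u n
    using find_Some_mem[OF that[unfolded find_node_def]] cells_enc_mem[of n N] by simp
  obtain w W' n where W: "W = w # W'" "find_node (fst w) N = Some n"
    using False by (auto simp: search_step_def s split: list.splits option.splits)
  show ?thesis
  proof (cases "\<not> snd w \<and> known K n")
    case True
    then show ?thesis using size[OF W(2)] by (simp add: search_step_def s W cells_node)
  next
    case False': False
    then obtain x where x: "node_var n = Some x"
      using False by (auto simp: search_step_def s W split: option.splits)
    show ?thesis
    proof (cases "snd w")
      case True
      then show ?thesis using size[OF W(2)] x
        by (auto simp: search_step_def s W cells_node split: list.splits)
    next
      case False'': False
      then obtain p q ps a b where preds: "node_preds n = p # q # ps"
        "find_node p N = Some a" "find_node q N = Some b"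
        using False False' x by (auto simp: search_step_def s W split: list.splits option.splits)
      show ?thesis
        using False' False'' x preds(1) size[OF W(2)] size[OF preds(2)] size[OF preds(3)]
        by (auto simp: search_step_def s W preds cells_node)
    qed
  qed
qed simp

lemma polytime_fun_search [polytime_intros]:
  assumes "polytime_fun f" "polytime_fun g"
  shows "polytime_fun (\<lambda>x. search (f x) (g x))"
proof (rule polytime_fun_app2[OF _ assms])
  let ?b = "\<lambda>N :: node list. 5 * cells (enc N) + 50"
  show "polytime_fun (\<lambda>p. search (fst p) (snd p))"
    unfolding search_def
  proof (rule polytime_fun_fold_increment)
    show "polytime_fun (\<lambda>p :: (node list \<times> (nat \<times> bool) list \<times> nat list \<times> ltree list) \<times> unit \<times> _.
        fold (\<lambda>_. search_step (fst (fst p))) (fuel (fst (fst p))) (snd (snd p)))"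
      by (rule polytime_fun_fold_increment[where c = "\<lambda>p. ?b (fst (fst p))"])
        (intro polytime_intros poly_bounded_intros cells_search_step)+
    show "poly_bounded (\<lambda>p :: node list \<times> (nat \<times> bool) list \<times> nat list \<times> ltree list.
        length (fuel (fst p)) * ?b (fst p))"
      by (intro poly_bounded_intros polytime_intros)
  next
    fix p :: "node list \<times> (nat \<times> bool) list \<times> nat list \<times> ltree list" and s
    show "cells (enc (fold (\<lambda>_. search_step (fst p)) (fuel (fst p)) s))
        \<le> cells (enc s) + length (fuel (fst p)) * ?b (fst p)"
      by (rule cells_fold) (rule cells_search_step)
  qed (intro polytime_intros)+
qed

lemma polytime_fun_unfold_dag: "polytime_fun unfold_dag"
  unfolding unfold_dag_def[abs_def] by (intro polytime_intros)

section \<open>Linear derivations\<close>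

abbreviation clause_of_node :: "node \<Rightarrow> clause" where
  "clause_of_node n \<equiv> fset_of_list (node_clause n)"

definition justified :: "inference_rule \<Rightarrow> clause set \<Rightarrow> node set \<Rightarrow> node \<Rightarrow> bool" where
  "justified R F N n \<longleftrightarrow> distinct (node_clause n) \<and>
     (node_var n = None \<and> node_preds n = [] \<and> clause_of_node n \<in> F \<or>
      (\<exists>x. \<exists>a \<in> N. \<exists>b \<in> N. node_id a \<noteq> node_id b \<and> node_var n = Some x \<and>
         node_preds n = [node_id a, node_id b] \<and>
         infers R x (clause_of_node a) (clause_of_node b) (clause_of_node n)))"

text \<open>Every node precedes its predecessors in the list.\<close>

primrec linear_derivation :: "inference_rule \<Rightarrow> clause set \<Rightarrow> node list \<Rightarrow> bool" where
  "linear_derivation R F [] \<longleftrightarrow> True"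
| "linear_derivation R F (n # N) \<longleftrightarrow> linear_derivation R F N \<and> node_id n \<notin> node_id ` set N \<and> justified R F (set N) n"

text \<open>\<open>E\<close> and \<open>V\<close> come from the original dag. A derivation placed in
  them inherits regularity from \<open>E\<close> and \<open>V\<close> without further
  argument.\<close>

definition placed :: "(nat \<times> nat) set \<Rightarrow> (nat \<Rightarrow> var option) \<Rightarrow> node list \<Rightarrow> bool" where
  "placed E V N \<longleftrightarrow>
     (\<forall>n \<in> set N. (\<forall>p \<in> set (node_preds n). (p, node_id n) \<in> E) \<and> V (node_id n) = node_var n)"

lemma justified_mono: "justified R F N n \<Longrightarrow> N \<subseteq> M \<Longrightarrow> justified R F M n"
  unfolding justified_def by blast

lemma justified_preds: "justified R F N n \<Longrightarrow> set (node_preds n) \<subseteq> node_id ` N"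
  unfolding justified_def by auto

lemma justified_cases:
  assumes "justified R F N n"
  obtains (initial) "node_var n = None" "node_preds n = []" "clause_of_node n \<in> F"
  | (inference) x a b where "a \<in> N" "b \<in> N" "node_id a \<noteq> node_id b" "node_var n = Some x"
    "node_preds n = [node_id a, node_id b]"
    "infers R x (clause_of_node a) (clause_of_node b) (clause_of_node n)"
  using assms unfolding justified_def by metis

lemma justified_distinct: "justified R F N n \<Longrightarrow> distinct (node_clause n)"
  unfolding justified_def by blast

lemma linear_distinct: "linear_derivation R F N \<Longrightarrow> distinct (map node_id N)"
  by (induction N) auto

lemma linear_justified: "linear_derivation R F N \<Longrightarrow> n \<in> set N \<Longrightarrow> justified R F (set N) n"
  by (induction N) (auto intro: justified_mono)

lemma linear_append: "linear_derivation R F (M @ N) \<Longrightarrow> linear_derivation R F N"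
  by (induction M) auto

lemma linear_unique:
  "linear_derivation R F N \<Longrightarrow> m \<in> set N \<Longrightarrow> n \<in> set N \<Longrightarrow> node_id m = node_id n \<Longrightarrow> m = n"
  using linear_distinct by (auto simp: distinct_map inj_on_def)

lemma find_node_Some: "find_node u N = Some n \<Longrightarrow> n \<in> set N \<and> node_id n = u"
  unfolding find_node_def by (auto dest: find_Some_mem)

lemma find_node_None: "find_node u N = None \<longleftrightarrow> u \<notin> node_id ` set N"
  unfolding find_node_def by (auto simp: find_None_iff)

lemma find_node_linear: "linear_derivation R F N \<Longrightarrow> n \<in> set N \<Longrightarrow> find_node (node_id n) N = Some n"
  by (cases "find_node (node_id n) N") (auto simp: find_node_None dest: find_node_Some intro: linear_unique)

text \<open>Nodes are ranked by their position counted from the end of the list; the rank later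
  yields acyclicity of the graph.\<close>

lemma linear_rank:
  assumes "linear_derivation R F N"
  shows "\<exists>f :: nat \<Rightarrow> nat. \<forall>n \<in> set N. f (node_id n) < length N \<and> (\<forall>p \<in> set (node_preds n). f p < f (node_id n))"
  using assms
proof (induction N)
  case (Cons n N)
  then obtain f where f: "\<forall>n \<in> set N. f (node_id n) < length N \<and> (\<forall>p \<in> set (node_preds n). f p < f (node_id n))"
    by auto
  let ?f = "f(node_id n := length N)"
  have fresh: "node_id n \<notin> node_id ` set N" and just: "justified R F (set N) n"
    using Cons.prems by auto
  have "?f p < ?f (node_id m)" if "m \<in> set (n # N)" "p \<in> set (node_preds m)" for m p
  proof -
    have "p \<in> node_id ` set N"
      using that justified_preds[OF just] justified_preds[OF linear_justified, of R F N m] Cons.prems by auto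
    moreover from this have "p \<noteq> node_id n" using fresh by metis
    moreover have "f p < length N" using \<open>p \<in> node_id ` set N\<close> f by auto
    ultimately have "p \<noteq> node_id n" "f p < length N" by simp_all
    then show ?thesis using f that fresh by (cases "m = n") auto
  qed
  moreover have "?f (node_id m) < length (n # N)" if "m \<in> set (n # N)" for m
    using f that fresh by (auto simp: less_Suc_eq)
  ultimately show ?case by blast
qed simp

lemma infers_commute: "infers R x C D E \<Longrightarrow> infers R x D C E"
  unfolding infers_def by blast

lemma infers_resolution_w: "infers resolution x C D E \<Longrightarrow> infers w_resolution x C D E"
  unfolding infers_def resolution_def by blast

text \<open>\<open>Pos x\<close> and \<open>Neg x\<close> differ, so the literal deleted from one
  copy survives in the other. This guarantees that an inference with a new conclusion has two
  different predecessors.\<close>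

lemma infers_w_same: "infers w_resolution x C C D \<Longrightarrow> D = C"
  unfolding infers_def w_resolution_def by auto

subsection \<open>Regularity\<close>

text \<open>Regularity of a dag expressed by the transitive closure, so that it obviously survives
  the replacement of edges by paths.\<close>

definition regular_rel :: "(nat \<times> nat) set \<Rightarrow> (nat \<Rightarrow> var option) \<Rightarrow> bool" where
  "regular_rel E V \<longleftrightarrow> (\<forall>u w x. (u, w) \<in> E\<^sup>+ \<longrightarrow> V u = Some x \<longrightarrow> V w \<noteq> Some x)"

lemma dag_path_trancl:
  assumes "edges G \<subseteq> nodes G \<times> nodes G" "(u, w) \<in> (edges G)\<^sup>+"
  shows "\<exists>us. dag_path G (us @ [w]) \<and> u \<in> set us"
  using assms(2)
proof (induction rule: trancl_induct)
  case (base w)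
  then have "dag_path G ([u] @ [w])" using assms(1) by (auto simp: dag_path_def)
  then show ?case by (intro exI[of _ "[u]"]) simp
next
  case (step v w)
  then obtain us where "dag_path G (us @ [v])" "u \<in> set us" by blast
  then have "dag_path G ((us @ [v]) @ [w])"
    using step(2) assms(1) by (auto simp: dag_path_def successively_append_iff)
  then show ?case using \<open>u \<in> set us\<close> by (intro exI[of _ "us @ [v]"]) simp
qed

lemma regular_dag_imp_rel:
  assumes "edges G \<subseteq> nodes G \<times> nodes G" "regular_dag G"
  shows "regular_rel (edges G) (var_of G)"
  unfolding regular_rel_def
proof (intro allI impI notI)
  fix u w x
  assume "(u, w) \<in> (edges G)\<^sup>+" and x: "var_of G u = Some x" "var_of G w = Some x"
  then obtain us where us: "dag_path G (us @ [w])" "u \<in> set us"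
    using dag_path_trancl[OF assms(1)] by blast
  have "filter (\<lambda>u. var_of G u = Some x) us \<noteq> []"
    using us(2) x(1) by (auto simp: filter_empty_conv)
  then have "length (filter (\<lambda>u. var_of G u = Some x) (us @ [w])) > 1"
    using x(2) by simp
  then show False
    using assms(2) us(1) unfolding regular_dag_def by (metis not_le)
qed

lemma successively_trancl:
  "successively (\<lambda>u w. (u, w) \<in> E) (u # us) \<Longrightarrow> w \<in> set us \<Longrightarrow> (u, w) \<in> E\<^sup>+"
proof (induction us arbitrary: u)
  case (Cons v us)
  then show ?case by (cases "w = v") (auto intro: trancl_into_trancl2)
qed simp

lemma regular_rel_imp_dag:
  assumes "regular_rel (edges G) (var_of G)"
  shows "regular_dag G"
proof -
  have "length (filter (\<lambda>u. var_of G u = Some x) us) \<le> 1"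
    if "successively (\<lambda>u w. (u, w) \<in> edges G) us" for us x
    using that
  proof (induction us)
    case (Cons u us)
    have IH: "length (filter (\<lambda>u. var_of G u = Some x) us) \<le> 1"
      using Cons by (cases us) auto
    have "filter (\<lambda>u. var_of G u = Some x) us = []" if "var_of G u = Some x"
      using that assms successively_trancl[OF Cons.prems] unfolding regular_rel_def filter_empty_conv by blast
    then show ?case using IH by simp
  qed simp
  then show ?thesis unfolding regular_dag_def dag_path_def by blast
qed

lemma regular_rel_mono: "regular_rel E V \<Longrightarrow> E' \<subseteq> E\<^sup>+ \<Longrightarrow> regular_rel E' V"
  unfolding regular_rel_def using trancl_mono[of _ E' "E\<^sup>+"] by (metis trancl_id trans_trancl)

subsection \<open>Lists of nodes and dags\<close>

definition graph_of :: "node list \<Rightarrow> dag" where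
  "graph_of N = \<lparr>nodes = node_id ` set N,
     edges = {(p, u). \<exists>n \<in> set N. node_id n = u \<and> p \<in> set (node_preds n)},
     clause_of = (\<lambda>u. case find_node u N of None \<Rightarrow> {||} | Some n \<Rightarrow> clause_of_node n),
     var_of = (\<lambda>u. case find_node u N of None \<Rightarrow> None | Some n \<Rightarrow> node_var n)\<rparr>"

lemma graph_of_linear:
  assumes "linear_derivation R F N" "n \<in> set N"
  shows "preds (graph_of N) (node_id n) = set (node_preds n)"
    "clause_of (graph_of N) (node_id n) = clause_of_node n" "var_of (graph_of N) (node_id n) = node_var n"
proof -
  have "m = n" if "m \<in> set N" "node_id m = node_id n" for m
    using linear_unique[OF assms(1) that(1) assms(2) that(2)] .
  then show "preds (graph_of N) (node_id n) = set (node_preds n)"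
    using assms(2) unfolding graph_of_def preds_def by fastforce
qed (simp_all add: graph_of_def find_node_linear[OF assms])

lemma encode_nat_option_enc: "encode_nat_option v = enc v"
  by (cases v) (auto simp: enc_nat_def)

lemma encodes_clause_enc: "encodes_clause v C \<longleftrightarrow> (\<exists>c. distinct c \<and> fset_of_list c = C \<and> v = enc c)"
proof -
  have "encode_list (map encode_literal c) = enc c" for c
    unfolding enc_list_def enc_literal_def ..
  then show ?thesis unfolding encodes_clause_def by simp
qed

definition node_represents :: "dag \<Rightarrow> node \<Rightarrow> bool" where
  "node_represents G n \<longleftrightarrow> distinct (node_clause n) \<and> clause_of_node n = clause_of G (node_id n) \<and>
     node_var n = var_of G (node_id n) \<and> distinct (node_preds n) \<and>
     set (node_preds n) = preds G (node_id n)"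

lemma encodes_node_enc:
  "encodes_node G v u \<longleftrightarrow> (\<exists>n. v = enc n \<and> node_id n = u \<and> node_represents G n)" (is "?l \<longleftrightarrow> ?r")
proof -
  have list: "encode_list (map encode_nat ps) = enc ps" for ps
    unfolding enc_list_def enc_nat_def ..
  have "?l \<longleftrightarrow> (\<exists>c ps. distinct c \<and> fset_of_list c = clause_of G u \<and> distinct ps \<and> set ps = preds G u \<and>
      v = enc (Node u c (var_of G u) ps))" (is "_ \<longleftrightarrow> ?m")
    by (auto simp: encodes_node_def encodes_clause_enc encode_nat_option_enc list enc_nat_def)
  also have "\<dots> \<longleftrightarrow> ?r"
  proof
    assume ?r
    then obtain n where "v = enc n" "node_id n = u" "node_represents G n" by blast
    then show ?m
      by (intro exI[of _ "node_clause n"] exI[of _ "node_preds n"])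
        (cases n, auto simp: node_represents_def)
  next
    assume ?m
    then obtain c ps where "distinct c" "fset_of_list c = clause_of G u" "distinct ps"
      "set ps = preds G u" "v = enc (Node u c (var_of G u) ps)" by blast
    then show ?r
      by (intro exI[of _ "Node u c (var_of G u) ps"]) (simp add: node_represents_def)
  qed
  finally show ?thesis .
qed

definition represents :: "node list \<Rightarrow> dag \<Rightarrow> bool" where
  "represents N G \<longleftrightarrow> distinct (map node_id N) \<and> node_id ` set N = nodes G \<and>
     (\<forall>n \<in> set N. node_represents G n)"

lemma representsD:
  assumes "represents N G" "n \<in> set N"
  shows "distinct (node_clause n)" "clause_of_node n = clause_of G (node_id n)"
    "node_var n = var_of G (node_id n)" "distinct (node_preds n)"
    "set (node_preds n) = preds G (node_id n)" "node_id n \<in> nodes G"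
proof -
  have "node_represents G n" using assms unfolding represents_def by blast
  then show "distinct (node_clause n)" "clause_of_node n = clause_of G (node_id n)"
    "node_var n = var_of G (node_id n)" "distinct (node_preds n)"
    "set (node_preds n) = preds G (node_id n)"
    unfolding node_represents_def by blast+
  show "node_id n \<in> nodes G" using assms unfolding represents_def by blast
qed

text \<open>The bridge from the relational encoding to the functional one: each ordering of nodes,
  literals and predecessors corresponds to one list \<open>N\<close>, and the procedures work on
  these lists.\<close>

lemma encodes_dag_represents:
  "encodes_dag v G \<longleftrightarrow> (\<exists>N. v = enc N \<and> represents N G)"
proof
  assume "encodes_dag v G"
  then obtain us vs where us: "distinct us" "set us = nodes G" "list_all2 (encodes_node G) vs us"
    "v = encode_list vs"
    unfolding encodes_dag_def by blast
  have "\<exists>N. vs = map enc N \<and> map node_id N = us \<and> (\<forall>n \<in> set N. node_represents G n)"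
    using us(3)
  proof (induction rule: list_all2_induct)
    case (Cons w ws u us)
    then obtain N where N: "ws = map enc N \<and> map node_id N = us \<and> (\<forall>n \<in> set N. node_represents G n)"
      by blast
    obtain n where "w = enc n" "node_id n = u" "node_represents G n"
      using Cons(1) unfolding encodes_node_enc by blast
    then show ?case using N by (intro exI[of _ "n # N"]) simp
  qed simp
  then obtain N where N: "vs = map enc N" "map node_id N = us" "\<forall>n \<in> set N. node_represents G n"
    by blast
  have "v = enc N" using us(4) N(1) by (simp add: enc_list_def)
  moreover have "represents N G"
    unfolding represents_def using N(3) us(1,2) by (simp flip: N(2))
  ultimately show "\<exists>N. v = enc N \<and> represents N G" by blast
next
  assume "\<exists>N. v = enc N \<and> represents N G"
  then obtain N where N: "v = enc N" "represents N G" by blast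
  then have "list_all2 (encodes_node G) (map enc N) (map node_id N)"
    unfolding represents_def by (auto simp: list_all2_conv_all_nth encodes_node_enc)
  then show "encodes_dag v G"
    unfolding encodes_dag_def
    by (intro exI[of _ "map node_id N"] exI[of _ "map enc N"])
      (use N in \<open>auto simp: represents_def enc_list_def\<close>)
qed

lemma represents_graph_of:
  assumes "linear_derivation R F N"
  shows "represents N (graph_of N)"
  unfolding represents_def
proof (intro conjI ballI)
  fix n assume n: "n \<in> set N"
  note just = linear_justified[OF assms n]
  from just have "distinct (node_preds n)" by (cases rule: justified_cases) auto
  then show "node_represents (graph_of N) n"
    using graph_of_linear[OF assms n] justified_distinct[OF just] by (simp add: node_represents_def)
qed (use linear_distinct[OF assms] in \<open>simp_all add: graph_of_def\<close>)

text \<open>\<open>sink\<close> and \<open>reach\<close> make \<open>r\<close> the only node without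
  successors; \<open>linear_rank\<close> gives acyclicity.\<close>

lemma graph_of_derivation:
  assumes "linear_derivation R F N" and r: "r \<in> set N" "node_clause r = []"
    and sink: "\<And>n. n \<in> set N \<Longrightarrow> node_id r \<notin> set (node_preds n)"
    and reach: "\<And>n. n \<in> set N \<Longrightarrow> n \<noteq> r \<Longrightarrow> \<exists>m \<in> set N. node_id n \<in> set (node_preds m)"
  shows "dag_derivation R F (graph_of N) {||}"
  unfolding dag_derivation_def
proof (intro conjI)
  let ?G = "graph_of N"
  have preds: "set (node_preds n) \<subseteq> node_id ` set N" if "n \<in> set N" for n
    using justified_preds[OF linear_justified[OF assms(1) that]] .
  show "finite (nodes ?G)" by (simp add: graph_of_def)
  show "edges ?G \<subseteq> nodes ?G \<times> nodes ?G" by (auto simp: graph_of_def dest: subsetD[OF preds])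
  obtain f :: "nat \<Rightarrow> nat" where "\<forall>n \<in> set N. \<forall>p \<in> set (node_preds n). f p < f (node_id n)"
    using linear_rank[OF assms(1)] by blast
  then have "edges ?G \<subseteq> measure f" by (auto simp: graph_of_def)
  then show "acyclic (edges ?G)" by (rule acyclic_subset[OF wf_acyclic[OF wf_measure]])
  have "{u \<in> nodes ?G. succs ?G u = {}} = {node_id r}"
  proof (intro equalityI subsetI)
    fix u assume "u \<in> {u \<in> nodes ?G. succs ?G u = {}}"
    then obtain n where n: "n \<in> set N" "u = node_id n" "succs ?G u = {}"
      by (auto simp: graph_of_def)
    then have "n = r" using reach[OF n(1)] by (auto simp: succs_def graph_of_def)
    then show "u \<in> {node_id r}" using n(2) by simp
  next
    fix u assume "u \<in> {node_id r}"
    then show "u \<in> {u \<in> nodes ?G. succs ?G u = {}}"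
      using r(1) sink by (auto simp: succs_def graph_of_def)
  qed
  then show "\<exists>s. {u \<in> nodes ?G. succs ?G u = {}} = {s} \<and> clause_of ?G s = {||}"
    using graph_of_linear(2)[OF assms(1) r(1)] r(2) by (intro exI[of _ "node_id r"]) simp
  show "\<forall>u \<in> nodes ?G. (preds ?G u = {} \<and> var_of ?G u = None \<and> clause_of ?G u \<in> F) \<or>
    (\<exists>p q x. p \<noteq> q \<and> preds ?G u = {p, q} \<and> var_of ?G u = Some x \<and>
       infers R x (clause_of ?G p) (clause_of ?G q) (clause_of ?G u))"
  proof
    fix u assume "u \<in> nodes ?G"
    then obtain n where n: "n \<in> set N" "u = node_id n" by (auto simp: graph_of_def)
    show "(preds ?G u = {} \<and> var_of ?G u = None \<and> clause_of ?G u \<in> F) \<or>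
      (\<exists>p q x. p \<noteq> q \<and> preds ?G u = {p, q} \<and> var_of ?G u = Some x \<and>
         infers R x (clause_of ?G p) (clause_of ?G q) (clause_of ?G u))"
      using linear_justified[OF assms(1) n(1)]
    proof (cases rule: justified_cases)
      case initial
      then show ?thesis using graph_of_linear[OF assms(1) n(1)] n(2) by simp
    next
      case (inference x a b)
      then show ?thesis
        using graph_of_linear[OF assms(1) n(1)] graph_of_linear[OF assms(1) inference(1)]
          graph_of_linear[OF assms(1) inference(2)] n(2)
        by (intro disjI2 exI[of _ "node_id a"] exI[of _ "node_id b"] exI[of _ x]) simp
    qed
  qed
qed

lemma graph_of_regular:
  assumes "linear_derivation R F N" "placed E V N" "regular_rel E V"
  shows "regular_dag (graph_of N)"
proof (rule regular_rel_imp_dag)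
  let ?G = "graph_of N"
  have edges: "edges ?G \<subseteq> E"
    using assms(2) by (auto simp: graph_of_def placed_def)
  have var: "V u = Some x" if x: "var_of ?G u = Some x" for u x
  proof (cases "find_node u N")
    case None
    then show ?thesis using x by (simp add: graph_of_def)
  next
    case (Some n)
    then have "n \<in> set N" "node_id n = u" using find_node_Some by blast+
    then show ?thesis using x Some assms(2) by (auto simp: graph_of_def placed_def)
  qed
  show "regular_rel (edges ?G) (var_of ?G)"
    unfolding regular_rel_def
  proof (intro allI impI notI)
    fix u w x
    assume "(u, w) \<in> (edges ?G)\<^sup>+" and "var_of ?G u = Some x" "var_of ?G w = Some x"
    moreover from this have "(u, w) \<in> E\<^sup>+" using trancl_mono edges by blast
    ultimately show False
      using assms(3) var unfolding regular_rel_def by blast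
  qed
qed

subsection \<open>Correctness of topological sorting\<close>

lemma topo_step_mono: "set A \<subseteq> set (topo_step n A)"
  unfolding topo_step_def by auto

lemma fold_topo_step_mono: "set A \<subseteq> set (fold topo_step M A)"
proof (induction M arbitrary: A)
  case (Cons n M)
  show ?case using topo_step_mono[of A n] Cons.IH[of "topo_step n A"] by auto
qed simp

lemma dag_derivation_node:
  assumes "dag_derivation R F G C" "u \<in> nodes G"
  obtains (initial) "preds G u = {}" "var_of G u = None" "clause_of G u \<in> F"
  | (inference) p q x where "p \<noteq> q" "preds G u = {p, q}" "var_of G u = Some x"
    "infers R x (clause_of G p) (clause_of G q) (clause_of G u)"
proof -
  have "(preds G u = {} \<and> var_of G u = None \<and> clause_of G u \<in> F) \<or>
      (\<exists>p q x. p \<noteq> q \<and> preds G u = {p, q} \<and> var_of G u = Some x \<and>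
         infers R x (clause_of G p) (clause_of G q) (clause_of G u))"
    using assms(1) unfolding dag_derivation_def by (elim conjE) (erule bspec[OF _ assms(2)])
  then show thesis
  proof (elim disjE conjE exE)
    assume "preds G u = {}" "var_of G u = None" "clause_of G u \<in> F"
    then show thesis by (rule initial)
  next
    fix p q x
    assume "p \<noteq> q" "preds G u = {p, q}" "var_of G u = Some x"
      "infers R x (clause_of G p) (clause_of G q) (clause_of G u)"
    then show thesis by (rule inference)
  qed
qed

lemma distinct_doubleton:
  assumes "distinct xs" "set xs = {p, q}" "p \<noteq> q"
  shows "xs = [p, q] \<or> xs = [q, p]"
proof -
  have "length xs = 2"
    using distinct_card[OF assms(1)] assms(2,3) by simp
  then obtain a b where "xs = [a, b]"
    by (metis One_nat_def Suc_1 length_0_conv length_Suc_conv)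
  then show ?thesis using assms(2) by (auto simp: doubleton_eq_iff)
qed

lemma topo_step_justified:
  assumes "represents N G" "dag_derivation R F G C" "n \<in> set N"
    and "set A \<subseteq> set N" "set (node_preds n) \<subseteq> node_id ` set A"
  shows "justified R F (set A) n"
proof -
  let ?u = "node_id n"
  note n = representsD[OF assms(1,3)]
  have clause: "clause_of_node a = clause_of G (node_id a)" if "a \<in> set A" for a
    using representsD(2)[OF assms(1)] assms(4) that by blast
  from assms(2) n(6) show ?thesis
  proof (cases rule: dag_derivation_node)
    case initial
    then show ?thesis using n(1-5) unfolding justified_def by simp
  next
    case (inference p q x)
    obtain a b where ab: "a \<in> set A" "node_id a = p" "b \<in> set A" "node_id b = q"
      using assms(5) unfolding n(5) inference(2) by blast
    note infers = inference(4)[folded ab(2,4), folded clause[OF ab(1)] clause[OF ab(3)] n(2)]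
    \<comment> \<open>The encoding may list the two predecessors in either order;
      \<open>infers\<close> is symmetric in them.\<close>
    have "node_preds n = [p, q] \<or> node_preds n = [q, p]"
      by (rule distinct_doubleton) (use n inference in simp_all)
    then show ?thesis
    proof
      assume "node_preds n = [p, q]"
      then show ?thesis
        unfolding justified_def using n(1,3) inference(1,3) ab infers
        by (intro conjI disjI2 exI[of _ x] bexI[of _ a] bexI[of _ b]) simp_all
    next
      assume "node_preds n = [q, p]"
      then show ?thesis
        unfolding justified_def using n(1,3) inference(1,3) ab infers_commute[OF infers]
        by (intro conjI disjI2 exI[of _ x] bexI[of _ a] bexI[of _ b]) simp_all
    qed
  qed
qed

lemma topo_step_linear:
  assumes "represents N G" "dag_derivation R F G C" "n \<in> set N"
    and "linear_derivation R F A" "set A \<subseteq> set N"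
  shows "linear_derivation R F (topo_step n A) \<and> set (topo_step n A) \<subseteq> set N"
proof (cases "find_node (node_id n) A = None \<and> list_all (\<lambda>p. find_node p A \<noteq> None) (node_preds n)")
  case True
  then have "set (node_preds n) \<subseteq> node_id ` set A" "node_id n \<notin> node_id ` set A"
    by (auto simp: list_all_iff find_node_None)
  then show ?thesis
    using topo_step_justified[OF assms(1-3,5)] assms(3-5) True by (simp add: topo_step_def)
qed (use assms in \<open>auto simp: topo_step_def\<close>)

lemma fold_topo_step_linear:
  assumes "represents N G" "dag_derivation R F G C" "set M \<subseteq> set N" "linear_derivation R F A" "set A \<subseteq> set N"
  shows "linear_derivation R F (fold topo_step M A) \<and> set (fold topo_step M A) \<subseteq> set N"
  using assms(3-5)
proof (induction M arbitrary: A)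
  case (Cons n M)
  then show ?case using topo_step_linear[OF assms(1,2), of n A] by simp
qed simp

text \<open>Passes only add nodes, so the predecessors are still present when the pass comes to
  \<open>n\<close>. If the name of \<open>n\<close> is already taken, the node bearing it is
  \<open>n\<close> itself.\<close>

lemma topo_round_progress:
  assumes "represents N G" "dag_derivation R F G C" "n \<in> set N"
    and "linear_derivation R F A" "set A \<subseteq> set N" "set (node_preds n) \<subseteq> node_id ` set A"
  shows "n \<in> set (fold topo_step N A)"
proof -
  obtain M M' where N: "N = M @ n # M'" using assms(3) by (meson split_list)
  let ?A = "fold topo_step M A"
  have A: "set ?A \<subseteq> set N" "set A \<subseteq> set ?A"
    using fold_topo_step_linear[OF assms(1,2) _ assms(4,5), of M] fold_topo_step_mono N by auto
  have "n \<in> set (topo_step n ?A)"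
  proof (cases "find_node (node_id n) ?A")
    case None
    have "list_all (\<lambda>p. find_node p ?A \<noteq> None) (node_preds n)"
      using assms(6) A(2) by (auto simp: list_all_iff find_node_None)
    then show ?thesis using None by (simp add: topo_step_def)
  next
    case (Some m)
    have "inj_on node_id (set N)"
      using assms(1) by (simp add: represents_def distinct_map)
    then have "m = n"
      by (rule inj_onD) (use find_node_Some[OF Some] A(1) assms(3) in auto)
    then show ?thesis using find_node_Some[OF Some] topo_step_mono by blast
  qed
  then show ?thesis using fold_topo_step_mono[of "topo_step n ?A" M'] unfolding N by auto
qed

text \<open>While nodes are missing, every pass strictly enlarges the list: a missing node that is
  minimal with respect to the edges has all its predecessors present. Hence \<open>k\<close> passes
  yield either everything or at least \<open>k\<close> nodes.\<close>

lemma topo_sort_correct: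
  assumes "represents N G" "dag_derivation R F G C"
  shows "linear_derivation R F (topo_sort N) \<and> set (topo_sort N) = set N"
proof -
  let ?A = "\<lambda>k. ((\<lambda>A. fold topo_step N A) ^^ k) []"
  have inv: "linear_derivation R F (?A k) \<and> set (?A k) \<subseteq> set N" for k
    by (induction k) (use fold_topo_step_linear[OF assms subset_refl] in auto)
  have wf: "wf (edges G)"
  proof (rule finite_acyclic_wf)
    show "finite (edges G)"
      using assms(2) finite_subset[of "edges G" "nodes G \<times> nodes G"]
      unfolding dag_derivation_def by blast
  qed (use assms(2) in \<open>simp add: dag_derivation_def\<close>)
  have progress: "card (set (?A k)) < card (set (?A (Suc k)))" if "set (?A k) \<noteq> set N" for k
  proof -
    let ?Q = "node_id ` (set N - set (?A k))"
    have "?Q \<noteq> {}" using that inv[of k] by auto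
    then obtain u where u: "u \<in> ?Q" "\<And>p. (p, u) \<in> edges G \<Longrightarrow> p \<notin> ?Q"
      using wfE_min'[OF wf, of ?Q] by auto
    then obtain n where n: "n \<in> set N" "n \<notin> set (?A k)" "u = node_id n" by auto
    have "set (node_preds n) \<subseteq> node_id ` set (?A k)"
    proof
      fix p assume "p \<in> set (node_preds n)"
      then have p: "(p, u) \<in> edges G"
        using representsD(5)[OF assms(1) n(1)] n(3) by (auto simp: preds_def)
      then have "p \<in> node_id ` set N"
        using assms unfolding represents_def dag_derivation_def by auto
      then show "p \<in> node_id ` set (?A k)" using u(2)[OF p] by auto
    qed
    then have "n \<in> set (?A (Suc k))"
      using topo_round_progress[OF assms n(1)] inv[of k] by simp
    then have "set (?A k) \<subset> set (?A (Suc k))"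
      using n(2) fold_topo_step_mono[of "?A k" N] by auto
    then show ?thesis by (rule psubset_card_mono[rotated]) simp
  qed
  have "set (?A k) = set N \<or> k \<le> card (set (?A k))" for k
  proof (induction k)
    case (Suc k)
    show ?case
    proof (cases "set (?A k) = set N")
      case True
      then show ?thesis using inv[of "Suc k"] fold_topo_step_mono[of "?A k" N] by auto
    next
      case False
      then show ?thesis using Suc progress[of k] by auto
    qed
  qed simp
  moreover have "set (?A (length N)) = set N" if "length N \<le> card (set (?A (length N)))"
  proof (rule card_subset_eq)
    show "card (set (?A (length N))) = card (set N)"
      using that card_mono[of "set N" "set (?A (length N))"] inv[of "length N"] card_length[of N]
      by simp
  qed (use inv in auto)
  moreover have "topo_sort N = ?A (length N)"
  proof -
    have "fold (\<lambda>_ A. f A) xs A = (f ^^ length xs) A" for f :: "node list \<Rightarrow> node list" and xs :: "node list" and A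
      by (induction xs arbitrary: A) (auto simp: funpow_swap1)
    then show ?thesis unfolding topo_sort_def by simp
  qed
  ultimately show ?thesis using inv[of "length N"] by auto
qed

subsection \<open>Correctness of eliminating w-resolution\<close>

lemma fset_of_list_eq_iff: "fset_of_list c = fset_of_list d \<longleftrightarrow> set c = set d"
  by (simp add: fset_eq_iff fset_of_list_elem set_eq_iff)

lemma w_resolution_fset_of_list:
  "w_resolution x (fset_of_list c) (fset_of_list d) (fset_of_list e) \<longleftrightarrow>
     set e = (set c - {Pos x}) \<union> (set d - {Neg x})"
proof -
  have res: "(fset_of_list c |-| {|Pos x|}) |\<union>| (fset_of_list d |-| {|Neg x|}) =
      fset_of_list (filter (\<lambda>l. l \<noteq> Pos x) c @ filter (\<lambda>l. l \<noteq> Neg x) d)"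
    by (rule fset_eqI) (auto simp: fset_of_list_elem)
  have set: "set (filter (\<lambda>l. l \<noteq> Pos x) c @ filter (\<lambda>l. l \<noteq> Neg x) d) =
      (set c - {Pos x}) \<union> (set d - {Neg x})" by auto
  show ?thesis unfolding w_resolution_def res fset_of_list_eq_iff set ..
qed

lemma infers_w_resolution_iff:
  "infers w_resolution x (fset_of_list c) (fset_of_list d) (fset_of_list e) \<longleftrightarrow>
     set e = (set c - {Pos x}) \<union> (set d - {Neg x}) \<or> set e = (set d - {Pos x}) \<union> (set c - {Neg x})"
  unfolding infers_def w_resolution_fset_of_list ..

lemma infers_resolutionI:
  assumes "Pos x \<in> set c" "Neg x \<in> set d" "set e = (set c - {Pos x}) \<union> (set d - {Neg x})"
  shows "infers resolution x (fset_of_list c) (fset_of_list d) (fset_of_list e)"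
  using assms unfolding infers_def resolution_def w_resolution_fset_of_list
  by (simp add: fset_of_list_elem)

text \<open>If \<open>c\<close> without one literal lies in \<open>e\<close> but \<open>c\<close>
  does not, then \<open>c\<close> contains that literal; so both resolved literals are really
  present. Since \<open>infers\<close> leaves open which premise is resolved positively, the test in
  \<open>w_resolvent\<close> has to find a possible orientation.\<close>

lemma w_resolvent_correct:
  assumes "\<not> set c \<subseteq> set e" "\<not> set d \<subseteq> set e" "set c \<subseteq> set c'" "set d \<subseteq> set d'"
    and "infers w_resolution x (fset_of_list c') (fset_of_list d') (fset_of_list e)"
  shows "set (w_resolvent x c d e) \<subseteq> set e"
    and "infers resolution x (fset_of_list c) (fset_of_list d) (fset_of_list (w_resolvent x c d e))"
proof -
  show "set (w_resolvent x c d e) \<subseteq> set e"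
  proof -
    have "set (if b then filter P e else filter Q e) \<subseteq> set e" for b P Q by auto
    then show ?thesis unfolding w_resolvent_def Let_def .
  qed
  let ?test = "(\<forall>l \<in> set c. l = Pos x \<or> l \<in> set e) \<and> (\<forall>l \<in> set d. l = Neg x \<or> l \<in> set e)"
  show "infers resolution x (fset_of_list c) (fset_of_list d) (fset_of_list (w_resolvent x c d e))"
  proof (cases ?test)
    case True
    have sub: "set c - {Pos x} \<subseteq> set e" "set d - {Neg x} \<subseteq> set e"
      using True by auto
    then have "Pos x \<in> set c" "Neg x \<in> set d" using assms(1,2) by auto
    then show ?thesis
    proof (rule infers_resolutionI)
      have "w_resolvent x c d e = filter (\<lambda>l. (l \<in> set c \<and> l \<noteq> Pos x) \<or> (l \<in> set d \<and> l \<noteq> Neg x)) e"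
        unfolding w_resolvent_def Let_def list_all_iff by (rule if_P[OF True])
      then show "set (w_resolvent x c d e) = (set c - {Pos x}) \<union> (set d - {Neg x})"
        using sub by (simp only: set_filter) blast
    qed
  next
    case False
    \<comment> \<open>In this orientation the subclauses \<open>c\<close> and \<open>d\<close> would
      pass the test, so the original inference was made in the other one.\<close>
    have "\<not> set e = (set c' - {Pos x}) \<union> (set d' - {Neg x})"
    proof
      assume e: "set e = (set c' - {Pos x}) \<union> (set d' - {Neg x})"
      have "set c - {Pos x} \<subseteq> set e" "set d - {Neg x} \<subseteq> set e"
        unfolding e using assms(3,4) by auto
      then show False using False by blast
    qed
    then have e: "set e = (set d' - {Pos x}) \<union> (set c' - {Neg x})"
      using assms(5) unfolding infers_w_resolution_iff by blast
    have sub: "set d - {Pos x} \<subseteq> set e" "set c - {Neg x} \<subseteq> set e"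
      unfolding e using assms(3,4) by auto
    then have "Pos x \<in> set d" "Neg x \<in> set c" using assms(1,2) by auto
    then have "infers resolution x (fset_of_list d) (fset_of_list c) (fset_of_list (w_resolvent x c d e))"
    proof (rule infers_resolutionI)
      have "w_resolvent x c d e = filter (\<lambda>l. (l \<in> set d \<and> l \<noteq> Pos x) \<or> (l \<in> set c \<and> l \<noteq> Neg x)) e"
        unfolding w_resolvent_def Let_def list_all_iff by (rule if_not_P[OF False])
      then show "set (w_resolvent x c d e) = (set d - {Pos x}) \<union> (set c - {Neg x})"
        using sub by (simp only: set_filter) blast
    qed
    then show ?thesis by (rule infers_commute)
  qed
qed

text \<open>Every node \<open>n\<close> of the original derivation is represented by a node \<open>a\<close> of the new one with
  a subclause of its clause; in the entry \<open>(n, a, c)\<close> the list \<open>c\<close> is that subclause.\<close>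

definition rep_invariant ::
    "clause set \<Rightarrow> (nat \<times> nat) set \<Rightarrow> (nat \<Rightarrow> var option) \<Rightarrow> node list \<Rightarrow>
      (nat \<times> nat \<times> literal list) list \<times> node list \<Rightarrow> bool" where
  "rep_invariant F E V N s \<longleftrightarrow>
     linear_derivation resolution F (snd s) \<and> placed (E\<^sup>+) V (snd s) \<and> length (snd s) \<le> length N \<and>
     node_id ` set (snd s) \<subseteq> node_id ` set N \<and> fst ` set (fst s) = node_id ` set N \<and>
     (\<forall>e \<in> set (fst s). \<exists>n \<in> set N. \<exists>a \<in> set (snd s).
        fst e = node_id n \<and> fst (snd e) = node_id a \<and> (node_id a, node_id n) \<in> E\<^sup>* \<and>
        set (snd (snd e)) = set (node_clause a) \<and> set (node_clause a) \<subseteq> set (node_clause n))"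

lemma rep_invariant_entry:
  assumes "rep_invariant F E V N s" "linear_derivation w_resolution F N" "n \<in> set N"
  obtains e a where "List.find (\<lambda>e. fst e = node_id n) (fst s) = Some e" "a \<in> set (snd s)"
    "fst (snd e) = node_id a" "(node_id a, node_id n) \<in> E\<^sup>*"
    "set (snd (snd e)) = set (node_clause a)" "set (node_clause a) \<subseteq> set (node_clause n)"
proof -
  have "node_id n \<in> fst ` set (fst s)"
    using assms(1,3) unfolding rep_invariant_def by blast
  then obtain e where e: "List.find (\<lambda>e. fst e = node_id n) (fst s) = Some e"
    by (cases "List.find (\<lambda>e. fst e = node_id n) (fst s)") (auto simp: find_None_iff)
  then have "e \<in> set (fst s)" and id: "fst e = node_id n" using find_Some_mem[OF e] by auto
  then obtain m a where m: "m \<in> set N" "fst e = node_id m" and a: "a \<in> set (snd s)"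
    "fst (snd e) = node_id a" "(node_id a, node_id m) \<in> E\<^sup>*"
    "set (snd (snd e)) = set (node_clause a)" "set (node_clause a) \<subseteq> set (node_clause m)"
    using assms(1) unfolding rep_invariant_def by blast
  have "m = n" using linear_unique[OF assms(2) m(1) assms(3)] m(2) id by simp
  then show thesis using that e a by blast
qed

lemma rep_invariant_keep:
  assumes "rep_invariant F E V N s" "a \<in> set (snd s)" "u = node_id a" "(node_id a, node_id n) \<in> E\<^sup>*"
    and "set c = set (node_clause a)" "set (node_clause a) \<subseteq> set (node_clause n)"
  shows "rep_invariant F E V (n # N) ((node_id n, u, c) # fst s, snd s)"
proof -
  have "\<exists>n' \<in> set (n # N). \<exists>a \<in> set (snd s).
      fst e = node_id n' \<and> fst (snd e) = node_id a \<and> (node_id a, node_id n') \<in> E\<^sup>* \<and>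
      set (snd (snd e)) = set (node_clause a) \<and> set (node_clause a) \<subseteq> set (node_clause n')"
    if "e \<in> set ((node_id n, u, c) # fst s)" for e
  proof (cases "e = (node_id n, u, c)")
    case True
    then show ?thesis using assms(2-6) by (intro bexI[of _ n] bexI[of _ a]) simp_all
  next
    case False
    then have "e \<in> set (fst s)" using that by simp
    then obtain n' a where "n' \<in> set N" "a \<in> set (snd s)"
      "fst e = node_id n' \<and> fst (snd e) = node_id a \<and> (node_id a, node_id n') \<in> E\<^sup>* \<and>
       set (snd (snd e)) = set (node_clause a) \<and> set (node_clause a) \<subseteq> set (node_clause n')"
      using assms(1) unfolding rep_invariant_def by blast
    then show ?thesis by (intro bexI[of _ n'] bexI[of _ a]) simp_all
  qed
  moreover have "fst ` set ((node_id n, u, c) # fst s) = node_id ` set (n # N)"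
    using assms(1) by (simp add: rep_invariant_def)
  moreover have "node_id ` set (snd s) \<subseteq> node_id ` set (n # N)" "length (snd s) \<le> length (n # N)"
    using assms(1) by (auto simp: rep_invariant_def)
  moreover have "linear_derivation resolution F (snd s)" "placed (E\<^sup>+) V (snd s)"
    using assms(1) by (simp_all add: rep_invariant_def)
  ultimately show ?thesis
    unfolding rep_invariant_def fst_conv snd_conv by blast
qed

lemma rep_invariant_add:
  assumes "rep_invariant F E V N s" "node_id n \<notin> node_id ` set N"
    and "node_id a = node_id n" "node_clause a = c" "set c \<subseteq> set (node_clause n)"
    and "justified resolution F (set (snd s)) a" "placed (E\<^sup>+) V [a]"
  shows "rep_invariant F E V (n # N) ((node_id n, node_id n, c) # fst s, a # snd s)"
proof -
  have "\<exists>n' \<in> set (n # N). \<exists>a \<in> set (a # snd s).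
      fst e = node_id n' \<and> fst (snd e) = node_id a \<and> (node_id a, node_id n') \<in> E\<^sup>* \<and>
      set (snd (snd e)) = set (node_clause a) \<and> set (node_clause a) \<subseteq> set (node_clause n')"
    if "e \<in> set ((node_id n, node_id n, c) # fst s)" for e
  proof (cases "e = (node_id n, node_id n, c)")
    case True
    then show ?thesis using assms(3-5) by (intro bexI[of _ n] bexI[of _ a]) simp_all
  next
    case False
    then have "e \<in> set (fst s)" using that by simp
    then obtain n' a where "n' \<in> set N" "a \<in> set (snd s)"
      "fst e = node_id n' \<and> fst (snd e) = node_id a \<and> (node_id a, node_id n') \<in> E\<^sup>* \<and>
       set (snd (snd e)) = set (node_clause a) \<and> set (node_clause a) \<subseteq> set (node_clause n')"
      using assms(1) unfolding rep_invariant_def by blast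
    then show ?thesis by (intro bexI[of _ n'] bexI[of _ a]) simp_all
  qed
  moreover have "fst ` set ((node_id n, node_id n, c) # fst s) = node_id ` set (n # N)"
    using assms(1) by (simp add: rep_invariant_def)
  moreover have ids: "node_id ` set (snd s) \<subseteq> node_id ` set N" "length (snd s) \<le> length N"
    using assms(1) by (simp_all add: rep_invariant_def)
  moreover have "node_id ` set (a # snd s) \<subseteq> node_id ` set (n # N)"
    "length (a # snd s) \<le> length (n # N)"
    using ids assms(3) by auto
  moreover have "linear_derivation resolution F (a # snd s)"
  proof -
    have "node_id a \<notin> node_id ` set (snd s)" using ids(1) assms(2,3) by (metis subsetD)
    then show ?thesis using assms(1,6) by (simp add: rep_invariant_def)
  qed
  moreover have "placed (E\<^sup>+) V (a # snd s)"
    using assms(1,7) by (simp add: rep_invariant_def placed_def)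
  ultimately show ?thesis
    unfolding rep_invariant_def fst_conv snd_conv by blast
qed

lemma rep_step_correct:
  assumes inv: "rep_invariant F E V N s" and lin: "linear_derivation w_resolution F (n # N)"
    and placed: "placed E V (n # N)"
  shows "rep_invariant F E V (n # N) (rep_step n s)"
proof -
  have fresh: "node_id n \<notin> node_id ` set N" and linN: "linear_derivation w_resolution F N"
    and just: "justified w_resolution F (set N) n" using lin by auto
  have V: "V (node_id n) = node_var n" and E: "\<forall>p \<in> set (node_preds n). (p, node_id n) \<in> E"
    using placed by (auto simp: placed_def)
  have dist: "distinct (node_clause n)" using just by (rule justified_distinct)
  show ?thesis using just
  proof (cases rule: justified_cases)
    case initial
    have "rep_invariant F E V (n # N) ((node_id n, node_id n, node_clause n) # fst s,
        Node (node_id n) (node_clause n) None [] # snd s)"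
      by (rule rep_invariant_add[OF inv fresh])
        (use initial V dist in \<open>auto simp: justified_def placed_def\<close>)
    then show ?thesis using initial by (simp add: rep_step_def)
  next
    case (inference x n1 n2)
    obtain e1 a1 where 1: "List.find (\<lambda>e. fst e = node_id n1) (fst s) = Some e1" "a1 \<in> set (snd s)"
      "fst (snd e1) = node_id a1" "(node_id a1, node_id n1) \<in> E\<^sup>*"
      "set (snd (snd e1)) = set (node_clause a1)" "set (node_clause a1) \<subseteq> set (node_clause n1)"
      using rep_invariant_entry[OF inv linN inference(1)] by blast
    obtain e2 a2 where 2: "List.find (\<lambda>e. fst e = node_id n2) (fst s) = Some e2" "a2 \<in> set (snd s)"
      "fst (snd e2) = node_id a2" "(node_id a2, node_id n2) \<in> E\<^sup>*"
      "set (snd (snd e2)) = set (node_clause a2)" "set (node_clause a2) \<subseteq> set (node_clause n2)"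
      using rep_invariant_entry[OF inv linN inference(2)] by blast
    let ?e = "w_resolvent x (snd (snd e1)) (snd (snd e2)) (node_clause n)"
    have edge: "(node_id n1, node_id n) \<in> E" "(node_id n2, node_id n) \<in> E"
      using E inference(5) by auto
    have E1: "(node_id a1, node_id n) \<in> E\<^sup>+" using 1(4) edge(1) by (rule rtrancl_into_trancl1)
    have E2: "(node_id a2, node_id n) \<in> E\<^sup>+" using 2(4) edge(2) by (rule rtrancl_into_trancl1)
    consider (keep1) "set (node_clause a1) \<subseteq> set (node_clause n)"
      | (keep2) "\<not> set (node_clause a1) \<subseteq> set (node_clause n)" "set (node_clause a2) \<subseteq> set (node_clause n)"
      | (add) "\<not> set (node_clause a1) \<subseteq> set (node_clause n)" "\<not> set (node_clause a2) \<subseteq> set (node_clause n)"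
      by blast
    then show ?thesis
    proof cases
      case keep1
      have "rep_step n s = ((node_id n, snd e1) # fst s, snd s)"
        using keep1 inference 1 2 by (simp add: rep_step_def)
      then show ?thesis
        using rep_invariant_keep[OF inv 1(2,3) trancl_into_rtrancl[OF E1] 1(5) keep1] by simp
    next
      case keep2
      have "rep_step n s = ((node_id n, snd e2) # fst s, snd s)"
        using keep2 inference 1 2 by (simp add: rep_step_def)
      then show ?thesis
        using rep_invariant_keep[OF inv 2(2,3) trancl_into_rtrancl[OF E2] 2(5) keep2(2)] by simp
    next
      case add
      have step: "rep_step n s = ((node_id n, node_id n, ?e) # fst s,
          Node (node_id n) ?e (Some x) [node_id a1, node_id a2] # snd s)"
        using add inference 1 2 by (simp add: rep_step_def)
      have res: "set ?e \<subseteq> set (node_clause n)"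
        "infers resolution x (fset_of_list (snd (snd e1))) (fset_of_list (snd (snd e2))) (fset_of_list ?e)"
        by (rule w_resolvent_correct[OF _ _ _ _ inference(6)]; use add 1 2 in simp)+
      have clauses: "fset_of_list (snd (snd e1)) = clause_of_node a1"
        "fset_of_list (snd (snd e2)) = clause_of_node a2"
        unfolding fset_of_list_eq_iff by (fact 1(5), fact 2(5))
      \<comment> \<open>A common representative would be its own resolvent and hence be contained in
        the clause of \<open>n\<close>, which case \<open>add\<close> excludes.\<close>
      have "node_id a1 \<noteq> node_id a2"
      proof
        assume "node_id a1 = node_id a2"
        moreover have "linear_derivation resolution F (snd s)"
          using inv unfolding rep_invariant_def by blast
        ultimately have "a1 = a2" using linear_unique 1(2) 2(2) by blast
        then have "fset_of_list ?e = clause_of_node a1"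
          using infers_w_same[OF infers_resolution_w[OF res(2)[unfolded clauses, folded \<open>a1 = a2\<close>]]]
          by (simp only:)
        then have "set ?e = set (node_clause a1)" unfolding fset_of_list_eq_iff .
        then show False using res(1) add(1) by (simp only:)
      qed
      moreover have "distinct ?e" using dist by (simp add: w_resolvent_def Let_def)
      ultimately have "justified resolution F (set (snd s)) (Node (node_id n) ?e (Some x) [node_id a1, node_id a2])"
        unfolding justified_def using 1(2) 2(2) res(2) clauses
        by (intro conjI disjI2 exI[of _ x] bexI[of _ a1] bexI[of _ a2]) simp_all
      then show ?thesis unfolding step
        by (intro rep_invariant_add[OF inv fresh])
          (use E1 E2 V inference(4) res(1) in \<open>simp_all add: placed_def\<close>)
    qed
  qed
qed

lemma strict_resolution_correct:
  assumes "linear_derivation w_resolution F N" "placed E V N" "n \<in> set N" "node_clause n = []"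
  shows "linear_derivation resolution F (strict_resolution N)" "placed (E\<^sup>+) V (strict_resolution N)"
    "length (strict_resolution N) \<le> length N"
    "\<exists>r \<in> set (strict_resolution N). node_clause r = []"
proof -
  let ?s = "foldr rep_step N ([], [])"
  have inv: "rep_invariant F E V N ?s"
    using assms(1,2)
  proof (induction N)
    case Nil
    then show ?case by (simp add: rep_invariant_def placed_def)
  next
    case (Cons m N)
    then have "rep_invariant F E V N (foldr rep_step N ([], []))" by (simp add: placed_def)
    then show ?case using rep_step_correct[OF _ Cons.prems] by simp
  qed
  have s: "strict_resolution N = snd ?s"
    by (simp add: strict_resolution_def foldr_conv_fold)
  show "linear_derivation resolution F (strict_resolution N)" "placed (E\<^sup>+) V (strict_resolution N)"
    "length (strict_resolution N) \<le> length N"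
    using inv unfolding s rep_invariant_def by blast+
  obtain a where "a \<in> set (snd ?s)" "set (node_clause a) \<subseteq> set (node_clause n)"
    by (rule rep_invariant_entry[OF inv assms(1,3)])
  then show "\<exists>r \<in> set (strict_resolution N). node_clause r = []"
    unfolding s using assms(4) by auto
qed

subsection \<open>Correctness of pruning\<close>

lemma linear_filter:
  assumes "linear_derivation R F N" "\<And>n. n \<in> set N \<Longrightarrow> node_id n \<in> S \<Longrightarrow> set (node_preds n) \<subseteq> S"
  shows "linear_derivation R F (filter (\<lambda>n. node_id n \<in> S) N)"
  using assms
proof (induction N)
  case (Cons n N)
  let ?f = "filter (\<lambda>n. node_id n \<in> S)"
  have IH: "linear_derivation R F (?f N)" using Cons by simp
  have "justified R F (set (?f N)) n" if "node_id n \<in> S"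
  proof -
    have S: "set (node_preds n) \<subseteq> S" using Cons.prems(2)[of n] that by simp
    have just: "justified R F (set N) n" using Cons.prems(1) by simp
    then show ?thesis
    proof (cases rule: justified_cases)
      case initial
      then show ?thesis using justified_distinct[OF just] by (simp add: justified_def)
    next
      case (inference x a b)
      then show ?thesis
        unfolding justified_def using justified_distinct[OF just] S
        by (intro conjI disjI2 exI[of _ x] bexI[of _ a] bexI[of _ b]) simp_all
    qed
  qed
  then show ?case using IH Cons.prems(1) by auto
qed simp

text \<open>\<open>P\<close> is the part of the list that has been processed, \<open>S\<close> the names of the needed nodes.\<close>

definition needed_root :: "node list \<Rightarrow> nat list \<Rightarrow> node \<Rightarrow> bool" where
  "needed_root P S r \<longleftrightarrow> r \<in> set P \<and> node_clause r = [] \<and> node_id r \<in> set S \<and>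
     (\<forall>m \<in> set P. node_id m \<in> set S \<longrightarrow> node_id r \<notin> set (node_preds m)) \<and>
     (\<forall>u \<in> set S. u \<noteq> node_id r \<longrightarrow> (\<exists>m \<in> set P. node_id m \<in> set S \<and> u \<in> set (node_preds m)))"

definition needed_invariant :: "node list \<Rightarrow> nat list \<Rightarrow> bool" where
  "needed_invariant P S \<longleftrightarrow>
     (S = [] \<longrightarrow> (\<forall>m \<in> set P. node_clause m \<noteq> [])) \<and>
     (\<forall>m \<in> set P. node_id m \<in> set S \<longrightarrow> set (node_preds m) \<subseteq> set S) \<and>
     (S \<noteq> [] \<longrightarrow> (\<exists>r. needed_root P S r))"

text \<open>The predecessors of \<open>n\<close> stand after \<open>n\<close>, so none of them has
  been processed. Therefore the root acquires no successor, and every name that becomes needed has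
  \<open>n\<close> as a needed successor.\<close>

lemma needed_step_invariant:
  assumes inv: "needed_invariant P S" and lin: "linear_derivation R F (P @ n # Q)"
  shows "needed_invariant (P @ [n]) (needed_step n S)"
proof -
  have just: "justified R F (set Q) n" using linear_append[OF lin] by simp
  have old: "set (node_preds n) \<subseteq> node_id ` set Q" using justified_preds[OF just] .
  have "distinct (map node_id (P @ n # Q))" using linear_distinct[OF lin] .
  then have disj: "node_id n \<notin> node_id ` set P" "node_id n \<notin> node_id ` set Q"
    "node_id ` set P \<inter> node_id ` set Q = {}" by auto
  have new: "node_id m \<notin> set (node_preds n) \<and> node_id m \<noteq> node_id n" if "m \<in> set P" for m
    using imageI[OF that, of node_id] old disj by (metis IntI empty_iff subsetD)
  have irrefl: "node_id n \<notin> set (node_preds n)"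
    using old disj(2) by blast
  show ?thesis
  proof (cases "(S = [] \<and> node_clause n = []) \<or> node_id n \<in> set S")
    case True
    have step: "set (needed_step n S) = insert (node_id n) (set (node_preds n) \<union> set S)"
      using just True by (cases rule: justified_cases) (auto simp: needed_step_def)
    then have ne: "needed_step n S \<noteq> []" by (metis insert_not_empty list.set(1))
    have closed: "\<forall>m \<in> set (P @ [n]). node_id m \<in> set (needed_step n S) \<longrightarrow>
        set (node_preds m) \<subseteq> set (needed_step n S)"
    proof (intro ballI impI)
      fix m assume m: "m \<in> set (P @ [n])" "node_id m \<in> set (needed_step n S)"
      show "set (node_preds m) \<subseteq> set (needed_step n S)"
      proof (cases "m = n")
        case False
        then have "m \<in> set P" using m(1) by simp
        then have "node_id m \<in> set S" using new m(2) unfolding step by blast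
        then show ?thesis using inv \<open>m \<in> set P\<close> unfolding needed_invariant_def step by blast
      qed (auto simp: step)
    qed
    have "\<exists>r. needed_root (P @ [n]) (needed_step n S) r"
    proof (cases "S = []")
      case True
      then have "node_clause n = []" using \<open>_ \<or> _\<close> by simp
      then have "needed_root (P @ [n]) (needed_step n S) n"
        unfolding needed_root_def step using new irrefl True by auto
      then show ?thesis ..
    next
      case False
      then obtain r where "needed_root P S r"
        using inv unfolding needed_invariant_def by blast
      then have r: "r \<in> set P" "node_clause r = []" "node_id r \<in> set S"
        "\<forall>m \<in> set P. node_id m \<in> set S \<longrightarrow> node_id r \<notin> set (node_preds m)"
        "\<forall>u \<in> set S. u \<noteq> node_id r \<longrightarrow> (\<exists>m \<in> set P. node_id m \<in> set S \<and> u \<in> set (node_preds m))"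
        unfolding needed_root_def by blast+
      have "needed_root (P @ [n]) (needed_step n S) r"
        unfolding needed_root_def
      proof (intro conjI ballI impI)
        fix m assume "m \<in> set (P @ [n])" "node_id m \<in> set (needed_step n S)"
        then show "node_id r \<notin> set (node_preds m)"
          using r(1,4) new[of m] new[OF r(1)] unfolding step by auto
      next
        fix u assume u: "u \<in> set (needed_step n S)" "u \<noteq> node_id r"
        have "node_id n \<in> set S" using True False by blast
        then consider "u \<in> set (node_preds n)" | "u \<in> set S" using u(1) unfolding step by auto
        then show "\<exists>m \<in> set (P @ [n]). node_id m \<in> set (needed_step n S) \<and> u \<in> set (node_preds m)"
        proof cases
          case 1
          then show ?thesis unfolding step by auto
        next
          case 2
          then obtain m where "m \<in> set P" "node_id m \<in> set S" "u \<in> set (node_preds m)"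
            using r(5) u(2) by blast
          then show ?thesis unfolding step by auto
        qed
      qed (use r(1-3) in \<open>simp_all add: step\<close>)
      then show ?thesis ..
    qed
    then show ?thesis using ne closed unfolding needed_invariant_def by blast
  next
    case False
    then have "needed_step n S = S" by (auto simp: needed_step_def)
    then show ?thesis using inv False unfolding needed_invariant_def needed_root_def by auto
  qed
qed

lemma needed_correct:
  assumes "linear_derivation R F N"
  shows "needed_invariant N (needed N)"
proof -
  have "needed_invariant P (fold needed_step P [])" if "N = P @ Q" for P Q
    using that
  proof (induction P arbitrary: Q rule: rev_induct)
    case Nil
    then show ?case by (simp add: needed_invariant_def)
  next
    case (snoc n P)
    then show ?case using needed_step_invariant[of P _ R F n Q] assms by simp
  qed
  then show ?thesis unfolding needed_def by simp
qed

lemma prune_correct: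
  assumes "linear_derivation R F N" "placed E V N" "n \<in> set N" "node_clause n = []"
  shows "linear_derivation R F (prune N)" "placed E V (prune N)" "length (prune N) \<le> length N"
    "dag_derivation R F (graph_of (prune N)) {||}"
proof -
  let ?S = "needed N"
  have inv: "needed_invariant N ?S" using needed_correct[OF assms(1)] .
  then have "?S = [] \<longrightarrow> (\<forall>m \<in> set N. node_clause m \<noteq> [])"
    and closed: "\<forall>m \<in> set N. node_id m \<in> set ?S \<longrightarrow> set (node_preds m) \<subseteq> set ?S"
    and root: "?S \<noteq> [] \<longrightarrow> (\<exists>r. needed_root N ?S r)"
    unfolding needed_invariant_def by blast+
  then have ne: "?S \<noteq> []" using assms(3,4) by auto
  show lin: "linear_derivation R F (prune N)"
    unfolding prune_def by (rule linear_filter[OF assms(1)]) (use closed in blast)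
  show "placed E V (prune N)" using assms(2) by (simp add: placed_def prune_def)
  show "length (prune N) \<le> length N" by (simp add: prune_def)
  obtain r where "needed_root N ?S r" using mp[OF root ne] by blast
  then have r: "r \<in> set N" "node_clause r = []" "node_id r \<in> set ?S"
    "\<forall>m \<in> set N. node_id m \<in> set ?S \<longrightarrow> node_id r \<notin> set (node_preds m)"
    "\<forall>u \<in> set ?S. u \<noteq> node_id r \<longrightarrow> (\<exists>m \<in> set N. node_id m \<in> set ?S \<and> u \<in> set (node_preds m))"
    unfolding needed_root_def by blast+
  have mem: "m \<in> set (prune N) \<longleftrightarrow> m \<in> set N \<and> node_id m \<in> set ?S" for m
    by (simp add: prune_def)
  show "dag_derivation R F (graph_of (prune N)) {||}"
  proof (rule graph_of_derivation[OF lin, of r])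
    show "\<exists>m \<in> set (prune N). node_id k \<in> set (node_preds m)" if "k \<in> set (prune N)" "k \<noteq> r" for k
    proof -
      have "node_id k \<noteq> node_id r"
        using that linear_unique[OF assms(1) _ r(1), of k] by (auto simp: mem)
      then show ?thesis using r(5) that(1) mem by blast
    qed
  qed (use r mem in blast)+
qed

section \<open>Trees with lemmas\<close>

primrec rtree_of :: "ltree \<Rightarrow> rtree" where
  "rtree_of (LLeaf c) = Leaf (fset_of_list c)"
| "rtree_of (LInfer x c l r) = Infer x (fset_of_list c) (rtree_of l) (rtree_of r)"

primrec distinct_clauses :: "ltree \<Rightarrow> bool" where
  "distinct_clauses (LLeaf c) \<longleftrightarrow> distinct c"
| "distinct_clauses (LInfer x c l r) \<longleftrightarrow> distinct c \<and> distinct_clauses l \<and> distinct_clauses r"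

primrec inferences :: "ltree \<Rightarrow> nat" where
  "inferences (LLeaf c) = 0"
| "inferences (LInfer x c l r) = 1 + inferences l + inferences r"

lemma conclusion_rtree_of: "conclusion (rtree_of t) = fset_of_list (ltree_clause t)"
  by (cases t) simp_all

lemma length_postorder: "length (postorder (rtree_of t)) = 2 * inferences t + 1"
  by (induction t) simp_all

lemma encodes_tree_enc:
  "encodes_tree v T \<longleftrightarrow> (\<exists>t. v = enc t \<and> rtree_of t = T \<and> distinct_clauses t)"
proof (induction T arbitrary: v)
  case (Leaf C)
  show ?case
  proof
    assume "encodes_tree v (Leaf C)"
    then obtain c where "distinct c" "fset_of_list c = C" "v = Pair (enc c) Atom"
      by (auto simp: encodes_clause_enc)
    then show "\<exists>t. v = enc t \<and> rtree_of t = Leaf C \<and> distinct_clauses t"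
      by (intro exI[of _ "LLeaf c"]) simp
  next
    assume "\<exists>t. v = enc t \<and> rtree_of t = Leaf C \<and> distinct_clauses t"
    then obtain t where t: "v = enc t" "rtree_of t = Leaf C" "distinct_clauses t" by blast
    then show "encodes_tree v (Leaf C)"
      by (cases t) (auto simp: encodes_clause_enc)
  qed
next
  case (Infer x C l r)
  show ?case
  proof
    assume "encodes_tree v (Infer x C l r)"
    then obtain c vl vr where "encodes_clause c C" "encodes_tree vl l" "encodes_tree vr r"
      and v: "v = encode_list [encode_nat x, c, vl, vr]" by auto
    moreover obtain d where d: "distinct d" "fset_of_list d = C" "c = enc d"
      using \<open>encodes_clause c C\<close> encodes_clause_enc by blast
    moreover obtain tl where tl: "vl = enc tl" "rtree_of tl = l" "distinct_clauses tl"
      using Infer.IH(1) \<open>encodes_tree vl l\<close> by blast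
    moreover obtain tr where tr: "vr = enc tr" "rtree_of tr = r" "distinct_clauses tr"
      using Infer.IH(2) \<open>encodes_tree vr r\<close> by blast
    ultimately show "\<exists>t. v = enc t \<and> rtree_of t = Infer x C l r \<and> distinct_clauses t"
      by (intro exI[of _ "LInfer x d tl tr"]) (simp add: enc_nat_def)
  next
    assume "\<exists>t. v = enc t \<and> rtree_of t = Infer x C l r \<and> distinct_clauses t"
    then obtain t where t: "v = enc t" "rtree_of t = Infer x C l r" "distinct_clauses t" by blast
    then obtain c tl tr where t': "t = LInfer x c tl tr" "fset_of_list c = C" "rtree_of tl = l" "rtree_of tr = r"
      by (cases t) simp_all
    have "encodes_clause (enc c) C"
      unfolding encodes_clause_enc using t(3) t'(1,2) by (intro exI[of _ c]) simp
    moreover have "encodes_tree (enc tl) l"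
      unfolding Infer.IH(1) using t(3) t'(1,3) by (intro exI[of _ tl]) simp
    moreover have "encodes_tree (enc tr) r"
      unfolding Infer.IH(2) using t(3) t'(1,4) by (intro exI[of _ tr]) simp
    ultimately show "encodes_tree v (Infer x C l r)"
      unfolding encodes_tree.simps t(1) t'(1)
      by (intro exI[of _ "enc c"] exI[of _ "enc tl"] exI[of _ "enc tr"]) (simp add: enc_nat_def)
  qed
qed

definition learned :: "rtree list \<Rightarrow> clause set" where
  "learned ss = conclusion ` {s \<in> set ss. input_resolution_tree s}"

text \<open>The positional condition on lemmas in \<open>tree_derivation\<close>, recast with a
  growing set of clauses so that it splits where the post-orders of two subtrees are joined.\<close>

primrec leaves_available :: "clause set \<Rightarrow> rtree list \<Rightarrow> bool" where
  "leaves_available A [] \<longleftrightarrow> True"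
| "leaves_available A (s # ss) \<longleftrightarrow>
     (\<forall>D. s = Leaf D \<longrightarrow> D \<in> A) \<and> leaves_available (A \<union> learned [s]) ss"

lemma learned_append: "learned (ss @ ss') = learned ss \<union> learned ss'"
  unfolding learned_def by auto

lemma leaves_available_mono: "leaves_available A ss \<Longrightarrow> A \<subseteq> B \<Longrightarrow> leaves_available B ss"
proof (induction ss arbitrary: A B)
  case (Cons s ss)
  have "leaves_available (B \<union> learned [s]) ss"
    by (rule Cons.IH[of "A \<union> learned [s]"]) (use Cons.prems in auto)
  then show ?case using Cons.prems by auto
qed simp

lemma leaves_available_append:
  "leaves_available A (ss @ ss') \<longleftrightarrow> leaves_available A ss \<and> leaves_available (A \<union> learned ss) ss'"
proof (induction ss arbitrary: A)
  case Nil
  then show ?case by (simp add: learned_def)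
next
  case (Cons s ss)
  have "learned (s # ss) = learned [s] \<union> learned ss"
    using learned_append[of "[s]" ss] by simp
  then show ?case using Cons.IH by (simp add: Un_assoc)
qed

lemma leaves_available_nth:
  assumes "leaves_available A ss" "i < length ss" "ss ! i = Leaf D"
  shows "D \<in> A \<or> (\<exists>j < i. input_resolution_tree (ss ! j) \<and> conclusion (ss ! j) = D)"
proof -
  have ss: "ss = take i ss @ Leaf D # drop (Suc i) ss"
    using id_take_nth_drop[OF assms(2)] assms(3) by simp
  have "leaves_available A (take i ss @ Leaf D # drop (Suc i) ss)"
    using assms(1) ss by simp
  then have "D \<in> A \<union> learned (take i ss)"
    unfolding leaves_available_append by simp
  then show ?thesis
    unfolding learned_def using assms(2) by (auto simp: in_set_conv_nth)
qed

subsection \<open>Correctness of unfolding\<close>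

definition available :: "clause set \<Rightarrow> node list \<Rightarrow> nat list \<Rightarrow> clause set" where
  "available F N K = F \<union> clause_of_node ` {n \<in> set N. node_id n \<in> set K}"

text \<open>\<open>t\<close> is a derivation of the clause of \<open>n\<close> from the lemmas in \<open>K\<close> which provides
  the lemmas in \<open>K'\<close>.\<close>

definition unfolding_of ::
    "clause set \<Rightarrow> node list \<Rightarrow> (nat \<times> nat) set \<Rightarrow> (nat \<Rightarrow> var option) \<Rightarrow>
      nat list \<Rightarrow> node \<Rightarrow> ltree \<Rightarrow> nat list \<Rightarrow> bool" where
  "unfolding_of F N E V K n t K' \<longleftrightarrow>
     ltree_clause t = node_clause n \<and> distinct_clauses t \<and>
     correct_inferences resolution (rtree_of t) \<and>
     leaves_available (available F N K) (postorder (rtree_of t)) \<and>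
     available F N K' \<subseteq> available F N K \<union> learned (postorder (rtree_of t)) \<and>
     regular_tree (rtree_of t) \<and>
     (\<forall>xs \<in> branches (rtree_of t). \<forall>x \<in> set xs. \<exists>w. (w, node_id n) \<in> E\<^sup>* \<and> V w = Some x)"

lemma unfolding_of_leaf:
  assumes "linear_derivation resolution F N" "n \<in> set N" "known K n"
  shows "unfolding_of F N E V K n (LLeaf (node_clause n)) K"
proof -
  have just: "justified resolution F (set N) n" using linear_justified[OF assms(1,2)] .
  have "clause_of_node n \<in> available F N K"
  proof (cases "node_preds n = []")
    case True
    from just have "clause_of_node n \<in> F"
      by (cases rule: justified_cases) (use True in simp_all)
    then show ?thesis by (simp add: available_def)
  next
    case False
    then show ?thesis using assms(2,3) by (simp add: available_def known_def)
  qed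
  then show ?thesis
    using justified_distinct[OF just] by (simp add: unfolding_of_def regular_tree_def)
qed

text \<open>In post-order the lemmas learned in \<open>l\<close> are available in \<open>r\<close>.
  All variables in \<open>l\<close> and \<open>r\<close> label nodes from which a nonempty path
  leads to \<open>n\<close>, so regularity of \<open>E\<close> keeps \<open>x\<close> away from
  them.\<close>

lemma unfolding_of_infer:
  assumes l: "unfolding_of F N E V K a l K1" and r: "unfolding_of F N E V K1 b r K2"
    and infers: "infers resolution x (clause_of_node a) (clause_of_node b) (clause_of_node n)"
    and n: "distinct (node_clause n)" "V (node_id n) = Some x"
    and E: "(node_id a, node_id n) \<in> E" "(node_id b, node_id n) \<in> E" and reg: "regular_rel E V"
  shows "unfolding_of F N E V K n (LInfer x (node_clause n) l r) K2"
proof -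
  let ?l = "postorder (rtree_of l)" and ?r = "postorder (rtree_of r)"
  let ?t = "LInfer x (node_clause n) l r"
  note L = l[unfolded unfolding_of_def] and R = r[unfolded unfolding_of_def]
  have sub: "available F N K1 \<subseteq> available F N K \<union> learned ?l" using L by blast
  have "leaves_available (available F N K1) ?r" using R by blast
  then have "leaves_available (available F N K \<union> learned ?l) ?r"
    using sub by (rule leaves_available_mono)
  then have avail: "leaves_available (available F N K) (postorder (rtree_of ?t))"
    using L by (simp add: leaves_available_append)
  have "available F N K2 \<subseteq> available F N K1 \<union> learned ?r" using R by blast
  then have provided: "available F N K2 \<subseteq> available F N K \<union> learned (postorder (rtree_of ?t))"
    using sub by (auto simp: learned_append)
  have path: "\<exists>w. (w, node_id n) \<in> E\<^sup>+ \<and> V w = Some y"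
    if "xs \<in> branches (rtree_of l) \<union> branches (rtree_of r)" "y \<in> set xs" for xs y
  proof -
    have "(\<exists>w. (w, node_id a) \<in> E\<^sup>* \<and> V w = Some y) \<or> (\<exists>w. (w, node_id b) \<in> E\<^sup>* \<and> V w = Some y)"
      using that L R by blast
    then show ?thesis using E rtrancl_into_trancl1 by metis
  qed
  have x: "x \<notin> set xs" if "xs \<in> branches (rtree_of l) \<union> branches (rtree_of r)" for xs
    using path[OF that] reg n(2) unfolding regular_rel_def by blast
  have dist: "distinct xs" if "xs \<in> branches (rtree_of l) \<union> branches (rtree_of r)" for xs
    using that L R unfolding regular_tree_def by blast
  have regular: "regular_tree (rtree_of ?t)"
    unfolding regular_tree_def
  proof
    fix ys assume "ys \<in> branches (rtree_of ?t)"
    then have "ys \<in> (#) x ` (branches (rtree_of l) \<union> branches (rtree_of r))"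
      by (simp only: rtree_of.simps branches.simps)
    then obtain xs where xs: "ys = x # xs" "xs \<in> branches (rtree_of l) \<union> branches (rtree_of r)"
      by blast
    then show "distinct ys" using x[OF xs(2)] dist[OF xs(2)] by simp
  qed
  have vars: "\<exists>w. (w, node_id n) \<in> E\<^sup>* \<and> V w = Some y" if "ys \<in> branches (rtree_of ?t)" "y \<in> set ys" for ys y
  proof -
    have "ys \<in> (#) x ` (branches (rtree_of l) \<union> branches (rtree_of r))"
      using that(1) by (simp only: rtree_of.simps branches.simps)
    then obtain xs where xs: "ys = x # xs" "xs \<in> branches (rtree_of l) \<union> branches (rtree_of r)"
      by blast
    show ?thesis
    proof (cases "y = x")
      case False
      then show ?thesis using path[OF xs(2), of y] that(2) xs(1) trancl_into_rtrancl by fastforce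
    qed (use n(2) in blast)
  qed
  have "correct_inferences resolution (rtree_of ?t)"
    using L R infers by (simp add: conclusion_rtree_of)
  then show ?thesis
    unfolding unfolding_of_def using avail provided regular vars L R n(1) by simp
qed

text \<open>A genuine inference from two leaves is an input resolution tree, so its conclusion may
  be used as a lemma from now on.\<close>

lemma unfolding_of_learn:
  assumes t: "unfolding_of F N E V K n (LInfer x (node_clause n) (LLeaf c) (LLeaf d)) K"
    and lin: "linear_derivation resolution F N" "n \<in> set N"
  shows "unfolding_of F N E V K n (LInfer x (node_clause n) (LLeaf c) (LLeaf d)) (node_id n # K)"
proof -
  let ?T = "rtree_of (LInfer x (node_clause n) (LLeaf c) (LLeaf d))"
  have "input_resolution_tree ?T"
    using t unfolding unfolding_of_def input_resolution_tree_def by simp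
  then have "clause_of_node n \<in> learned (postorder ?T)"
    unfolding learned_def by (intro image_eqI[of _ _ ?T]) simp_all
  moreover have "available F N (node_id n # K) \<subseteq> insert (clause_of_node n) (available F N K)"
    using linear_unique[OF lin(1) _ lin(2)] by (auto simp: available_def)
  ultimately show ?thesis
    using t unfolding unfolding_of_def by blast
qed

section \<open>The course of the depth-first search\<close>

lemma search_step_known:
  "find_node (node_id n) N = Some n \<Longrightarrow> known K n \<Longrightarrow>
    search_step N ((node_id n, False) # W, K, ts) = (W, K, LLeaf (node_clause n) # ts)"
  by (simp add: search_step_def)

lemma search_step_learn:
  assumes "find_node (node_id n) N = Some n" "\<not> known K n" "node_var n = Some x"
    and "node_preds n = [node_id a, node_id b]" "find_node (node_id a) N = Some a"
    and "find_node (node_id b) N = Some b" "known K a" "known K b"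
  shows "search_step N ((node_id n, False) # W, K, ts) =
    (W, node_id n # K, LInfer x (node_clause n) (LLeaf (node_clause a)) (LLeaf (node_clause b)) # ts)"
  using assms by (simp add: search_step_def)

lemma search_step_expand:
  assumes "find_node (node_id n) N = Some n" "\<not> known K n" "node_var n = Some x"
    and "node_preds n = [node_id a, node_id b]" "find_node (node_id a) N = Some a"
    and "find_node (node_id b) N = Some b" "\<not> (known K a \<and> known K b)"
  shows "search_step N ((node_id n, False) # W, K, ts) =
    ((node_id a, False) # (node_id b, False) # (node_id n, True) # W, K, ts)"
  using assms by (auto simp: search_step_def)

lemma search_step_build:
  assumes "find_node (node_id n) N = Some n" "node_var n = Some x"
  shows "search_step N ((node_id n, True) # W, K, r # l # ts) = (W, K, LInfer x (node_clause n) l r # ts)"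
  using assms by (simp add: search_step_def)

lemma card_known:
  assumes "\<not> known K n" "known K' n" "set K \<subseteq> set K'"
  shows "card (set K) < card (set K')"
  using assms by (intro psubset_card_mono) (auto simp: known_def)

text \<open>Visiting a node whose clause is not yet available always learns some clause, so every
  inference of the tree lies above an inference from two leaves that learns a new clause; there are at
  most \<open>length N\<close> of these, each below at most \<open>length M\<close> inferences.\<close>

lemma search_visit:
  assumes lin: "linear_derivation resolution F N" and placed: "placed E V N" and reg: "regular_rel E V"
  shows "N = P @ M \<Longrightarrow> n \<in> set M \<Longrightarrow> set K \<subseteq> node_id ` set N \<Longrightarrow>
    \<exists>k t K'. (\<forall>W ts. (search_step N ^^ k) ((node_id n, False) # W, K, ts) = (W, K', t # ts)) \<and>
      set K \<subseteq> set K' \<and> set K' \<subseteq> node_id ` set N \<and> unfolding_of F N E V K n t K' \<and>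
      k \<le> 3 * inferences t + 1 \<and>
      inferences t + length M * card (set K) \<le> length M * card (set K') \<and>
      (\<not> known K n \<longrightarrow> card (set K) < card (set K'))"
proof (induction "length M" arbitrary: M P n K rule: less_induct)
  case less
  have n: "n \<in> set N" using less.prems by simp
  have find: "find_node (node_id m) N = Some m" if "m \<in> set N" for m
    using find_node_linear[OF lin that] .
  show ?case
  proof (cases "known K n")
    case True
    have "(search_step N ^^ 1) ((node_id n, False) # W, K, ts) = (W, K, LLeaf (node_clause n) # ts)" for W ts
      using search_step_known[OF find[OF n] True] by simp
    moreover have "unfolding_of F N E V K n (LLeaf (node_clause n)) K"
      by (rule unfolding_of_leaf[OF lin n True])
    ultimately show ?thesis
      using True less.prems(3)
      by (intro exI[of _ 1] exI[of _ "LLeaf (node_clause n)"] exI[of _ K]) simp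
  next
    case unknown: False
    obtain M1 M2 where M: "M = M1 @ n # M2" using less.prems(2) by (meson split_list)
    have N: "N = (P @ M1 @ [n]) @ M2" using less.prems(1) M by simp
    have just: "justified resolution F (set M2) n"
      using linear_append[of resolution F "P @ M1" "n # M2"] lin N by simp
    from just obtain x a b where ab: "a \<in> set M2" "b \<in> set M2" "node_var n = Some x"
      "node_preds n = [node_id a, node_id b]"
      "infers resolution x (clause_of_node a) (clause_of_node b) (clause_of_node n)"
      by (cases rule: justified_cases) (use unknown in \<open>simp_all add: known_def\<close>)
    have a: "a \<in> set N" and b: "b \<in> set N" using N ab by simp_all
    have E: "(node_id a, node_id n) \<in> E" "(node_id b, node_id n) \<in> E" "V (node_id n) = Some x"
      using placed n ab(3,4) by (auto simp: placed_def)
    note infer = unfolding_of_infer[OF _ _ ab(5) justified_distinct[OF just] E(3,1,2) reg]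
    have len: "length M \<ge> length M2 + 1" unfolding M by simp
    show ?thesis
    proof (cases "known K a \<and> known K b")
      case True
      let ?t = "LInfer x (node_clause n) (LLeaf (node_clause a)) (LLeaf (node_clause b))"
      have step: "(search_step N ^^ 1) ((node_id n, False) # W, K, ts) = (W, node_id n # K, ?t # ts)" for W ts
        using search_step_learn[OF find[OF n] unknown ab(3,4) find[OF a] find[OF b]] True by simp
      have "unfolding_of F N E V K n ?t K"
        by (rule infer[OF unfolding_of_leaf[OF lin a] unfolding_of_leaf[OF lin b]]) (use True in simp_all)
      then have unf: "unfolding_of F N E V K n ?t (node_id n # K)"
        by (rule unfolding_of_learn[OF _ lin n])
      have card: "card (set (node_id n # K)) = card (set K) + 1"
        using unknown by (simp add: known_def)
      have "1 + length M * card (set K) \<le> length M * (card (set K) + 1)"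
        using len by simp
      then show ?thesis
        using step unf less.prems(3) n card
        by (intro exI[of _ 1] exI[of _ ?t] exI[of _ "node_id n # K"]) auto
    next
      case False
      obtain k1 l K1 where 1:
        "\<And>W ts. (search_step N ^^ k1) ((node_id a, False) # W, K, ts) = (W, K1, l # ts)"
        "set K \<subseteq> set K1" "set K1 \<subseteq> node_id ` set N" "unfolding_of F N E V K a l K1"
        "k1 \<le> 3 * inferences l + 1"
        "inferences l + length M2 * card (set K) \<le> length M2 * card (set K1)"
        "\<not> known K a \<longrightarrow> card (set K) < card (set K1)"
        using less.hyps[OF _ N ab(1) less.prems(3)] len by auto
      obtain k2 r K2 where 2:
        "\<And>W ts. (search_step N ^^ k2) ((node_id b, False) # W, K1, ts) = (W, K2, r # ts)"
        "set K1 \<subseteq> set K2" "set K2 \<subseteq> node_id ` set N" "unfolding_of F N E V K1 b r K2"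
        "k2 \<le> 3 * inferences r + 1"
        "inferences r + length M2 * card (set K1) \<le> length M2 * card (set K2)"
        "\<not> known K1 b \<longrightarrow> card (set K1) < card (set K2)"
        using less.hyps[OF _ N ab(2) 1(3)] len by auto
      \<comment> \<open>One step expands \<open>n\<close>, \<open>k1\<close> and \<open>k2\<close>
        steps treat its predecessors, one step builds the tree. With one step for a leaf, two extra
        steps per inference and one surplus from combining both subtrees give
        \<open>3 * inferences t + 1\<close>.\<close>
      let ?t = "LInfer x (node_clause n) l r" and ?k = "1 + (k2 + (k1 + 1))"
      have step: "(search_step N ^^ ?k) ((node_id n, False) # W, K, ts) = (W, K2, ?t # ts)" for W ts
        unfolding funpow_add comp_def
        using search_step_expand[OF find[OF n] unknown ab(3,4) find[OF a] find[OF b] False]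
          search_step_build[OF find[OF n] ab(3)] 1(1) 2(1) by simp
      have c1: "card (set K) \<le> card (set K1)" and c2: "card (set K1) \<le> card (set K2)"
        using 1(2) 2(2) by (auto intro: card_mono)
      \<comment> \<open>If \<open>a\<close> is known, then \<open>b\<close> is not; either
        \<open>b\<close> was learned during the visit of \<open>a\<close>, or visiting
        \<open>b\<close> itself learns something.\<close>
      have strict: "card (set K) < card (set K2)"
      proof (cases "known K a")
        case True
        then have "\<not> known K b" using False by simp
        then show ?thesis
          using c1 c2 2(7) card_known[of K b K1] 1(2) by (cases "known K1 b") auto
      next
        case False
        then show ?thesis using 1(7) c2 by simp
      qed
      \<comment> \<open>The recursive visits charge \<open>length M2\<close> to each learned clause.
        The difference \<open>1 + d\<close> to \<open>length M\<close>, charged to at least one new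
        clause, pays for the inference at \<open>n\<close>.\<close>
      obtain d where d: "length M = length M2 + 1 + d" using len nat_le_iff_add by blast
      have "inferences ?t + length M2 * card (set K) \<le> 1 + length M2 * card (set K2)"
        using 1(6) 2(6) by simp
      moreover have "(1 + d) * card (set K) + 1 \<le> (1 + d) * card (set K2)"
      proof -
        have "(1 + d) * (card (set K) + 1) \<le> (1 + d) * card (set K2)"
          by (rule mult_le_mono2) (use strict in simp)
        then show ?thesis by (simp add: algebra_simps)
      qed
      ultimately have size: "inferences ?t + length M * card (set K) \<le> length M * card (set K2)"
        unfolding d by (simp add: algebra_simps)
      have "unfolding_of F N E V K n ?t K2" by (rule infer[OF 1(4) 2(4)])
      moreover have "set K \<subseteq> set K2" using 1(2) 2(2) by blast
      moreover have "?k \<le> 3 * inferences ?t + 1" using 1(5) 2(5) by simp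
      ultimately show ?thesis
        using step 2(3) size strict by (intro exI[of _ ?k] exI[of _ ?t] exI[of _ K2]) blast
    qed
  qed
qed

lemma fold_const_funpow: "fold (\<lambda>_. f) xs s = (f ^^ length xs) s"
  by (induction xs arbitrary: s) (simp_all add: funpow_swap1)

lemma search_funpow: "search N s = (search_step N ^^ (cells (enc N) * cells (enc N))) s"
  unfolding search_def fold_const_funpow by (simp add: fuel_def funpow_mult)

lemma two_length_cells: "2 * length (N :: node list) + 1 \<le> cells (enc N)"
proof (induction N)
  case (Cons n N)
  then show ?case using cells_node[of n] by simp
qed simp

lemma funpow_fixpoint: "f s = s \<Longrightarrow> (f ^^ k) s = s"
  by (induction k) simp_all

lemma unfold_dag_correct:
  assumes lin: "linear_derivation resolution F N" and placed: "placed E V N" and reg: "regular_rel E V"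
    and empty: "\<exists>r \<in> set N. node_clause r = []"
  shows "tree_derivation resolution input_resolution_tree F (rtree_of (unfold_dag N)) {||}"
    "regular_tree (rtree_of (unfold_dag N))" "distinct_clauses (unfold_dag N)"
    "length (postorder (rtree_of (unfold_dag N))) \<le> 2 * (length N * length N) + 1"
proof -
  obtain n where n: "List.find (\<lambda>n. node_clause n = []) N = Some n"
    using empty by (cases "List.find (\<lambda>n. node_clause n = []) N") (auto simp: find_None_iff)
  then have n': "n \<in> set N" "node_clause n = []" using find_Some_mem[OF n] by simp_all
  obtain k t K' where
    k: "\<And>W ts. (search_step N ^^ k) ((node_id n, False) # W, [], ts) = (W, K', t # ts)"
    and K': "set K' \<subseteq> node_id ` set N" and unf: "unfolding_of F N E V [] n t K'"
    and len: "k \<le> 3 * inferences t + 1" and inf: "inferences t \<le> length N * card (set K')"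
    using search_visit[OF lin placed reg, of "[]" N n "[]"] n'(1) by auto
  have "card (set K') \<le> length N"
    using K' card_mono[of "node_id ` set N" "set K'"] card_image_le[of "set N" node_id] card_length[of N]
    by (meson List.finite_set finite_imageI le_trans)
  then have size: "inferences t \<le> length N * length N"
    using inf by (meson le_trans mult_le_mono2)
  \<comment> \<open>The search takes at most \<open>3 * (length N * length N) + 1\<close> steps,
    which this square exceeds or equals.\<close>
  have "(2 * length N + 1) * (2 * length N + 1) \<le> cells (enc N) * cells (enc N)"
    by (intro mult_le_mono two_length_cells)
  then have "k \<le> cells (enc N) * cells (enc N)"
    using len size by (simp add: algebra_simps)
  then obtain j where j: "cells (enc N) * cells (enc N) = j + k"
    by (metis le_add_diff_inverse2)
  \<comment> \<open>With an empty task stack the surplus steps change nothing.\<close>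
  have "search_step N ([], K', [t]) = ([], K', [t])" by (simp add: search_step_def)
  then have "search N ([(node_id n, False)], [], []) = ([], K', [t])"
    unfolding search_funpow j funpow_add comp_def using k[of "[]" "[]"] funpow_fixpoint by simp
  then have t: "unfold_dag N = t" by (simp add: unfold_dag_def n)
  note U = unf[unfolded unfolding_of_def]
  have "available F N [] = F" by (simp add: available_def)
  then have avail: "leaves_available F (postorder (rtree_of t))" using U by simp
  show "tree_derivation resolution input_resolution_tree F (rtree_of (unfold_dag N)) {||}"
    unfolding tree_derivation_def t
    using U leaves_available_nth[OF avail] n'(2) by (simp add: conclusion_rtree_of)
  show "regular_tree (rtree_of (unfold_dag N))" "distinct_clauses (unfold_dag N)"
    unfolding t using U by simp_all
  show "length (postorder (rtree_of (unfold_dag N))) \<le> 2 * (length N * length N) + 1"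
    unfolding t length_postorder using size by simp
qed

subsection \<open>Correctness of linearization\<close>

primrec ltree_postorder :: "ltree \<Rightarrow> ltree list" where
  "ltree_postorder (LLeaf c) = [LLeaf c]"
| "ltree_postorder (LInfer x c l r) = ltree_postorder l @ ltree_postorder r @ [LInfer x c l r]"

lemma postorder_rtree_of: "postorder (rtree_of t) = map rtree_of (ltree_postorder t)"
  by (induction t) simp_all

lemma visit_step_funpow:
  "(visit_step ^^ length (ltree_postorder t)) (t # ts, A) = (ts, ltree_postorder t @ A)"
proof (induction t arbitrary: ts A)
  case (LLeaf c)
  then show ?case by (simp add: visit_step_def)
next
  case (LInfer x c l r)
  have "length (ltree_postorder (LInfer x c l r)) =
      length (ltree_postorder l) + (length (ltree_postorder r) + 1)" by simp
  then have "(visit_step ^^ length (ltree_postorder (LInfer x c l r))) (LInfer x c l r # ts, A) =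
      (visit_step ^^ length (ltree_postorder l)) ((visit_step ^^ length (ltree_postorder r))
        (visit_step (LInfer x c l r # ts, A)))"
    by (simp add: funpow_add funpow_swap1 del: ltree_postorder.simps)
  also have "visit_step (LInfer x c l r # ts, A) = (r # l # ts, LInfer x c l r # A)"
    by (simp add: visit_step_def)
  finally show ?case by (simp add: LInfer.IH)
qed

lemma length_ltree_postorder: "length (ltree_postorder t) \<le> cells (enc t)"
  by (induction t) simp_all

lemma subtrees_postorder: "subtrees t = ltree_postorder t"
proof -
  obtain j where j: "cells (enc t) = j + length (ltree_postorder t)"
    using length_ltree_postorder[of t] by (metis le_add_diff_inverse2)
  have "(visit_step ^^ j) ([], A) = ([], A)" for A
    by (rule funpow_fixpoint) (simp add: visit_step_def)
  then have "(visit_step ^^ cells (enc t)) ([t], []) = ([], ltree_postorder t)"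
    unfolding j funpow_add comp_def by (simp add: visit_step_funpow)
  then show ?thesis by (simp add: subtrees_def fold_const_funpow fuel_def)
qed

lemma root_in_ltree_postorder: "t \<in> set (ltree_postorder t)"
  by (cases t) simp_all

lemma children_in_ltree_postorder:
  "i < length (ltree_postorder t) \<Longrightarrow> ltree_postorder t ! i = LInfer x c l r \<Longrightarrow>
    l \<in> set (take i (ltree_postorder t)) \<and> r \<in> set (take i (ltree_postorder t))"
proof (induction t arbitrary: i)
  case (LInfer y d l' r')
  let ?l = "ltree_postorder l'" and ?r = "ltree_postorder r'"
  consider "i < length ?l" | j where "i = length ?l + j" "j < length ?r" | "i = length ?l + length ?r"
    using LInfer.prems(1) by simp (metis add_diff_inverse_nat less_SucE nat_add_left_cancel_less)
  then show ?case
  proof cases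
    case 1
    then show ?thesis using LInfer.IH(1)[of i] LInfer.prems(2) by (simp add: nth_append)
  next
    case (2 j)
    then have "?r ! j = LInfer x c l r" using LInfer.prems(2) by (simp add: nth_append)
    then show ?thesis using LInfer.IH(2)[OF 2(2)] 2 by simp
  next
    case 3
    then have "l = l'" "r = r'" using LInfer.prems(2) by (simp_all add: nth_append)
    then show ?thesis using 3 root_in_ltree_postorder by simp
  qed
qed simp

lemma ltree_postorder_mem:
  assumes "s \<in> set (ltree_postorder t)"
  shows "correct_inferences R (rtree_of t) \<Longrightarrow> correct_inferences R (rtree_of s)"
    and "distinct_clauses t \<Longrightarrow> distinct_clauses s"
  using assms by (induction t) auto

lemma find_clause_Some:
  "find_clause c N = Some n \<Longrightarrow> n \<in> set N \<and> set (node_clause n) = set c"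
  unfolding find_clause_def by (drule find_Some_mem) auto

lemma find_clause_None: "find_clause c N = None \<Longrightarrow> n \<in> set N \<Longrightarrow> set (node_clause n) \<noteq> set c"
  unfolding find_clause_def find_None_iff by auto

text \<open>A leaf and the lemma it repeats may list their literals in different orders, hence the
  comparison as sets.\<close>

definition admissible :: "clause set \<Rightarrow> ltree list \<Rightarrow> ltree \<Rightarrow> bool" where
  "admissible F ts t \<longleftrightarrow> distinct (ltree_clause t) \<and>
     (case t of
        LLeaf c \<Rightarrow> fset_of_list c \<in> F \<or> (\<exists>s \<in> set ts. set (ltree_clause s) = set c)
      | LInfer x c l r \<Rightarrow> l \<in> set ts \<and> r \<in> set ts \<and>
          infers w_resolution x (fset_of_list (ltree_clause l)) (fset_of_list (ltree_clause r))
            (fset_of_list c))"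

definition linear_invariant :: "clause set \<Rightarrow> ltree list \<Rightarrow> node list \<Rightarrow> bool" where
  "linear_invariant F ts N \<longleftrightarrow> linear_derivation w_resolution F N \<and> length N \<le> length ts \<and>
     (\<forall>n \<in> set N. node_id n < fresh_id N) \<and>
     (\<forall>t \<in> set ts. \<exists>n \<in> set N. set (node_clause n) = set (ltree_clause t))"

lemma linear_invariant_add:
  assumes "linear_invariant F ts N" "node_id n = fresh_id N" "node_clause n = ltree_clause t"
    and "justified w_resolution F (set N) n"
  shows "linear_invariant F (ts @ [t]) (n # N)"
proof -
  have "linear_derivation w_resolution F (n # N)"
    using assms(1,2,4) by (auto simp: linear_invariant_def)
  moreover have "length (n # N) \<le> length (ts @ [t])"
    using assms(1) by (simp add: linear_invariant_def)
  moreover have "\<forall>m \<in> set (n # N). node_id m < fresh_id (n # N)"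
  proof
    fix m assume "m \<in> set (n # N)"
    then have "node_id m \<le> node_id n"
      using assms(1,2) by (auto simp: linear_invariant_def less_imp_le)
    then show "node_id m < fresh_id (n # N)" by (simp add: fresh_id_def)
  qed
  moreover have "\<forall>s \<in> set (ts @ [t]). \<exists>m \<in> set (n # N). set (node_clause m) = set (ltree_clause s)"
    using assms(1,3) by (auto simp: linear_invariant_def)
  ultimately show ?thesis unfolding linear_invariant_def by blast
qed

lemma add_step_correct:
  assumes inv: "linear_invariant F ts N" and adm: "admissible F ts t"
  shows "linear_invariant F (ts @ [t]) (add_step t N)"
proof (cases "find_clause (ltree_clause t) N")
  case (Some n)
  then have n: "n \<in> set N" "set (node_clause n) = set (ltree_clause t)" using find_clause_Some by blast+
  have "add_step t N = N" using Some by (simp add: add_step_def)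
  moreover have "\<forall>s \<in> set (ts @ [t]). \<exists>m \<in> set N. set (node_clause m) = set (ltree_clause s)"
    using inv n by (auto simp: linear_invariant_def)
  ultimately show ?thesis using inv by (simp add: linear_invariant_def)
next
  case None
  have mem: "\<exists>n \<in> set N. set (node_clause n) = set (ltree_clause s)" if "s \<in> set ts" for s
    using inv that by (simp add: linear_invariant_def)
  \<comment> \<open>The clause of \<open>t\<close> is new. In particular, if \<open>t\<close> is a
    leaf, it cannot be a lemma and must be an initial clause.\<close>
  have new: "s \<notin> set ts" if "set (ltree_clause s) = set (ltree_clause t)" for s
    using mem find_clause_None[OF None] that by metis
  show ?thesis
  proof (cases t)
    case (LLeaf c)
    have "fset_of_list c \<in> F" "distinct c"
      using adm new by (auto simp: admissible_def LLeaf)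
    then have "justified w_resolution F (set N) (Node (fresh_id N) c None [])"
      by (simp add: justified_def)
    then have "linear_invariant F (ts @ [t]) (Node (fresh_id N) c None [] # N)"
      by (intro linear_invariant_add[OF inv]) (simp_all add: LLeaf)
    then show ?thesis using None by (simp add: add_step_def LLeaf)
  next
    case (LInfer x c l r)
    have lr: "l \<in> set ts" "r \<in> set ts" "distinct c" "infers w_resolution x
        (fset_of_list (ltree_clause l)) (fset_of_list (ltree_clause r)) (fset_of_list c)"
      using adm by (simp_all add: admissible_def LInfer)
    obtain a where a: "find_clause (ltree_clause l) N = Some a"
      using mem[OF lr(1)] find_clause_None by (cases "find_clause (ltree_clause l) N") auto
    obtain b where b: "find_clause (ltree_clause r) N = Some b"
      using mem[OF lr(2)] find_clause_None by (cases "find_clause (ltree_clause r) N") auto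
    have a': "a \<in> set N" "clause_of_node a = fset_of_list (ltree_clause l)"
      using find_clause_Some[OF a] by (simp_all add: fset_of_list_eq_iff)
    have b': "b \<in> set N" "clause_of_node b = fset_of_list (ltree_clause r)"
      using find_clause_Some[OF b] by (simp_all add: fset_of_list_eq_iff)
    \<comment> \<open>Otherwise the conclusion would equal the common premise and its clause would
      have been found in \<open>N\<close>.\<close>
    have "node_id a \<noteq> node_id b"
    proof
      assume "node_id a = node_id b"
      moreover have "linear_derivation w_resolution F N" using inv by (simp add: linear_invariant_def)
      ultimately have "a = b" using linear_unique a'(1) b'(1) by blast
      then have "fset_of_list c = clause_of_node a"
        using infers_w_same lr(4) a'(2) b'(2) by metis
      then show False
        using find_clause_None[OF None a'(1)] by (simp add: LInfer fset_of_list_eq_iff)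
    qed
    then have "justified w_resolution F (set N) (Node (fresh_id N) c (Some x) [node_id a, node_id b])"
      unfolding justified_def using lr(3,4) a' b'
      by (intro conjI disjI2 exI[of _ x] bexI[of _ a] bexI[of _ b]) simp_all
    then have "linear_invariant F (ts @ [t]) (Node (fresh_id N) c (Some x) [node_id a, node_id b] # N)"
      by (intro linear_invariant_add[OF inv]) (simp_all add: LInfer)
    then show ?thesis using None a b by (simp add: add_step_def LInfer)
  qed
qed

lemma linearize_correct:
  assumes "tree_derivation w_resolution L F (rtree_of t) {||}" "distinct_clauses t"
  shows "linear_derivation w_resolution F (linearize t)" "\<exists>n \<in> set (linearize t). node_clause n = []"
    "length (linearize t) \<le> length (postorder (rtree_of t))"
proof -
  let ?ts = "ltree_postorder t"
  note der = assms(1)[unfolded tree_derivation_def postorder_rtree_of length_map]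
  have adm: "admissible F (take i ?ts) (?ts ! i)" if i: "i < length ?ts" for i
  proof -
    have mem: "?ts ! i \<in> set ?ts" using i by simp
    have correct: "correct_inferences w_resolution (rtree_of (?ts ! i))"
      using ltree_postorder_mem(1)[OF mem] der by blast
    have dist: "distinct_clauses (?ts ! i)" using ltree_postorder_mem(2)[OF mem assms(2)] .
    show ?thesis
    proof (cases "?ts ! i")
      case (LLeaf c)
      then have "map rtree_of ?ts ! i = Leaf (fset_of_list c)" using i by simp
      then have "fset_of_list c \<in> F \<or>
          (\<exists>j < i. conclusion (map rtree_of ?ts ! j) = fset_of_list c)"
        using der i by blast
      then show ?thesis
      proof
        assume "fset_of_list c \<in> F"
        then show ?thesis using LLeaf dist by (simp add: admissible_def)
      next
        assume "\<exists>j < i. conclusion (map rtree_of ?ts ! j) = fset_of_list c"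
        then obtain j where j: "j < i" "conclusion (map rtree_of ?ts ! j) = fset_of_list c" by blast
        then have "set (ltree_clause (?ts ! j)) = set c"
          using i by (simp add: conclusion_rtree_of fset_of_list_eq_iff)
        moreover have "?ts ! j \<in> set (take i ?ts)"
          using i j(1) by (auto simp: in_set_conv_nth)
        ultimately show ?thesis using LLeaf dist by (auto simp: admissible_def)
      qed
    next
      case (LInfer x c l r)
      then show ?thesis
        using children_in_ltree_postorder[OF i LInfer] correct dist
        by (simp add: admissible_def conclusion_rtree_of)
    qed
  qed
  have "linear_invariant F (take i ?ts) (fold add_step (take i ?ts) [])" if "i \<le> length ?ts" for i
    using that
  proof (induction i)
    case (Suc i)
    then show ?case
      using add_step_correct[OF _ adm[of i]] by (simp add: take_Suc_conv_app_nth)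
  qed (simp add: linear_invariant_def)
  from this[of "length ?ts"] have inv: "linear_invariant F ?ts (linearize t)"
    by (simp add: linearize_def subtrees_postorder)
  then show "linear_derivation w_resolution F (linearize t)"
    "length (linearize t) \<le> length (postorder (rtree_of t))"
    by (simp_all add: linear_invariant_def postorder_rtree_of)
  obtain n where "n \<in> set (linearize t)" "set (node_clause n) = set (ltree_clause t)"
    using inv root_in_ltree_postorder[of t] by (auto simp: linear_invariant_def)
  moreover have "fset_of_list (ltree_clause t) = fset_of_list []"
    using der by (simp add: conclusion_rtree_of)
  ultimately show "\<exists>n \<in> set (linearize t). node_clause n = []"
    unfolding fset_of_list_eq_iff by auto
qed


section \<open>Simulations\<close>

lemma p_simulatedI:
  fixes p :: "nat poly"
  assumes comp: "poly_computable UNIV v w"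
    and sim: "\<And>F \<pi> u. refutes Q \<pi> F \<Longrightarrow> encodes Q u \<pi> \<Longrightarrow>
      \<exists>x \<rho>. u = v x \<and> encodes R (w x) \<rho> \<and> refutes R \<rho> F \<and>
        proof_size R \<rho> \<le> poly p (proof_size Q \<pi>)"
  shows "Q \<le>\<^sub>p R"
proof -
  obtain e lib b where b: "poly_fun b" and code: "\<And>x. code_computes e lib b (v x) (w x)"
    using comp unfolding poly_computable_def by blast
  obtain q0 where q0: "b = poly q0" using b unfolding poly_fun_def by blast
  \<comment> \<open>The main function occupies index \<open>0\<close>, so the library is placed at
    position \<open>1\<close>.\<close>
  define P where "P = e 1 # lib 1"
  define q where "q = [:2:] + q0"
  have run: "\<exists>t. runs P (v x) (w x) t \<and> t \<le> poly q (cells (v x)) \<and> cells (w x) \<le> poly q (cells (v x))" for x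
  proof -
    obtain t where t: "t \<le> b (cells (v x))" "evaluates P [v x] (e 1) (w x) t"
      using code_computesD[OF code, of P "[e 1]" "[]" 1] by (auto simp: P_def)
    have P0: "0 < length P" "P ! 0 = e 1" by (simp_all add: P_def)
    have "runs P (v x) (w x) (1 + 1 + t)"
      unfolding runs_def
      by (rule evaluates_Call_unary[OF evaluates_Arg_0 P0(1)]) (simp only: P0 t(2))
    moreover have "1 + 1 + t \<le> poly q (cells (v x))" using t(1) by (simp add: q_def q0)
    moreover have "cells (w x) \<le> poly q (cells (v x))"
      using code_computes_size[OF code, of x] by (simp add: q_def q0)
    ultimately show ?thesis by blast
  qed
  have "polytime_on {u. \<exists>F \<pi>. refutes Q \<pi> F \<and> encodes Q u \<pi>} P"
    unfolding polytime_on_def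
  proof (intro exI[of _ q] ballI)
    fix u assume "u \<in> {u. \<exists>F \<pi>. refutes Q \<pi> F \<and> encodes Q u \<pi>}"
    then obtain x where "u = v x" using sim by blast
    then show "\<exists>w t. runs P u w t \<and> t \<le> poly q (cells u) \<and> cells w \<le> poly q (cells u)"
      using run[of x] by blast
  qed
  moreover have "\<exists>w t \<rho>. runs P u w t \<and> encodes R w \<rho> \<and> refutes R \<rho> F \<and>
      proof_size R \<rho> \<le> poly p (proof_size Q \<pi>)" if "refutes Q \<pi> F" "encodes Q u \<pi>" for F \<pi> u
    using sim[OF that] run by blast
  ultimately show ?thesis unfolding p_simulated_by_def by blast
qed

lemma p_simulated_subsystem:
  assumes "\<And>F \<pi>. refutes Q \<pi> F \<Longrightarrow> refutes R \<pi> F" "encodes R = encodes Q" "proof_size R = proof_size Q"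
  shows "Q \<le>\<^sub>p R"
proof (rule p_simulatedI[where p = "[:0, 1:]"])
  show "poly_computable UNIV (\<lambda>u. u) (\<lambda>u. u)" by (rule poly_computable_id)
qed (use assms in auto)

lemma p_simulated_polytime:
  fixes p :: "nat poly"
  assumes "polytime_fun f"
    and "\<And>F \<pi> u. refutes Q \<pi> F \<Longrightarrow> encodes Q u \<pi> \<Longrightarrow>
      \<exists>x \<rho>. u = enc x \<and> encodes R (enc (f x)) \<rho> \<and> refutes R \<rho> F \<and>
        proof_size R \<rho> \<le> poly p (proof_size Q \<pi>)"
  shows "Q \<le>\<^sub>p R"
  using p_simulatedI[OF assms(1)[unfolded polytime_fun_def] assms(2)] .

lemma dag_derivation_w:
  assumes "dag_derivation resolution F G C"
  shows "dag_derivation w_resolution F G C"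
proof -
  have "(preds G u = {} \<and> var_of G u = None \<and> clause_of G u \<in> F) \<or>
      (\<exists>p q x. p \<noteq> q \<and> preds G u = {p, q} \<and> var_of G u = Some x \<and>
         infers w_resolution x (clause_of G p) (clause_of G q) (clause_of G u))"
    if "u \<in> nodes G" for u
    using assms that
  proof (cases rule: dag_derivation_node)
    case initial
    then show ?thesis by simp
  next
    case (inference p q x)
    then show ?thesis
      using infers_resolution_w by (intro disjI2 exI[of _ p] exI[of _ q] exI[of _ x]) simp
  qed
  moreover have "finite (nodes G)" "edges G \<subseteq> nodes G \<times> nodes G" "acyclic (edges G)"
    "\<exists>r. {u \<in> nodes G. succs G u = {}} = {r} \<and> clause_of G r = C"
    using assms by (simp_all add: dag_derivation_def)
  ultimately show ?thesis unfolding dag_derivation_def by (intro conjI ballI)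
qed

lemma tree_derivation_w:
  assumes "tree_derivation resolution L F T C"
  shows "tree_derivation w_resolution L F T C"
proof -
  have "correct_inferences resolution T \<Longrightarrow> correct_inferences w_resolution T" for T
    by (induction T) (auto intro: infers_resolution_w)
  then show ?thesis using assms unfolding tree_derivation_def by blast
qed

lemma tree_derivation_mono:
  "tree_derivation R L F T C \<Longrightarrow> (\<And>s. L s \<Longrightarrow> L' s) \<Longrightarrow> tree_derivation R L' F T C"
  unfolding tree_derivation_def by blast

text \<open>The common first stage of both simulations of \<open>regWRD\<close>. \<open>E\<close> is
  the transitive closure of the original edges, since an edge of the new derivation is a path of the
  old one; \<open>V\<close> is the original labeling.\<close>

lemma dag_to_strict_linear:
  assumes "dag_derivation w_resolution F G {||}" "regular_dag G" "represents N G"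
  obtains E V where "linear_derivation resolution F (strict_resolution (topo_sort N))"
    "placed E V (strict_resolution (topo_sort N))" "regular_rel E V"
    "length (strict_resolution (topo_sort N)) \<le> card (nodes G)"
    "\<exists>r \<in> set (strict_resolution (topo_sort N)). node_clause r = []"
proof -
  let ?M = "topo_sort N" and ?E = "edges G" and ?V = "var_of G"
  have lin: "linear_derivation w_resolution F ?M" and set: "set ?M = set N"
    using topo_sort_correct[OF assms(3,1)] by blast+
  have placed: "placed ?E ?V ?M"
    unfolding placed_def set using representsD[OF assms(3)] by (auto simp: preds_def)
  have E: "?E \<subseteq> nodes G \<times> nodes G"
    using assms(1) by (simp add: dag_derivation_def)
  obtain s where "{u \<in> nodes G. succs G u = {}} = {s}" "clause_of G s = {||}"
    using assms(1) unfolding dag_derivation_def by blast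
  then have "s \<in> node_id ` set N" "clause_of G s = {||}"
    using assms(3) unfolding represents_def by blast+
  then obtain n where n: "n \<in> set N" "clause_of G (node_id n) = {||}" by blast
  then have "clause_of_node n = fset_of_list []" using representsD(2)[OF assms(3) n(1)] by simp
  then have empty: "node_clause n = []" unfolding fset_of_list_eq_iff by simp
  note strict = strict_resolution_correct[OF lin placed n(1)[folded set] empty]
  have "distinct ?M" "distinct N"
    using linear_distinct[OF lin] assms(3) by (auto simp: represents_def distinct_map)
  then have "length ?M = length N"
    using set distinct_card by metis
  moreover have "length N = card (nodes G)"
    using assms(3) distinct_card[of "map node_id N"] by (simp add: represents_def)
  ultimately have "length (strict_resolution ?M) \<le> card (nodes G)" using strict(3) by simp
  moreover have "regular_rel (?E\<^sup>+) ?V"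
    by (rule regular_rel_mono[OF regular_dag_imp_rel[OF E assms(2)] subset_refl])
  ultimately show thesis using that strict(1,2,4) by blast
qed

lemma card_nodes_graph_of: "card (nodes (graph_of N)) \<le> length N"
proof -
  have "card (node_id ` set N) \<le> card (set N)" by (rule card_image_le) simp
  then show ?thesis using card_length[of N] by (simp add: graph_of_def)
qed

text \<open>Representing a node by a premise may leave other nodes without successors, so pruning
  has to restore the unique sink. No stage increases the number of nodes, whence the identity
  polynomial.\<close>

lemma regWRD_le_regRD: "regWRD \<le>\<^sub>p regRD"
proof (rule p_simulated_polytime[where p = "[:0, 1:]"])
  let ?f = "\<lambda>N. prune (strict_resolution (topo_sort N))"
  show "polytime_fun ?f"
    by (intro polytime_fun_compose[OF polytime_fun_prune]
        polytime_fun_compose[OF polytime_fun_strict_resolution] polytime_fun_topo_sort)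
  fix F G u
  assume "refutes regWRD G F" "encodes regWRD u G"
  then have der: "dag_derivation w_resolution F G {||}" "regular_dag G" and "encodes_dag u G"
    by (simp_all add: regWRD_def dag_system_def)
  then obtain N where N: "u = enc N" "represents N G" using encodes_dag_represents by blast
  from dag_to_strict_linear[OF der N(2)] obtain E V r where
    S: "linear_derivation resolution F (strict_resolution (topo_sort N))"
    "placed E V (strict_resolution (topo_sort N))" "regular_rel E V"
    "length (strict_resolution (topo_sort N)) \<le> card (nodes G)"
    and r: "r \<in> set (strict_resolution (topo_sort N))" "node_clause r = []" by metis
  note prune = prune_correct[OF S(1,2) r]
  have "encodes_dag (enc (?f N)) (graph_of (?f N))"
    using encodes_dag_represents represents_graph_of[OF prune(1)] by blast
  moreover have "card (nodes (graph_of (?f N))) \<le> card (nodes G)"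
    using card_nodes_graph_of[of "?f N"] prune(3) S(4) by linarith
  ultimately show "\<exists>N \<rho>. u = enc N \<and> encodes regRD (enc (?f N)) \<rho> \<and> refutes regRD \<rho> F \<and>
      proof_size regRD \<rho> \<le> poly [:0, 1:] (proof_size regWRD G)"
    using N(1) prune(4) graph_of_regular[OF prune(1,2) S(3)]
    by (intro exI[of _ N] exI[of _ "graph_of (?f N)"]) (simp add: regRD_def regWRD_def dag_system_def)
qed

lemma regWRD_le_regRTI: "regWRD \<le>\<^sub>p regRTI"
\<comment> \<open>A tree with at most \<open>n * n\<close> inferences has at most
  \<open>2 * (n * n) + 1\<close> nodes. Pruning is omitted, as the search reaches only what its root
  requires.\<close>
proof (rule p_simulated_polytime[where p = "[:1, 0, 2:]"])
  let ?f = "\<lambda>N. unfold_dag (strict_resolution (topo_sort N))"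
  show "polytime_fun ?f"
    by (intro polytime_fun_compose[OF polytime_fun_unfold_dag]
        polytime_fun_compose[OF polytime_fun_strict_resolution] polytime_fun_topo_sort)
  fix F G u
  assume "refutes regWRD G F" "encodes regWRD u G"
  then have der: "dag_derivation w_resolution F G {||}" "regular_dag G" and "encodes_dag u G"
    by (simp_all add: regWRD_def dag_system_def)
  then obtain N where N: "u = enc N" "represents N G" using encodes_dag_represents by blast
  let ?S = "strict_resolution (topo_sort N)" and ?n = "card (nodes G)"
  from dag_to_strict_linear[OF der N(2)] obtain E V where
    S: "linear_derivation resolution F ?S" "placed E V ?S" "regular_rel E V" "length ?S \<le> ?n"
    "\<exists>r \<in> set ?S. node_clause r = []" by metis
  note unfold = unfold_dag_correct[OF S(1,2,3,5)]
  have "encodes_tree (enc (?f N)) (rtree_of (?f N))"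
    unfolding encodes_tree_enc using unfold(3) by blast
  moreover have "length ?S * length ?S \<le> ?n * ?n" using S(4) by (rule mult_le_mono) fact
  then have "length (postorder (rtree_of (?f N))) \<le> poly [:1, 0, 2:] ?n"
    using unfold(4) by simp
  ultimately show "\<exists>N \<rho>. u = enc N \<and> encodes regRTI (enc (?f N)) \<rho> \<and> refutes regRTI \<rho> F \<and>
      proof_size regRTI \<rho> \<le> poly [:1, 0, 2:] (proof_size regWRD G)"
    using N(1) unfold(1,2)
    by (intro exI[of _ N] exI[of _ "rtree_of (?f N)"])
      (simp add: regRTI_def regWRD_def dag_system_def tree_system_def)
qed

lemma regWRTL_le_RD: "regWRTL \<le>\<^sub>p RD"
proof (rule p_simulated_polytime[where p = "[:0, 1:]"])
  let ?f = "\<lambda>t. prune (strict_resolution (linearize t))"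
  show "polytime_fun ?f"
    by (intro polytime_fun_compose[OF polytime_fun_prune]
        polytime_fun_compose[OF polytime_fun_strict_resolution] polytime_fun_linearize)
  fix F T u
  assume "refutes regWRTL T F" "encodes regWRTL u T"
  then have der: "tree_derivation w_resolution (\<lambda>_. True) F T {||}" and "encodes_tree u T"
    by (simp_all add: regWRTL_def tree_system_def)
  then obtain t where t: "u = enc t" "rtree_of t = T" "distinct_clauses t"
    using encodes_tree_enc by blast
  note lin = linearize_correct[OF der[folded t(2)] t(3)]
  obtain n where n: "n \<in> set (linearize t)" "node_clause n = []" using lin(2) by blast
  \<comment> \<open>The target \<open>RD\<close> makes no demand of regularity, so every pair of
    names may count as an edge; only the labeling must fit.\<close>
  have "placed UNIV (var_of (graph_of (linearize t))) (linearize t)"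
    using graph_of_linear(3)[OF lin(1)] by (simp add: placed_def)
  note strict = strict_resolution_correct[OF lin(1) this n]
  obtain r where r: "r \<in> set (strict_resolution (linearize t))" "node_clause r = []"
    using strict(4) by blast
  note prune = prune_correct[OF strict(1,2) r]
  have "encodes_dag (enc (?f t)) (graph_of (?f t))"
    using encodes_dag_represents represents_graph_of[OF prune(1)] by blast
  moreover have "card (nodes (graph_of (?f t))) \<le> length (postorder T)"
    using card_nodes_graph_of[of "?f t"] prune(3) strict(3) lin(3) t(2) by simp
  ultimately show "\<exists>t \<rho>. u = enc t \<and> encodes RD (enc (?f t)) \<rho> \<and> refutes RD \<rho> F \<and>
      proof_size RD \<rho> \<le> poly [:0, 1:] (proof_size regWRTL T)"
    using t(1) prune(4)
    by (intro exI[of _ t] exI[of _ "graph_of (?f t)"])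
      (simp add: RD_def regWRTL_def dag_system_def tree_system_def)
qed

theorem theorem3p5:
  shows "regRD \<equiv>\<^sub>p regWRD \<and> regWRD \<le>\<^sub>p regRTI \<and> regRTI \<le>\<^sub>p regRTL \<and>
         regRTL \<le>\<^sub>p regWRTL \<and> regWRTL \<le>\<^sub>p RD \<and>
         regRTI \<le>\<^sub>p regWRTI \<and> regWRTI \<le>\<^sub>p regWRTL"
proof -
  \<comment> \<open>This and the remaining four simulations are inclusions, realized by the
    identity: resolution is a special case of w-resolution, and admitting more nodes as lemmas only
    enlarges a system.\<close>
  have "regRD \<le>\<^sub>p regWRD"
    by (rule p_simulated_subsystem) (auto simp: regRD_def regWRD_def dag_system_def intro: dag_derivation_w)
  moreover have "regRTI \<le>\<^sub>p regRTL" "regWRTI \<le>\<^sub>p regWRTL"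
    by (rule p_simulated_subsystem;
        auto simp: regRTI_def regRTL_def regWRTI_def regWRTL_def tree_system_def elim: tree_derivation_mono)+
  moreover have "regRTL \<le>\<^sub>p regWRTL" "regRTI \<le>\<^sub>p regWRTI"
    by (rule p_simulated_subsystem;
        auto simp: regRTI_def regRTL_def regWRTI_def regWRTL_def tree_system_def intro: tree_derivation_w)+
  ultimately show ?thesis
    using regWRD_le_regRD regWRD_le_regRTI regWRTL_le_RD unfolding p_equivalent_def by blast
qed

end
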